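(* Let $d\ge2$, $\nu>0$, and let $u$ be the strong solution to the incompressible Navier–Stokes equations with maximal lifetime $T_{max}>0$ and initial value $u_0\in L^\infty(\mathbb R^d)$ satisfying, for some constants $C,\sigma>0$, $|u_0(x)|\le C\,G_{\nu\sigma}(x)$ for a.e. $x\in\mathbb R^d$. Then for any fixed $t\in(0,T_{max})$, $$u(x,t)=o_t\big(|x|^{-d-1}\big)\quad\text{as }|x|\to\infty$$ if and only if $$\langle u^i,u^j\rangle_{2,t}=\frac{\|u\|_{2,t}^2}{d}\,\delta_{i,j}\quad\text{for all }i,j\in\{1,\dots,d\}.$$
   Context: $G_t(x)=(4\pi t)^{-d/2}e^{-|x|^2/(4t)}$. $\langle f,g\rangle_{2,t}:=\langle f,g\rangle_{L^2((0,t)\times\mathbb R^d)}$ is the usual $L^2$ inner product and $\|\cdot\|_{2,t}$ the corresponding norm (for the vector field $u$, $\|u\|_{2,t}^2=\sum_i\langle u^i,u^i\rangle_{2,t}$). The subscript in $o_t$ means $t$ is fixed. The incompressible Navier–Stokes system on $\mathbb R^d$ with viscosity $\nu>0$ is $\partial_tu+\mathrm{div}(u\otimes u)+\nabla p=\nu\Delta u$, $\mathrm{div}\,u=0$. For $d\le p\le\infty$, $u\in C([0,T);L^p)$ is the strong (mild) solution arising from $u_0\in L^p$ if $$u(x,t)=G_{\nu t}*u_0(x)-\int_0^tG_{\nu(t-s)}*\mathcal P\,\mathrm{div}\big(u(s)\otimes u(s)\big)(x)\,ds$$ holds in $C([0,T);L^p)$ and for a.e. $(x,t)\in\mathbb R^d\times[0,T)$,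 where $\mathcal P=\mathrm{Id}+\nabla(-\Delta)^{-1}\mathrm{div}$ is the Leray projector. For $u_0\in L^\infty$ the maximal lifespan (lifetime) is $T_{max}:=\sup\{T>0:\ \text{there exists a unique solution }u\in C([0,T];L^\infty)\text{ with }u(0)=u_0\}$. *)

theory Defs
  imports
    "HOL-Analysis.Analysis"
    "HOL-Library.Landau_Symbols"
    "HOL-Probability.Essential_Supremum"
begin

text \<open>
  Space is \<open>real ^ 'n\<close> with \<open>d = CARD('n)\<close>. All integrals are taken with respect to the complete
  measure \<^const>\<open>lebesgue\<close>, so that Lebesgue measurable (not necessarily Borel) functions are
  integrated properly.
\<close>

definition heat_kernel :: "real \<Rightarrow> real ^ 'n \<Rightarrow> real" where
  "heat_kernel t x =
     (4 * pi * t) powr (- (real CARD('n) / 2)) * exp (- ((norm x)\<^sup>2 / (4 * t)))"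

definition heat_flow :: "real \<Rightarrow> (real ^ 'n \<Rightarrow> real ^ 'n) \<Rightarrow> real ^ 'n \<Rightarrow> real ^ 'n" where
  "heat_flow t f x = (LINT y|lebesgue. heat_kernel t (x - y) *\<^sub>R f y)"


subsection \<open>The Leray projector\<close>

definition partial_deriv :: "'n \<Rightarrow> (real ^ 'n \<Rightarrow> real) \<Rightarrow> real ^ 'n \<Rightarrow> real" where
  "partial_deriv k f x = deriv (\<lambda>h. f (x + h *\<^sub>R axis k 1)) 0"

definition gradient :: "(real ^ 'n \<Rightarrow> real) \<Rightarrow> real ^ 'n \<Rightarrow> real ^ 'n" where
  "gradient f x = (\<chi> k. partial_deriv k f x)"

definition divergence :: "(real ^ 'n \<Rightarrow> real ^ 'n) \<Rightarrow> real ^ 'n \<Rightarrow> real" where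
  "divergence v x = (\<Sum>k\<in>UNIV. partial_deriv k (\<lambda>y. v y $ k) x)"

definition fourier :: "(real ^ 'n \<Rightarrow> complex) \<Rightarrow> real ^ 'n \<Rightarrow> complex" where
  "fourier f \<xi> = (LINT x|lebesgue. cis (- (\<xi> \<bullet> x)) * f x)"

definition inv_fourier :: "(real ^ 'n \<Rightarrow> complex) \<Rightarrow> real ^ 'n \<Rightarrow> complex" where
  "inv_fourier g x = (LINT \<xi>|lebesgue. cis (\<xi> \<bullet> x) * g \<xi>) / of_real ((2 * pi) ^ CARD('n))"

text \<open>
  The operator \<open>(- \<Delta>)\<^sup>-\<^sup>1\<close> is the Fourier multiplier \<open>1 / \<bar>\<xi>\<bar>\<^sup>2\<close>; it maps real functions to real
  functions, so taking the real part only adjusts the type.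
\<close>

definition inv_neg_laplacian :: "(real ^ 'n \<Rightarrow> real) \<Rightarrow> real ^ 'n \<Rightarrow> real" where
  "inv_neg_laplacian f x =
     Re (inv_fourier (\<lambda>\<xi>. fourier (\<lambda>y. of_real (f y)) \<xi> / of_real ((norm \<xi>)\<^sup>2)) x)"

definition leray :: "(real ^ 'n \<Rightarrow> real ^ 'n) \<Rightarrow> real ^ 'n \<Rightarrow> real ^ 'n" where
  "leray v x = v x + gradient (inv_neg_laplacian (divergence v)) x"

text \<open>
  For a bounded tensor field \<open>F\<close>, \<open>div F\<close> is only a distribution, with \<open>j\<close>-th component
  \<open>\<Sum>k. \<partial>\<^sub>k F\<^sub>j\<^sub>k\<close>. As usual, \<open>G\<^sub>t * P div F\<close> is understood by letting \<open>P\<close> and the derivatives act on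
  the Gaussian: it is the sum over \<open>j, k\<close> of the convolutions of \<open>F\<^sub>j\<^sub>k\<close> with the integrable field
  \<open>P (\<partial>\<^sub>k G\<^sub>t e\<^sub>j)\<close>, on which \<^term>\<open>leray\<close> is given by absolutely convergent integrals.
\<close>

definition heat_leray_div ::
    "real \<Rightarrow> (real ^ 'n \<Rightarrow> real ^ 'n ^ 'n) \<Rightarrow> real ^ 'n \<Rightarrow> real ^ 'n" where
  "heat_leray_div t F x =
     (\<Sum>j\<in>UNIV. \<Sum>k\<in>UNIV. LINT y|lebesgue.
        (F y $ j $ k) *\<^sub>R leray (\<lambda>z. partial_deriv k (heat_kernel t) z *\<^sub>R axis j 1) (x - y))"

definition tensor :: "real ^ 'n \<Rightarrow> real ^ 'n \<Rightarrow> real ^ 'n ^ 'n" where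
  "tensor a b = (\<chi> j k. a $ j * b $ k)"


subsection \<open>Mild solutions with values in \<open>L\<^sup>\<infinity>\<close>\<close>

definition Linf_norm :: "(real ^ 'n \<Rightarrow> real ^ 'n) \<Rightarrow> ereal" where
  "Linf_norm f = esssup lebesgue (\<lambda>x. ereal (norm (f x)))"

definition Linf :: "(real ^ 'n \<Rightarrow> real ^ 'n) set" where
  "Linf = {f \<in> borel_measurable lebesgue. Linf_norm f < \<infinity>}"

definition continuous_Linf :: "real set \<Rightarrow> (real \<Rightarrow> real ^ 'n \<Rightarrow> real ^ 'n) \<Rightarrow> bool" where
  "continuous_Linf I u \<longleftrightarrow>
     (\<forall>t\<in>I. u t \<in> Linf) \<and>
     (\<forall>t\<in>I. ((\<lambda>s. Linf_norm (\<lambda>x. u s x - u t x)) \<longlongrightarrow> 0) (at t within I))"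

text \<open>
  A path in \<open>L\<^sup>\<infinity>\<close> is represented by a jointly measurable function of time and space; this makes the
  space-time integrals meaningful. The Duhamel formula is an identity in \<open>L\<^sup>\<infinity>\<close> for every time, hence
  by Fubini also one for almost every \<open>(x, t)\<close>. At time \<open>0\<close>, where the heat kernel is the Dirac mass
  and \<^term>\<open>heat_kernel 0\<close> is meaningless, it reads \<open>u(0) = u\<^sub>0\<close>.
\<close>

definition mild_solution ::
    "real \<Rightarrow> (real ^ 'n \<Rightarrow> real ^ 'n) \<Rightarrow> real set \<Rightarrow> (real \<Rightarrow> real ^ 'n \<Rightarrow> real ^ 'n) \<Rightarrow> bool" where
  "mild_solution \<nu> u0 I u \<longleftrightarrow>
     (\<lambda>(t, x). u t x) \<in> borel_measurable (lebesgue_on (I \<times> UNIV)) \<and>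
     continuous_Linf I u \<and>
     (AE x in lebesgue. u 0 x = u0 x) \<and>
     (\<forall>t\<in>I. t > 0 \<longrightarrow>
        (AE x in lebesgue. u t x =
           heat_flow (\<nu> * t) u0 x
           - (LINT s:{0..t}|lebesgue.
                heat_leray_div (\<nu> * (t - s)) (\<lambda>y. tensor (u s y) (u s y)) x)))"

definition lifespan :: "real \<Rightarrow> (real ^ 'n \<Rightarrow> real ^ 'n) \<Rightarrow> ereal" where
  "lifespan \<nu> u0 = Sup {ereal T | T. T > 0 \<and>
     (\<exists>u. mild_solution \<nu> u0 {0..T} u \<and>
        (\<forall>v. mild_solution \<nu> u0 {0..T} v \<longrightarrow>
           (\<forall>t\<in>{0..T}. AE x in lebesgue. v t x = u t x)))}"


subsection \<open>The space-time inner product\<close>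

definition L2_inner ::
    "real \<Rightarrow> (real \<Rightarrow> real ^ 'n \<Rightarrow> real) \<Rightarrow> (real \<Rightarrow> real ^ 'n \<Rightarrow> real) \<Rightarrow> real" where
  "L2_inner t f g = (LINT (s, x):{0<..<t} \<times> UNIV|lebesgue. f s x * g s x)"

definition L2_norm :: "real \<Rightarrow> (real \<Rightarrow> real ^ 'n \<Rightarrow> real ^ 'n) \<Rightarrow> real" where
  "L2_norm t u = sqrt (\<Sum>i\<in>UNIV. L2_inner t (\<lambda>s x. u s x $ i) (\<lambda>s x. u s x $ i))"

end

theory Submission
  imports Defs "HOL-Probability.Characteristic_Functions" "HOL-Real_Asymp.Real_Asymp"
begin

text \<open>
  Since \<open>\<bar>\<xi>\<bar>\<^sup>-\<^sup>2 exp (- \<tau> \<bar>\<xi>\<bar>\<^sup>2)\<close> is the integral of \<open>exp (- s \<bar>\<xi>\<bar>\<^sup>2)\<close> over \<open>s > \<tau>\<close>, the kernel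
  \<open>P (\<partial>\<^sub>k G\<^sub>\<tau> e\<^sub>j)\<close> has the components \<open>\<delta>\<^sub>i\<^sub>j \<partial>\<^sub>k G\<^sub>\<tau>\<close> plus the integral of \<open>\<partial>\<^sub>i \<partial>\<^sub>j \<partial>\<^sub>k G\<^sub>s\<close> over \<open>s > \<tau>\<close>.
  It is bounded by a multiple of \<open>(\<surd>\<tau> + \<bar>z\<bar>)\<^sup>-\<^sup>d\<^sup>-\<^sup>1\<close> and converges, at the rate \<open>\<surd>\<tau> \<bar>z\<bar>\<^sup>-\<^sup>d\<^sup>-\<^sup>2\<close>, to the kernel
  \<open>c \<bar>z\<bar>\<^sup>-\<^sup>d\<^sup>-\<^sup>2 (\<delta>\<^sub>i\<^sub>j z\<^sub>k + \<delta>\<^sub>i\<^sub>k z\<^sub>j + \<delta>\<^sub>j\<^sub>k z\<^sub>i - (d + 2) z\<^sub>i z\<^sub>j z\<^sub>k / \<bar>z\<bar>\<^sup>2)\<close>, which is homogeneous of degree \<open>- d - 1\<close>.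

  A Gronwall argument in the Duhamel formula, linearised by the bound on \<open>u\<close> in \<open>L\<^sup>\<infinity>\<close> and run with a
  truncated weight, gives \<open>\<bar>u(s, x)\<bar> \<le> A (1 + \<bar>x\<bar>)\<^sup>-\<^sup>d\<^sup>-\<^sup>1\<close> on \<open>[0, t]\<close>. Hence \<open>u \<otimes> u\<close> has a first moment, and
  the Duhamel integral equals the limit kernel contracted with the matrix of the inner products of
  the \<open>u\<^sup>i\<close>, up to \<open>O(\<bar>x\<bar>\<^sup>-\<^sup>d\<^sup>-\<^sup>2)\<close>. By homogeneity \<open>u\<close> is \<open>o(\<bar>x\<bar>\<^sup>-\<^sup>d\<^sup>-\<^sup>1)\<close> iff this contraction vanishes
  identically, and testing it on the coordinate axes shows that this happens only for multiples of
  the identity matrix.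
\<close>

section \<open>Integration over Euclidean space\<close>

text \<open>The exponent d + 1 is forced: the projection is nonlocal, so its kernel has an algebraic
  tail of this order however fast the data decay, and this is the best power weight that the Duhamel
  operator preserves. The rate in sqrt(\<tau>) rests on an exact identity: integrating the time
  derivative of G_s / s over s > \<tau> eliminates the integral of G_s / s^3, so that besides a
  boundary term only the missing piece of the integral of G_s / s^2 over (0, \<tau>) has to be
  estimated. Two matters of rigour shape the rest. A solution is given up to null sets and is
  Lebesgue measurable, not necessarily Borel; hence integrals are bounded before they are known to
  exist, and are rewritten later through Borel representatives. For the same reason \<open>u\<close>
  cannot be compared with the limit field along a ray; the comparison takes place on balls of radius
  proportional to |x|, on which the limit field, being Lipschitz at that scale, hardly
  varies.\<close>

lemma has_real_derivative_lebesgue_integral: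
  fixes f f' :: "real \<Rightarrow> 'a \<Rightarrow> real"
  assumes int: "\<And>h. integrable M (f h)"
    and der: "\<And>h x. x \<in> space M \<Longrightarrow> ((\<lambda>h. f h x) has_real_derivative f' h x) (at h)"
    and bound: "\<And>h x. x \<in> space M \<Longrightarrow> \<bar>f' h x\<bar> \<le> g x"
    and g: "integrable M g"
  shows "((\<lambda>h. \<integral>x. f h x \<partial>M) has_real_derivative (\<integral>x. f' h x \<partial>M)) (at h)"
proof -
  \<comment> \<open>The mean value inequality turns the bound on \<open>f'\<close> into domination
    of every difference quotient by \<open>g\<close>, as dominated convergence needs. The function
    \<open>f' h\<close> is measurable as the limit of these quotients.\<close>
  have lip: "\<bar>f a x - f b x\<bar> \<le> g x * \<bar>a - b\<bar>" if x: "x \<in> space M" for a b x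
  proof -
    have "norm (f a x - f b x) \<le> g x * norm (a - b)"
      by (rule field_differentiable_bound[of UNIV "\<lambda>h. f h x" "\<lambda>h. f' h x"])
        (use der[OF x] bound[OF x] in auto)
    then show ?thesis by simp
  qed
  show ?thesis
    unfolding DERIV_def tendsto_at_iff_sequentially comp_def
  proof (intro allI impI)
    fix X :: "nat \<Rightarrow> real" assume X: "\<forall>i. X i \<in> UNIV - {0}" "X \<longlonglongrightarrow> 0"
    have "(\<lambda>n. \<integral>x. (f (h + X n) x - f h x) / X n \<partial>M) \<longlonglongrightarrow> (\<integral>x. f' h x \<partial>M)"
    proof (rule integral_dominated_convergence[where w = g])
      have lim: "(\<lambda>n. (f (h + X n) x - f h x) / X n) \<longlonglongrightarrow> f' h x" if "x \<in> space M" for x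
        using der[OF that, of h] X unfolding DERIV_def tendsto_at_iff_sequentially comp_def by blast
      have m: "(\<lambda>x. (f (h + X n) x - f h x) / X n) \<in> borel_measurable M" for n
        using int[THEN borel_measurable_integrable] by measurable
      show "f' h \<in> borel_measurable M"
        by (rule borel_measurable_LIMSEQ_real[OF lim m]) 
      show "AE x in M. (\<lambda>n. (f (h + X n) x - f h x) / X n) \<longlonglongrightarrow> f' h x"
        using lim by simp
      show "AE x in M. norm ((f (h + X n) x - f h x) / X n) \<le> g x" for n
      proof (rule AE_I2)
        fix x assume "x \<in> space M"
        then have "\<bar>f (h + X n) x - f h x\<bar> \<le> g x * \<bar>X n\<bar>" using lip[of x "h + X n" h] by simp
        moreover have "X n \<noteq> 0" using X(1) by auto
        ultimately show "norm ((f (h + X n) x - f h x) / X n) \<le> g x"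
          by (simp add: divide_le_eq)
      qed
      show "(\<lambda>x. (f (h + X n) x - f h x) / X n) \<in> borel_measurable M" for n by (rule m)
    qed (rule g)
    moreover have "(\<integral>x. (f (h + X n) x - f h x) / X n \<partial>M)
        = ((\<integral>x. f (h + X n) x \<partial>M) - (\<integral>x. f h x \<partial>M)) / X n" for n
      using Bochner_Integration.integral_diff[OF int int, of "h + X n" h] by simp
    ultimately show "(\<lambda>n. ((\<integral>x. f (h + X n) x \<partial>M) - (\<integral>x. f h x \<partial>M)) / X n) \<longlonglongrightarrow> (\<integral>x. f' h x \<partial>M)"
      by (simp only:)
  qed
qed

lemma integrable_of_norm_le:
  fixes f :: "'a \<Rightarrow> 'b::{banach, second_countable_topology}" and g :: "'a \<Rightarrow> real"
  assumes "integrable M g" "f \<in> borel_measurable M" "\<And>x. norm (f x) \<le> g x"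
  shows "integrable M f"
proof (rule Bochner_Integration.integrable_bound[OF assms(1,2)])
  show "AE x in M. norm (f x) \<le> norm (g x)"
    unfolding real_norm_def by (intro AE_I2 order_trans[OF assms(3) abs_ge_self])
qed

text \<open>Fubini in all coordinates at once: \<open>lborel\<close> is by definition the image of
  the product over \<open>Basis\<close> of one-dimensional measures. The values lie in a normed
  field so that complex Gaussian integrals factor as well as real ones.\<close>

lemma lborel_integral_prod_Basis:
  fixes f :: "'a::euclidean_space \<Rightarrow> real \<Rightarrow> 'b::{real_normed_field, banach, second_countable_topology}"
  assumes int: "\<And>b. b \<in> Basis \<Longrightarrow> integrable lborel (f b)"
  shows "integrable lborel (\<lambda>x::'a. \<Prod>b\<in>Basis. f b (x \<bullet> b))"
    and "(LBINT x. (\<Prod>b\<in>Basis. f b ((x::'a) \<bullet> b))) = (\<Prod>b\<in>Basis. LBINT x. f b x)"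
proof -
  interpret product_sigma_finite "\<lambda>_::'a. lborel :: real measure" ..
  let ?P = "\<Pi>\<^sub>M b\<in>(Basis :: 'a set). (lborel :: real measure)"
  let ?T = "\<lambda>f. (\<Sum>b\<in>Basis. f b *\<^sub>R b) :: 'a"
  have lb: "lborel = distr ?P borel ?T"
    unfolding lborel_eq_real by (rule lborel_def)
  have T: "?T \<in> ?P \<rightarrow>\<^sub>M borel" by measurable
  have [measurable]: "f b \<in> borel_measurable borel" if "b \<in> Basis" for b
    using int[OF that, THEN borel_measurable_integrable] by simp
  have m: "(\<lambda>x::'a. \<Prod>b\<in>Basis. f b (x \<bullet> b)) \<in> borel_measurable borel"
    by measurable
  have eq: "(\<Prod>b\<in>Basis. f b (?T y \<bullet> b)) = (\<Prod>b\<in>Basis. f b (y b))" for y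
    by (intro prod.cong refl) simp
  show "integrable lborel (\<lambda>x::'a. \<Prod>b\<in>Basis. f b (x \<bullet> b))"
    unfolding lb by (subst integrable_distr_eq[OF T m], subst eq)
       (rule product_integrable_prod[OF finite_Basis int])
  show "(LBINT x. (\<Prod>b\<in>Basis. f b ((x::'a) \<bullet> b))) = (\<Prod>b\<in>Basis. LBINT x. f b x)"
    by (subst lb, subst integral_distr[OF T m], subst eq)
       (rule product_integral_prod[OF finite_Basis int])
qed

lemma lborel_integrable_translate_scale:
  fixes f :: "'a::euclidean_space \<Rightarrow> 'b::{banach, second_countable_topology}"
  assumes c: "c \<noteq> 0" and f: "integrable lborel f"
  shows "integrable lborel (\<lambda>x. f (t + c *\<^sub>R x))"
    and "(LBINT x. f (t + c *\<^sub>R x)) = (1 / \<bar>c\<bar> ^ DIM('a)) *\<^sub>R (LBINT x. f x)"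
proof -
  note [measurable] = borel_measurable_integrable[OF f]
  let ?D = "density (distr lborel borel (\<lambda>x. t + c *\<^sub>R x)) (\<lambda>_. ennreal (\<bar>c\<bar> ^ DIM('a)))"
  have l: "lborel = ?D"
    using lborel_affine[OF c, of t] by (simp add: ennreal_power)
  have "integrable ?D f" using f l by simp
  then have "integrable (distr lborel borel (\<lambda>x. t + c *\<^sub>R x)) (\<lambda>x. \<bar>c\<bar> ^ DIM('a) *\<^sub>R f x)"
    by (subst (asm) integrable_density) auto
  then have "integrable (distr lborel borel (\<lambda>x. t + c *\<^sub>R x))
      (\<lambda>x. (1 / \<bar>c\<bar> ^ DIM('a)) *\<^sub>R (\<bar>c\<bar> ^ DIM('a) *\<^sub>R f x))"
    by (rule integrable_scaleR_right)
  then have "integrable (distr lborel borel (\<lambda>x. t + c *\<^sub>R x)) f"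
    using c by (simp add: scaleR_scaleR)
  then show "integrable lborel (\<lambda>x. f (t + c *\<^sub>R x))"
    by (subst (asm) integrable_distr_eq) auto
  have "(LBINT x. f x) = (\<integral>x. f x \<partial>?D)" using l by simp
  also have "\<dots> = (LBINT x. \<bar>c\<bar> ^ DIM('a) *\<^sub>R f (t + c *\<^sub>R x))"
    by (subst integral_density) (auto simp: integral_distr)
  finally show "(LBINT x. f (t + c *\<^sub>R x)) = (1 / \<bar>c\<bar> ^ DIM('a)) *\<^sub>R (LBINT x. f x)"
    using c by simp
qed

text \<open>A product bound in place of polar coordinates: no coordinate exceeds the norm, so one
  d-th of the decay can be given to each coordinate, and the resulting exponent (d + 1) / d > 1
  makes every factor integrable on the line.\<close>

lemma integrable_inverse_power_norm:
  "integrable lborel (\<lambda>y::real ^ 'n. 1 / (1 + norm y) ^ (CARD('n) + 1))"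
proof -
  define a where "a = 1 + 1 / real CARD('n)"
  have a: "a > 1" by (simp add: a_def)
  have i1: "integrable lborel (\<lambda>x::real. (1 + \<bar>x\<bar>) powr - a)"
  proof -
    have pos: "set_integrable lborel {0..} (\<lambda>x::real. (1 + x) powr - a)"
    proof -
      have "((\<lambda>x. x powr - a) has_integral -(1 powr (- a + 1)) / (- a + 1)) {1..}"
        by (rule has_integral_powr_to_inf) (use a in auto)
      then have "(\<lambda>x::real. x powr - a) absolutely_integrable_on {1..}"
        by (intro nonnegative_absolutely_integrable_1) auto
      then have "integrable lebesgue (\<lambda>x::real. indicator {1..} x *\<^sub>R (x powr - a))"
        by (simp add: set_integrable_def)
      then have "integrable lborel (\<lambda>x::real. indicator {1..} x *\<^sub>R (x powr - a))"
        by (subst (asm) integrable_completion) auto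
      from lborel_integrable_translate_scale(1)[OF _ this, of 1 1]
      show ?thesis unfolding set_integrable_def
        by (rule back_subst) (auto simp: indicator_def fun_eq_iff)
    qed
    then have "integrable lborel (\<lambda>x::real. indicator {0..} x *\<^sub>R (1 + x) powr - a)"
      by (simp add: set_integrable_def)
    from lborel_integrable_translate_scale(1)[OF _ this, of "-1" 0] this
    have "integrable lborel (\<lambda>x::real. indicator {0..} x *\<^sub>R (1 + x) powr - a
       + indicator {0..} (-x) *\<^sub>R (1 - x) powr - a)" by simp
    then show ?thesis
      by (rule Bochner_Integration.integrable_bound) (auto simp: indicator_def abs_if)
  qed
  have "integrable lborel (\<lambda>y::real^'n. \<Prod>b\<in>Basis. (1 + \<bar>y \<bullet> b\<bar>) powr - a)"
    by (rule lborel_integral_prod_Basis(1)[of "\<lambda>_ x. (1 + \<bar>x\<bar>) powr - a"]) (rule i1)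
  then show ?thesis
  proof (rule Bochner_Integration.integrable_bound)
    show "AE y in lborel. norm (1 / (1 + norm y) ^ (CARD('n) + 1))
        \<le> norm (\<Prod>b\<in>Basis. (1 + \<bar>(y::real^'n) \<bullet> b\<bar>) powr - a)"
    proof (rule AE_I2)
      fix y :: "real^'n"
      have "1 / (1 + norm y) ^ (CARD('n) + 1) = (1 + norm y) powr - (real CARD('n) + 1)"
        using powr_realpow[of "1 + norm y" "CARD('n) + 1"] powr_minus_divide[of "1 + norm y" "real (CARD('n) + 1)"]
        by (simp add: add_pos_nonneg add.commute)
      also have "\<dots> = (\<Prod>b\<in>(Basis::(real^'n) set). (1 + norm y) powr - a)"
      proof -
        have "a * real CARD('n) = real CARD('n) + 1" by (simp add: a_def field_simps)
        then have "- a * real CARD('n) = - (real CARD('n) + 1)" by linarith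
        moreover have "((1 + norm y) powr - a) ^ CARD('n) = (1 + norm y) powr (- a * real CARD('n))"
          using add_pos_nonneg[OF zero_less_one norm_ge_zero, of y]
          by (subst powr_realpow[symmetric]) (simp_all add: powr_powr)
        ultimately have "((1 + norm y) powr - a) ^ CARD('n) = (1 + norm y) powr - (real CARD('n) + 1)"
          by (simp only:)
        then show ?thesis by simp
      qed
      also have "\<dots> \<le> (\<Prod>b\<in>Basis. (1 + \<bar>y \<bullet> b\<bar>) powr - a)"
        by (intro prod_mono conjI powr_mono2') (use a Basis_le_norm in auto)
      finally show "norm (1 / (1 + norm y) ^ (CARD('n) + 1))
        \<le> norm (\<Prod>b\<in>Basis. (1 + \<bar>y \<bullet> b\<bar>) powr - a)"
        by (simp add: prod_nonneg abs_of_nonneg)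
    qed
  qed (simp add: borel_measurable_divide)
qed

section \<open>Gaussian integrals\<close>

text \<open>With N = m + k both polynomial factors are absorbed by \<open>exp (N * r)\<close>, and
  completing the square bounds N r - s r^2 by N^2 / (4 s). The constants \<open>exp (N^2)\<close> in
  the kernel bounds below arise from s = 1/4.\<close>

lemma gaussian_le_inverse_power:
  fixes r s :: real
  assumes "0 \<le> r" "0 < s"
  shows "r ^ m * exp (- (s * r\<^sup>2)) \<le> exp ((real (m + k))\<^sup>2 / (4 * s)) / (1 + r) ^ k"
proof -
  let ?N = "real (m + k)"
  have "r ^ m * (1 + r) ^ k \<le> (1 + r) ^ m * (1 + r) ^ k"
    using assms by (intro mult_right_mono power_mono) auto
  also have "\<dots> = (1 + r) ^ (m + k)" by (simp add: power_add)
  also have "\<dots> \<le> exp r ^ (m + k)"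
    using assms by (intro power_mono) (auto simp: add.commute)
  also have "\<dots> = exp (?N * r)" by (rule exp_of_nat_mult[symmetric])
  finally have "r ^ m * (1 + r) ^ k * exp (- (s * r\<^sup>2)) \<le> exp (?N * r) * exp (- (s * r\<^sup>2))"
    by (rule mult_right_mono) simp
  also have "\<dots> = exp (?N * r - s * r\<^sup>2)" by (simp add: exp_diff exp_minus divide_inverse)
  also have "\<dots> \<le> exp (?N\<^sup>2 / (4 * s))"
  proof -
    have "0 \<le> (?N - 2 * s * r)\<^sup>2" by simp
    also have "\<dots> = ?N\<^sup>2 - 4 * s * (?N * r - s * r\<^sup>2)" by (simp add: power2_eq_square algebra_simps)
    finally have "?N * r - s * r\<^sup>2 \<le> ?N\<^sup>2 / (4 * s)"
      using assms(2) by (simp add: pos_le_divide_eq mult.commute)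
    then show ?thesis by simp
  qed
  finally show ?thesis using assms by (simp add: pos_le_divide_eq mult.commute mult.left_commute)
qed

lemma integrable_power_norm_gaussian:
  assumes "0 < s"
  shows "integrable lborel (\<lambda>y::real ^ 'n. norm y ^ m * exp (- (s * (norm y)\<^sup>2)))"
proof (rule Bochner_Integration.integrable_bound)
  let ?C = "exp ((real (m + (CARD('n) + 1)))\<^sup>2 / (4 * s))"
  show "integrable lborel (\<lambda>y::real ^ 'n. ?C * (1 / (1 + norm y) ^ (CARD('n) + 1)))"
    by (rule integrable_mult_right) (rule integrable_inverse_power_norm)
  show "AE y in lborel. norm (norm y ^ m * exp (- (s * (norm y)\<^sup>2)))
      \<le> norm (?C * (1 / (1 + norm (y::real^'n)) ^ (CARD('n) + 1)))"
    using gaussian_le_inverse_power[OF norm_ge_zero assms, of _ m "CARD('n) + 1"]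
    by (intro AE_I2) (simp add: abs_mult)
qed measurable

text \<open>This is the characteristic function of the standard normal law after the substitution x
  -> sqrt(2 s) x.\<close>

lemma fourier_gaussian_real:
  fixes s z :: real
  assumes "0 < s"
  shows "integrable lborel (\<lambda>x. cis (x * z) * of_real (exp (- (s * x\<^sup>2))))"
    and "(LBINT x. cis (x * z) * of_real (exp (- (s * x\<^sup>2))))
      = of_real (sqrt (pi / s) * exp (- (z\<^sup>2 / (4 * s))))"
proof -
  define t where "t = z / sqrt (2 * s)"
  have ts: "t * sqrt (2 * s) = z" using assms by (simp add: t_def)
  let ?f = "\<lambda>x. std_normal_density x *\<^sub>R iexp (t * x)"
  have int: "integrable lborel ?f"
  proof (rule Bochner_Integration.integrable_bound)
    show "integrable lborel std_normal_density"
      using integrable_std_normal_moment[of 0] by simp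
  qed (auto simp: norm_mult)
  have eq: "(LBINT x. ?f x) = of_real (exp (- (t\<^sup>2) / 2))"
    using char_std_normal_distribution
    unfolding char_def by (subst (asm) integral_density) (auto simp: fun_eq_iff)
  have c: "sqrt (2 * s) \<noteq> 0" using assms by simp
  have f: "cis (x * z) * of_real (exp (- (s * x\<^sup>2))) = sqrt (2 * pi) *\<^sub>R ?f (0 + sqrt (2 * s) *\<^sub>R x)" for x
  proof -
    have 1: "iexp (t * (sqrt (2 * s) * x)) = cis (x * z)"
    proof -
      have "t * (sqrt (2 * s) * x) = x * z" using ts by (metis mult.assoc mult.commute)
      then show ?thesis by (simp only: cis_conv_exp)
    qed
    have 2: "std_normal_density (sqrt (2 * s) * x) = exp (- (s * x\<^sup>2)) / sqrt (2 * pi)"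
      using assms by (simp add: std_normal_density_def power_mult_distrib)
    show ?thesis using 1 2 by (simp add: scaleR_conv_of_real mult.commute)
  qed
  show "integrable lborel (\<lambda>x. cis (x * z) * of_real (exp (- (s * x\<^sup>2))))"
    unfolding f by (rule integrable_scaleR_right) (rule lborel_integrable_translate_scale(1)[OF c int])
  have "(LBINT x. cis (x * z) * of_real (exp (- (s * x\<^sup>2))))
      = sqrt (2 * pi) *\<^sub>R (1 / \<bar>sqrt (2 * s)\<bar> ^ DIM(real)) *\<^sub>R of_real (exp (- (t\<^sup>2) / 2))"
    unfolding f by (subst integral_scaleR_right, subst lborel_integrable_translate_scale(2)[OF c int], subst eq) simp
  also have "\<dots> = of_real (sqrt (2 * pi) / sqrt (2 * s) * exp (- (t\<^sup>2) / 2))"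
    using assms by (simp add: scaleR_conv_of_real)
  also have "sqrt (2 * pi) / sqrt (2 * s) = sqrt (pi / s)"
    by (simp add: real_sqrt_divide[symmetric])
  also have "- (t\<^sup>2) / 2 = - (z\<^sup>2 / (4 * s))"
    using assms by (simp add: t_def power_divide)
  finally show "(LBINT x. cis (x * z) * of_real (exp (- (s * x\<^sup>2))))
      = of_real (sqrt (pi / s) * exp (- (z\<^sup>2 / (4 * s))))" .
qed

section \<open>Fourier transform of the Gaussian in d dimensions and its trigonometric
  moments\<close>

lemma cis_sum: "finite A \<Longrightarrow> cis (\<Sum>i\<in>A. f i) = (\<Prod>i\<in>A. cis (f i))"
  by (induction rule: finite_induct) (simp_all flip: cis_mult)

text \<open>The Fourier transform of exp(-s |x|^2), as \<open>integral_cos_gaussian\<close>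
  confirms. Up to the factor (2 pi)^d it is also the heat kernel at time \<open>s\<close>, which is
  why its derivatives in \<open>z\<close> serve both purposes.\<close>

definition gauss_transform :: "real \<Rightarrow> real ^ 'n \<Rightarrow> real" where
  "gauss_transform s z = sqrt (pi / s) ^ CARD('n) * exp (- ((norm z)\<^sup>2 / (4 * s)))"

lemma integral_cos_gaussian:
  fixes z :: "real ^ 'n"
  assumes "0 < s"
  shows "(LBINT x. cos (x \<bullet> z) * exp (- (s * (norm x)\<^sup>2))) = gauss_transform s z"
proof -
  let ?f = "\<lambda>b x. cis (x * (z \<bullet> b)) * complex_of_real (exp (- (s * x\<^sup>2)))"
  have sq: "(norm x)\<^sup>2 = (\<Sum>b\<in>Basis. (x \<bullet> b)\<^sup>2)" for x :: "real^'n"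
    unfolding power2_norm_eq_inner by (subst euclidean_inner) (simp add: power2_eq_square)
  have eq: "cis (x \<bullet> z) * complex_of_real (exp (- (s * (norm x)\<^sup>2))) = (\<Prod>b\<in>Basis. ?f b (x \<bullet> b))" for x :: "real^'n"
    unfolding sq by (subst euclidean_inner)
      (simp add: cis_sum prod.distrib sum_distrib_left exp_sum sum_negf[symmetric] del: of_real_exp)
  have int: "integrable lborel (\<lambda>x::real^'n. \<Prod>b\<in>Basis. ?f b (x \<bullet> b))"
    by (rule lborel_integral_prod_Basis(1)) (rule fourier_gaussian_real(1)[OF assms])
  have "(LBINT x. cis (x \<bullet> z) * complex_of_real (exp (- (s * (norm x)\<^sup>2))))
      = (\<Prod>b\<in>(Basis::(real^'n) set). of_real (sqrt (pi / s) * exp (- ((z \<bullet> b)\<^sup>2 / (4 * s)))))"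
    unfolding eq
    by (subst lborel_integral_prod_Basis(2)) (simp_all only: fourier_gaussian_real[OF assms])
  also have "\<dots> = of_real (\<Prod>b\<in>(Basis::(real^'n) set). (sqrt (pi / s) * exp (- ((z \<bullet> b)\<^sup>2 / (4 * s)))))"
    by (simp only: of_real_prod)
  also have "(\<Prod>b\<in>(Basis::(real^'n) set). (sqrt (pi / s) * exp (- ((z \<bullet> b)\<^sup>2 / (4 * s)))))
     = gauss_transform s z"
    unfolding gauss_transform_def sq
    by (simp add: prod.distrib exp_sum sum_divide_distrib sum_negf[symmetric])
  finally have "Re (LBINT x. cis (x \<bullet> z) * complex_of_real (exp (- (s * (norm x)\<^sup>2)))) = gauss_transform s z"
    by simp
  then show ?thesis
    using int unfolding eq[symmetric] by (subst (asm) integral_Re[symmetric]) auto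
qed

lemma power2_norm_add_axis:
  fixes z :: "real ^ 'n"
  shows "(norm (z + h *\<^sub>R axis k 1))\<^sup>2 = (norm z)\<^sup>2 + 2 * h * z $ k + h\<^sup>2"
  unfolding power2_norm_eq_inner
  by (simp add: inner_add_left inner_add_right inner_axis inner_commute[of "axis k 1" z]
      power2_eq_square inner_axis_axis algebra_simps)

lemma gauss_transform_deriv:
  assumes "s \<noteq> 0"
  shows "((\<lambda>h. gauss_transform s (z + h *\<^sub>R axis k 1)) has_real_derivative
     - ((z $ k + h) / (2 * s)) * gauss_transform s (z + h *\<^sub>R axis k 1)) (at h)"
  unfolding gauss_transform_def power2_norm_add_axis
  using assms by (auto intro!: derivative_eq_intros simp: field_simps)

lemma component_deriv:
  "((\<lambda>h. (z + h *\<^sub>R axis k 1) $ j) has_real_derivative (if j = k then 1 else 0)) (at h)"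
  by (auto intro!: derivative_eq_intros simp: axis_def)

lemma abs_monomial_le:
  fixes x :: "real ^ 'n"
  shows "\<bar>x $ i\<bar> \<le> norm x" "\<bar>x $ i * x $ j\<bar> \<le> norm x ^ 2" "\<bar>x $ i * x $ j * x $ k\<bar> \<le> norm x ^ 3"
proof -
  show 1: "\<bar>x $ i\<bar> \<le> norm x" for i by (rule component_le_norm_cart)
  show 2: "\<bar>x $ i * x $ j\<bar> \<le> norm x ^ 2" for i j
    unfolding abs_mult power2_eq_square by (intro mult_mono 1) auto
  have "\<bar>x $ i * x $ j\<bar> * \<bar>x $ k\<bar> \<le> norm x ^ 2 * norm x" by (intro mult_mono 1 2) auto
  then show "\<bar>x $ i * x $ j * x $ k\<bar> \<le> norm x ^ 3"
    by (simp only: abs_mult power3_eq_cube power2_eq_square)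
qed

lemma integrable_monomial_gaussian:
  fixes p T :: "real ^ 'n \<Rightarrow> real"
  assumes s: "0 < s" and [measurable]: "p \<in> borel_measurable borel" "T \<in> borel_measurable borel"
    and p: "\<And>x. \<bar>p x\<bar> \<le> norm x ^ m" and T: "\<And>x. \<bar>T x\<bar> \<le> 1"
  shows "integrable lborel (\<lambda>x. p x * T x * exp (- (s * (norm x)\<^sup>2)))"
proof (rule Bochner_Integration.integrable_bound[OF integrable_power_norm_gaussian[OF s, of m]])
  show "AE x in lborel. norm (p x * T x * exp (- (s * (norm x)\<^sup>2))) \<le> norm (norm x ^ m * exp (- (s * (norm x)\<^sup>2)))"
  proof (rule AE_I2)
    fix x :: "real^'n"
    have "\<bar>p x\<bar> * \<bar>T x\<bar> \<le> norm x ^ m * 1" by (intro mult_mono p T) auto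
    then show "norm (p x * T x * exp (- (s * (norm x)\<^sup>2))) \<le> norm (norm x ^ m * exp (- (s * (norm x)\<^sup>2)))"
      by (simp add: abs_mult)
  qed
qed measurable

text \<open>Here \<open>T\<close> stands for sin or cos, so each derivative in \<open>z\<close>
  costs one power of |x|, which the Gaussian absorbs. The factor \<open>p\<close> is a monomial, or
  the bounded symbol of the projection with \<open>m = 0\<close>.\<close>

lemma integral_gaussian_deriv:
  fixes p :: "real ^ 'n \<Rightarrow> real" and T T' :: "real \<Rightarrow> real"
  assumes s: "0 < s" and p: "\<And>x. \<bar>p x\<bar> \<le> norm x ^ m" "p \<in> borel_measurable borel"
    and T: "\<And>x. (T has_real_derivative T' x) (at x)" "\<And>x. \<bar>T x\<bar> \<le> 1" "\<And>x. \<bar>T' x\<bar> \<le> 1"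
  shows "((\<lambda>h. LBINT x. p x * T (x \<bullet> (z + h *\<^sub>R axis k 1)) * exp (- (s * (norm x)\<^sup>2)))
    has_real_derivative
      (LBINT x. (p x * x $ k) * T' (x \<bullet> (z + h *\<^sub>R axis k 1)) * exp (- (s * (norm x)\<^sup>2)))) (at h)"
proof (rule has_real_derivative_lebesgue_integral[where g = "\<lambda>x. norm x ^ Suc m * exp (- (s * (norm x)\<^sup>2))"])
  have [measurable]: "p \<in> borel_measurable borel" by fact
  have cont: "continuous_on UNIV T" using T(1) by (intro continuous_at_imp_continuous_on) (auto intro: DERIV_isCont)
  have [measurable]: "T \<in> borel_measurable borel" using cont by (rule borel_measurable_continuous_onI)
  show "integrable lborel (\<lambda>x. p x * T (x \<bullet> (z + h *\<^sub>R axis k 1)) * exp (- (s * (norm x)\<^sup>2)))" for h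
    by (rule integrable_monomial_gaussian[OF s]) (use p T in auto)
  show "((\<lambda>h. p x * T (x \<bullet> (z + h *\<^sub>R axis k 1)) * exp (- (s * (norm x)\<^sup>2))) has_real_derivative
      (p x * x $ k) * T' (x \<bullet> (z + h *\<^sub>R axis k 1)) * exp (- (s * (norm x)\<^sup>2))) (at h)" for h x
  proof -
    have "((\<lambda>h. T (x \<bullet> z + h * x $ k)) has_real_derivative T' (x \<bullet> z + h * x $ k) * x $ k) (at h)"
      by (rule DERIV_chain2[OF T(1)]) (auto intro!: derivative_eq_intros)
    then show ?thesis
      by (auto intro!: derivative_eq_intros simp: inner_add_right inner_axis)
  qed
  show "integrable lborel (\<lambda>x::real^'n. norm x ^ Suc m * exp (- (s * (norm x)\<^sup>2)))"
    by (rule integrable_power_norm_gaussian[OF s])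
  show "\<bar>(p x * x $ k) * T' (x \<bullet> (z + h *\<^sub>R axis k 1)) * exp (- (s * (norm x)\<^sup>2))\<bar>
      \<le> norm x ^ Suc m * exp (- (s * (norm x)\<^sup>2))" for h x
  proof -
    have "\<bar>p x\<bar> * \<bar>x $ k\<bar> * \<bar>T' (x \<bullet> (z + h *\<^sub>R axis k 1))\<bar> \<le> norm x ^ m * norm x * 1"
      by (intro mult_mono p T abs_monomial_le) auto
    then show ?thesis by (simp add: abs_mult mult.commute)
  qed
qed

text \<open>Each trigonometric moment comes from differentiating the preceding one in
  \<open>z\<close>, once under the integral and once in closed form; uniqueness of derivatives
  identifies the results.\<close>

lemma integral_sin_gaussian:
  fixes z :: "real ^ 'n"
  assumes s: "0 < s"
  shows "(LBINT x. x $ k * sin (x \<bullet> z) * exp (- (s * (norm x)\<^sup>2))) = z $ k / (2 * s) * gauss_transform s z"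
proof -
  have "((\<lambda>h. LBINT x. 1 * cos (x \<bullet> (z + h *\<^sub>R axis k 1)) * exp (- (s * (norm x)\<^sup>2))) has_real_derivative
      (LBINT x. (1 * x $ k) * - sin (x \<bullet> (z + 0 *\<^sub>R axis k 1)) * exp (- (s * (norm x)\<^sup>2)))) (at 0)"
    by (rule integral_gaussian_deriv[OF s, where m = 0]) (auto intro!: derivative_eq_intros)
  then have "((\<lambda>h. gauss_transform s (z + h *\<^sub>R axis k 1)) has_real_derivative
      - (LBINT x. x $ k * sin (x \<bullet> z) * exp (- (s * (norm x)\<^sup>2)))) (at 0)"
    by (simp add: integral_cos_gaussian[OF s])
  from DERIV_unique[OF this gauss_transform_deriv] s show ?thesis by simp
qed

lemma integral_cos_gaussian_2:
  fixes z :: "real ^ 'n"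
  assumes s: "0 < s"
  shows "(LBINT x. x $ j * x $ k * cos (x \<bullet> z) * exp (- (s * (norm x)\<^sup>2)))
    = ((if j = k then 1 else 0) / (2 * s) - z $ j * z $ k / (4 * s\<^sup>2)) * gauss_transform s z"
proof -
  \<comment> \<open>In terms of 1 / (2 s) all denominators become powers of \<open>w\<close>, and
    the comparison of derivatives is a polynomial identity.\<close>
  define w where "w = 1 / (2 * s)"
  have w: "x / (2 * s) = x * w" "x / (4 * s\<^sup>2) = x * w\<^sup>2" for x
    by (simp_all add: w_def power_divide power_mult_distrib)
  have alg: "a * w * g + - (r * w) * g * (p * w) = (a * w - p * r * w\<^sup>2) * g" for a p r g :: real
    by (simp add: algebra_simps power2_eq_square)
  have "((\<lambda>h. LBINT x. x $ j * sin (x \<bullet> (z + h *\<^sub>R axis k 1)) * exp (- (s * (norm x)\<^sup>2))) has_real_derivative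
      (LBINT x. (x $ j * x $ k) * cos (x \<bullet> (z + 0 *\<^sub>R axis k 1)) * exp (- (s * (norm x)\<^sup>2)))) (at 0)"
  proof (rule integral_gaussian_deriv[OF s, where m = 1])
    show "\<bar>x $ j\<bar> \<le> norm x ^ 1" for x :: "real^'n" using abs_monomial_le(1)[of x] by simp
  qed (simp_all add: DERIV_sin)
  then have "((\<lambda>h. (z + h *\<^sub>R axis k 1) $ j / (2 * s) * gauss_transform s (z + h *\<^sub>R axis k 1)) has_real_derivative
      (LBINT x. x $ j * x $ k * cos (x \<bullet> z) * exp (- (s * (norm x)\<^sup>2)))) (at 0)"
    by (simp add: integral_sin_gaussian[OF s])
  moreover have "((\<lambda>h. (z + h *\<^sub>R axis k 1) $ j / (2 * s) * gauss_transform s (z + h *\<^sub>R axis k 1)) has_real_derivative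
     ((if j = k then 1 else 0) / (2 * s) - z $ j * z $ k / (4 * s\<^sup>2)) * gauss_transform s z) (at 0)"
    by (rule DERIV_cong[OF DERIV_mult[OF DERIV_cdivide[OF component_deriv] gauss_transform_deriv]])
      (use s in \<open>simp\<close>, simp only: scaleR_zero_left add_0_right w, rule alg)
  ultimately show ?thesis by (rule DERIV_unique)
qed

lemma integral_sin_gaussian_3:
  fixes z :: "real ^ 'n" and s :: real
  assumes s: "0 < s"
  shows "(LBINT x. x $ i * x $ j * x $ k * sin (x \<bullet> z) * exp (- (s * (norm x)\<^sup>2)))
    = (((if i = j then 1 else 0) * z $ k + (if i = k then 1 else 0) * z $ j + (if j = k then 1 else 0) * z $ i)
          / (4 * s\<^sup>2)
        - z $ i * z $ j * z $ k / (8 * s ^ 3)) * gauss_transform s z"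
proof -
  define w where "w = 1 / (2 * s)"
  have w: "x / (2 * s) = x * w" "x / (4 * s\<^sup>2) = x * w\<^sup>2" "x / (8 * s ^ 3) = x * w ^ 3" for x
    by (simp_all add: w_def power_divide power_mult_distrib)
  have alg: "(0 - (b * q + c * p) * w\<^sup>2) * g + - (r * w) * g * (a * w - p * q * w\<^sup>2)
      = - (((a * r + b * q + c * p) * w\<^sup>2 - p * q * r * w ^ 3) * g)" for a b c p q r g :: real
    by (simp add: algebra_simps power2_eq_square power3_eq_cube)
  have "((\<lambda>h. LBINT x. (x $ i * x $ j) * cos (x \<bullet> (z + h *\<^sub>R axis k 1)) * exp (- (s * (norm x)\<^sup>2))) has_real_derivative
      (LBINT x. (x $ i * x $ j * x $ k) * - sin (x \<bullet> (z + 0 *\<^sub>R axis k 1)) * exp (- (s * (norm x)\<^sup>2)))) (at 0)"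
  proof (rule integral_gaussian_deriv[OF s, where m = 2])
    show "\<bar>x $ i * x $ j\<bar> \<le> norm x ^ 2" for x :: "real^'n" by (rule abs_monomial_le(2))
  qed (simp_all add: DERIV_cos)
  then have "((\<lambda>h. ((if i = j then 1 else 0) / (2 * s) - (z + h *\<^sub>R axis k 1) $ i * (z + h *\<^sub>R axis k 1) $ j / (4 * s\<^sup>2))
       * gauss_transform s (z + h *\<^sub>R axis k 1)) has_real_derivative
      - (LBINT x. x $ i * x $ j * x $ k * sin (x \<bullet> z) * exp (- (s * (norm x)\<^sup>2)))) (at 0)"
    by (simp add: integral_cos_gaussian_2[OF s])
  moreover have "((\<lambda>h. ((if i = j then 1 else 0) / (2 * s) - (z + h *\<^sub>R axis k 1) $ i * (z + h *\<^sub>R axis k 1) $ j / (4 * s\<^sup>2))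
       * gauss_transform s (z + h *\<^sub>R axis k 1)) has_real_derivative
     - ((((if i = j then 1 else 0) * z $ k + (if i = k then 1 else 0) * z $ j + (if j = k then 1 else 0) * z $ i)
          / (4 * s\<^sup>2)
        - z $ i * z $ j * z $ k / (8 * s ^ 3)) * gauss_transform s z)) (at 0)"
    by (rule DERIV_cong[OF DERIV_mult[OF DERIV_diff[OF DERIV_const
              DERIV_cdivide[OF DERIV_mult[OF component_deriv component_deriv]]] gauss_transform_deriv]])
      (use s in \<open>simp\<close>, simp only: scaleR_zero_left add_0_right w, rule alg)
  ultimately show ?thesis by (rule DERIV_unique[THEN iffD1[OF neg_equal_iff_equal]])
qed

section \<open>The Leray projection of a derivative of the heat kernel\<close>

lemma heat_kernel_eq:
  fixes z :: "real ^ 'n"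
  assumes "0 < \<tau>"
  shows "heat_kernel \<tau> z = exp (- ((norm z)\<^sup>2 / (4 * \<tau>))) / sqrt (4 * pi * \<tau>) ^ CARD('n)"
proof -
  have "sqrt (4 * pi * \<tau>) ^ CARD('n) = (4 * pi * \<tau>) powr (real CARD('n) / 2)"
    using assms by (simp add: powr_half_sqrt[symmetric] powr_powr powr_realpow[symmetric])
  then show ?thesis
    by (simp add: heat_kernel_def powr_minus_divide)
qed

text \<open>The prefactor is \<open>0 powr a = 0\<close>. With this default value, time integrals
  starting at 0 have a harmless integrand at their endpoint.\<close>

lemma heat_kernel_0 [simp]: "heat_kernel 0 z = 0"
  by (simp add: heat_kernel_def)

lemma heat_kernel_nonneg [simp]: "0 \<le> heat_kernel \<tau> z"
  by (simp add: heat_kernel_def)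

lemma borel_measurable_heat_kernel [measurable (raw)]:
  assumes [measurable]: "f \<in> borel_measurable M" "g \<in> borel_measurable M"
  shows "(\<lambda>x. heat_kernel (f x) (g x :: real ^ 'n)) \<in> borel_measurable M"
  unfolding heat_kernel_def by measurable

lemma borel_measurable_vec_nth_compose [measurable (raw)]:
  assumes "f \<in> borel_measurable M"
  shows "(\<lambda>x. f x $ i :: real) \<in> borel_measurable M"
  by (rule measurable_compose[OF assms]) simp

lemma heat_kernel_eq_gauss_transform:
  fixes z :: "real ^ 'n"
  assumes "0 < \<tau>"
  shows "heat_kernel \<tau> z = gauss_transform \<tau> z / (2 * pi) ^ CARD('n)"
proof -
  have "sqrt (pi / \<tau>) * sqrt (4 * pi * \<tau>) = 2 * pi"
    using assms real_sqrt_abs[of "2 * pi"]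
    by (simp add: real_sqrt_mult[symmetric] real_sqrt_divide[symmetric] power2_eq_square mult_ac)
  then have "sqrt (pi / \<tau>) ^ CARD('n) * sqrt (4 * pi * \<tau>) ^ CARD('n) = (2 * pi) ^ CARD('n)"
    by (metis power_mult_distrib)
  then have "1 / sqrt (4 * pi * \<tau>) ^ CARD('n) = sqrt (pi / \<tau>) ^ CARD('n) / (2 * pi) ^ CARD('n)"
    using assms by (simp add: field_simps)
  then show ?thesis
    unfolding heat_kernel_eq[OF assms] gauss_transform_def
    by (metis (no_types, lifting) mult.commute mult.right_neutral times_divide_eq_right)
qed

lemma heat_kernel_deriv:
  assumes "0 < \<tau>"
  shows "((\<lambda>h. heat_kernel \<tau> (z + h *\<^sub>R axis k 1)) has_real_derivative
     - ((z $ k + h) / (2 * \<tau>)) * heat_kernel \<tau> (z + h *\<^sub>R axis k 1)) (at h)"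
  using DERIV_cdivide[OF gauss_transform_deriv[of \<tau> z k h], of "(2 * pi) ^ CARD('n)"] assms
  by (simp add: heat_kernel_eq_gauss_transform)

lemma partial_deriv_heat_kernel:
  assumes "0 < \<tau>"
  shows "partial_deriv k (heat_kernel \<tau>) = (\<lambda>z. - (z $ k / (2 * \<tau>)) * heat_kernel \<tau> z)"
  unfolding partial_deriv_def
  using DERIV_imp_deriv[OF heat_kernel_deriv[OF assms, of _ k 0]] by (simp add: fun_eq_iff)

lemma partial_deriv_partial_deriv_heat_kernel:
  assumes "0 < \<tau>"
  shows "partial_deriv j (partial_deriv k (heat_kernel \<tau>))
    = (\<lambda>z. (z $ j * z $ k / (4 * \<tau>\<^sup>2) - (if j = k then 1 else 0) / (2 * \<tau>)) * heat_kernel \<tau> z)"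
proof
  fix z :: "real ^ 'a"
  define w where "w = 1 / (2 * \<tau>)"
  have w: "x / (2 * \<tau>) = x * w" "x / (4 * \<tau>\<^sup>2) = x * w\<^sup>2" for x
    by (simp_all add: w_def power_divide power_mult_distrib)
  have alg: "- (d * w) * g + - (r * w) * g * - (p * w) = (r * p * w\<^sup>2 - d * w) * g" for d p r g :: real
    by (simp add: algebra_simps power2_eq_square)
  have "((\<lambda>h. - ((z + h *\<^sub>R axis j 1) $ k / (2 * \<tau>)) * heat_kernel \<tau> (z + h *\<^sub>R axis j 1)) has_real_derivative
    (z $ j * z $ k / (4 * \<tau>\<^sup>2) - (if k = j then 1 else 0) / (2 * \<tau>)) * heat_kernel \<tau> z) (at 0)"
    by (rule DERIV_cong[OF DERIV_mult[OF DERIV_minus[OF DERIV_cdivide[OF component_deriv]] heat_kernel_deriv[OF assms]]])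
      (simp only: scaleR_zero_left add_0_right w, rule alg)
  then show "partial_deriv j (partial_deriv k (heat_kernel \<tau>)) z
    = (z $ j * z $ k / (4 * \<tau>\<^sup>2) - (if j = k then 1 else 0) / (2 * \<tau>)) * heat_kernel \<tau> z"
    unfolding partial_deriv_heat_kernel[OF assms]
    by (subst partial_deriv_def) (simp add: DERIV_imp_deriv eq_commute)
qed

section \<open>The inverse Laplacian on the Fourier side\<close>

lemma integral_odd_eq_0:
  fixes f :: "'a::euclidean_space \<Rightarrow> real"
  assumes "\<And>x. f (- x) = - f x"
  shows "(LBINT x. f x) = 0"
proof (cases "integrable lborel f")
  case True
  have "(LBINT x. f (0 + (-1) *\<^sub>R x)) = (1 / \<bar>-1\<bar> ^ DIM('a)) *\<^sub>R (LBINT x. f x)"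
    by (rule lborel_integrable_translate_scale(2)[OF _ True]) simp
  then have "- (LBINT x. f x) = (LBINT x. f x)"
    using assms by simp
  then show ?thesis by linarith
\<comment> \<open>A non-integrable integrand has integral 0 by convention.\<close>
qed (simp add: not_integrable_integral_eq)

lemma integral_cis_real:
  fixes f :: "'a::euclidean_space \<Rightarrow> real" and \<xi> :: 'a
  assumes f: "integrable lborel f"
  shows "Re (LBINT x. cis (\<xi> \<bullet> x) * of_real (f x)) = (LBINT x. cos (\<xi> \<bullet> x) * f x)"
    and "Im (LBINT x. cis (\<xi> \<bullet> x) * of_real (f x)) = (LBINT x. sin (\<xi> \<bullet> x) * f x)"
proof -
  have [measurable]: "f \<in> borel_measurable borel"
    using borel_measurable_integrable[OF f] by simp
  have "continuous_on UNIV cis" by (simp add: cis_conv_exp continuous_intros)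
  then have [measurable]: "cis \<in> borel_measurable borel" by (rule borel_measurable_continuous_onI)
  have "integrable lborel (\<lambda>x. cis (\<xi> \<bullet> x) * complex_of_real (f x))"
    by (rule Bochner_Integration.integrable_bound[OF f]) (auto simp: norm_mult)
  note integral_Re[OF this] integral_Im[OF this]
  then show "Re (LBINT x. cis (\<xi> \<bullet> x) * of_real (f x)) = (LBINT x. cos (\<xi> \<bullet> x) * f x)"
    "Im (LBINT x. cis (\<xi> \<bullet> x) * of_real (f x)) = (LBINT x. sin (\<xi> \<bullet> x) * f x)"
    by simp_all
qed

lemma borel_measurable_cis_mult:
  fixes f :: "'a::euclidean_space \<Rightarrow> complex"
  assumes [measurable]: "f \<in> borel_measurable borel"
  shows "(\<lambda>x. cis (\<xi> \<bullet> x) * f x) \<in> borel_measurable borel"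
proof -
  have "continuous_on UNIV cis" by (simp add: cis_conv_exp continuous_intros)
  then have [measurable]: "cis \<in> borel_measurable borel" by (rule borel_measurable_continuous_onI)
  show ?thesis by measurable
qed

text \<open>The heat kernel is itself a Gaussian with parameter s = 1 / (4 \<tau>), so its second
  derivative is a combination of Gaussian moments of order 0 and 2. The cosine part is known from
  above and the sine part vanishes by oddness.\<close>

lemma fourier_second_deriv_heat_kernel:
  fixes \<xi> :: "real ^ 'n"
  assumes \<tau>: "0 < \<tau>"
  shows "fourier (\<lambda>y. of_real (partial_deriv j (partial_deriv k (heat_kernel \<tau>)) y)) \<xi>
    = of_real (- (\<xi> $ j * \<xi> $ k) * exp (- (\<tau> * (norm \<xi>)\<^sup>2)))"
proof -
  define s where "s = 1 / (4 * \<tau>)"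
  define D :: real where "D = (if j = k then 1 else 0)"
  have s: "0 < s" using \<tau> by (simp add: s_def)
  define c where "c = 1 / sqrt (4 * pi * \<tau>) ^ CARD('n)"
  let ?f = "partial_deriv j (partial_deriv k (heat_kernel \<tau>)) :: real^'n \<Rightarrow> real"
  have f: "?f x = c / (4 * \<tau>\<^sup>2) * (x $ j * x $ k * 1 * exp (- (s * (norm x)\<^sup>2)))
      - c * D / (2 * \<tau>) * (1 * 1 * exp (- (s * (norm x)\<^sup>2)))" for x
  proof -
    have "(p / a - D / b) * (e / S) = 1 / S / a * (p * 1 * e) - 1 / S * D / b * (1 * 1 * e)" for p a b e S :: real
      by (simp add: divide_inverse algebra_simps)
    moreover have "exp (- (s * (norm x)\<^sup>2)) = exp (- ((norm x)\<^sup>2 / (4 * \<tau>)))" by (simp add: s_def)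
    ultimately show ?thesis
      unfolding partial_deriv_partial_deriv_heat_kernel[OF \<tau>] heat_kernel_eq[OF \<tau>] c_def D_def by (simp only:)
  qed
  have c2: "cos (- \<xi> \<bullet> x) * ?f x = c / (4 * \<tau>\<^sup>2) * (x $ j * x $ k * cos (x \<bullet> \<xi>) * exp (- (s * (norm x)\<^sup>2)))
      - c * D / (2 * \<tau>) * (1 * cos (x \<bullet> \<xi>) * exp (- (s * (norm x)\<^sup>2)))" for x
    unfolding f by (simp add: inner_commute algebra_simps)
  have i: "integrable lborel (\<lambda>x::real^'n. x $ j * x $ k * T x * exp (- (s * (norm x)\<^sup>2)))"
    "integrable lborel (\<lambda>x::real^'n. 1 * T x * exp (- (s * (norm x)\<^sup>2)))"
    if "T \<in> borel_measurable borel" "\<And>x. \<bar>T x\<bar> \<le> 1" for T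
    by (rule integrable_monomial_gaussian[OF s _ that(1) _ that(2), where m = 2]; simp add: abs_monomial_le del: abs_mult)
      (rule integrable_monomial_gaussian[OF s _ that(1) _ that(2), where m = 0]; simp)
  have int: "integrable lborel ?f"
    unfolding f by (intro Bochner_Integration.integrable_diff integrable_mult_right i) auto
  have [measurable]: "?f \<in> borel_measurable borel"
    using borel_measurable_integrable[OF int] by simp
  have gt: "c * gauss_transform s \<xi> = exp (- (\<tau> * (norm \<xi>)\<^sup>2))"
    using \<tau> by (simp add: gauss_transform_def c_def s_def field_simps)
  have "(LBINT x. cos (- \<xi> \<bullet> x) * ?f x)
      = c / (4 * \<tau>\<^sup>2) * ((D / (2 * s) - \<xi> $ j * \<xi> $ k / (4 * s\<^sup>2)) * gauss_transform s \<xi>)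
        - c * D / (2 * \<tau>) * gauss_transform s \<xi>"
  proof -
    have "integrable lborel (\<lambda>x::real^'n. c / (4 * \<tau>\<^sup>2) * (x $ j * x $ k * cos (x \<bullet> \<xi>) * exp (- (s * (norm x)\<^sup>2))))"
      "integrable lborel (\<lambda>x::real^'n. c * D / (2 * \<tau>) * (1 * cos (x \<bullet> \<xi>) * exp (- (s * (norm x)\<^sup>2))))"
      by (intro integrable_mult_right i; simp)+
    from Bochner_Integration.integral_diff[OF this] show ?thesis
      unfolding c2 integral_mult_right_zero by (simp add: integral_cos_gaussian_2[OF s] integral_cos_gaussian[OF s] D_def)
  qed
  also have "\<dots> = ((D / (2 * s) - \<xi> $ j * \<xi> $ k / (4 * s\<^sup>2)) / (4 * \<tau>\<^sup>2) - D / (2 * \<tau>)) * (c * gauss_transform s \<xi>)"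
  proof -
    have "c / a * (A * g) - c * D / b * g = (A / a - D / b) * (c * g)" for a b A g :: real
      by (simp add: divide_inverse algebra_simps)
    then show ?thesis .
  qed
  \<comment> \<open>For s = 1 / (4 \<tau>) the two Kronecker terms cancel exactly.\<close>
  also have "(D / (2 * s) - \<xi> $ j * \<xi> $ k / (4 * s\<^sup>2)) / (4 * \<tau>\<^sup>2) - D / (2 * \<tau>) = - (\<xi> $ j * \<xi> $ k)"
    using \<tau> by (simp add: s_def field_simps power2_eq_square)
  finally have re: "(LBINT x. cos (- \<xi> \<bullet> x) * ?f x) = - (\<xi> $ j * \<xi> $ k) * exp (- (\<tau> * (norm \<xi>)\<^sup>2))"
    unfolding gt .
  have im: "(LBINT x. sin (- \<xi> \<bullet> x) * ?f x) = 0"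
    by (rule integral_odd_eq_0) (simp add: f)
  have "fourier (\<lambda>y. of_real (?f y)) \<xi> = (LBINT x. cis (- \<xi> \<bullet> x) * of_real (?f x))"
    unfolding fourier_def
    by (subst integral_completion) (auto intro!: borel_measurable_cis_mult[of _ "- \<xi>", simplified])
  also have "\<dots> = of_real (- (\<xi> $ j * \<xi> $ k) * exp (- (\<tau> * (norm \<xi>)\<^sup>2)))"
    by (rule complex_eqI) (simp_all only: integral_cis_real[OF int] re im Re_complex_of_real Im_complex_of_real)
  finally show ?thesis .
qed

lemma integral_exp_to_infinity:
  fixes a c :: real
  assumes "0 < a"
  shows "integrable lborel (\<lambda>s. indicator {c..} s * exp (- (s * a)))"
    and "(LBINT s. indicator {c..} s * exp (- (s * a))) = exp (- (c * a)) / a"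
proof -
  have hi: "((\<lambda>s. exp (- (s * a))) has_integral exp (- (c * a)) / a) {c..}"
    using has_integral_exp_minus_to_infinity[OF assms, of c] by (simp add: mult.commute)
  have "has_bochner_integral lborel (\<lambda>s. indicator {c..} s * exp (- (s * a))) (exp (- (c * a)) / a)"
  proof (rule has_bochner_integral_nn_integral)
    have "((\<lambda>s. indicator {c..} s * exp (- (s * a))) has_integral exp (- (c * a)) / a) UNIV"
    proof -
      have "(\<lambda>s. indicator {c..} s * exp (- (s * a))) = (\<lambda>s. if s \<in> {c..} then exp (- (s * a)) else 0)"
        by (auto simp: indicator_def)
      then show ?thesis using hi by (simp only: has_integral_restrict_UNIV)
    qed
    then show "(\<integral>\<^sup>+ s. ennreal (indicator {c..} s * exp (- (s * a))) \<partial>lborel) = ennreal (exp (- (c * a)) / a)"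
      by (intro nn_integral_has_integral_lborel) auto
  qed (use assms in auto)
  then show "integrable lborel (\<lambda>s. indicator {c..} s * exp (- (s * a)))"
    "(LBINT s. indicator {c..} s * exp (- (s * a))) = exp (- (c * a)) / a"
    by (auto simp: has_bochner_integral_iff)
qed

text \<open>
  The third derivative \<open>\<partial>\<^sub>i \<partial>\<^sub>j \<partial>\<^sub>k G\<^sub>s(z)\<close>, written out.
\<close>

definition heat_kernel_deriv3 :: "'n \<Rightarrow> 'n \<Rightarrow> 'n \<Rightarrow> real \<Rightarrow> real ^ 'n \<Rightarrow> real" where
  "heat_kernel_deriv3 i j k s z =
    (((if i = j then 1 else 0) * z $ k + (if i = k then 1 else 0) * z $ j + (if j = k then 1 else 0) * z $ i)
          / (4 * s\<^sup>2) - z $ i * z $ j * z $ k / (8 * s ^ 3)) * heat_kernel s z"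

lemma divergence_component_axis:
  "divergence (\<lambda>z. f z *\<^sub>R axis j 1) = partial_deriv j f"
proof
  fix x :: "real ^ 'a"
  have "partial_deriv m (\<lambda>y. (f y *\<^sub>R axis j 1 :: real^'a) $ m) x = (if m = j then partial_deriv j f x else 0)" for m
    by (simp add: axis_def partial_deriv_def)
  then show "divergence (\<lambda>z. f z *\<^sub>R axis j 1) x = partial_deriv j f x"
    by (simp add: divergence_def)
qed

lemma inv_neg_laplacian_second_deriv_heat_kernel:
  fixes x :: "real ^ 'n"
  assumes \<tau>: "0 < \<tau>"
  shows "inv_neg_laplacian (partial_deriv j (partial_deriv k (heat_kernel \<tau>))) x
    = - (\<integral>\<xi>. \<xi> $ j * \<xi> $ k / (norm \<xi>)\<^sup>2 * cos (\<xi> \<bullet> x) * exp (- (\<tau> * (norm \<xi>)\<^sup>2)) \<partial>lborel) / (2 * pi) ^ CARD('n)"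
proof -
  let ?m = "\<lambda>\<xi>::real^'n. - (\<xi> $ j * \<xi> $ k / (norm \<xi>)\<^sup>2 * 1 * exp (- (\<tau> * (norm \<xi>)\<^sup>2)))"
  \<comment> \<open>Since \<open>x / 0 = 0\<close>, the symbol is bounded by 1 at the origin
    too.\<close>
  have b: "\<bar>\<xi> $ j * \<xi> $ k / (norm \<xi>)\<^sup>2\<bar> \<le> norm \<xi> ^ 0" for \<xi> :: "real^'n"
    using abs_monomial_le(2)[of \<xi> j k] by (simp add: divide_le_eq del: abs_mult)
  have int: "integrable lborel ?m"
    by (intro Bochner_Integration.integrable_minus integrable_monomial_gaussian[OF \<tau> _ _ b]) auto
  have [measurable]: "?m \<in> borel_measurable borel"
    using borel_measurable_integrable[OF int] by simp
  have eq: "fourier (\<lambda>y. of_real (partial_deriv j (partial_deriv k (heat_kernel \<tau>)) y)) \<xi> / of_real ((norm \<xi>)\<^sup>2)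
      = of_real (?m \<xi>)" for \<xi> :: "real^'n"
    by (simp only: fourier_second_deriv_heat_kernel[OF \<tau>] of_real_divide[symmetric]) simp
  have "inv_neg_laplacian (partial_deriv j (partial_deriv k (heat_kernel \<tau>))) x
      = Re ((\<integral>\<xi>. cis (x \<bullet> \<xi>) * of_real (?m \<xi>) \<partial>lborel) / of_real ((2 * pi) ^ CARD('n)))"
  proof -
    have "(\<lambda>\<xi>. cis (x \<bullet> \<xi>) * complex_of_real (?m \<xi>)) \<in> borel_measurable borel"
      by (rule borel_measurable_cis_mult) measurable
    then have "(\<lambda>\<xi>. cis (x \<bullet> \<xi>) * complex_of_real (?m \<xi>)) \<in> borel_measurable lborel"
      by (simp only: measurable_lborel2)
    moreover have "(\<lambda>\<xi>. cis (\<xi> \<bullet> x) * complex_of_real (?m \<xi>)) = (\<lambda>\<xi>. cis (x \<bullet> \<xi>) * complex_of_real (?m \<xi>))"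
      by (simp add: inner_commute)
    ultimately show ?thesis
      unfolding inv_neg_laplacian_def inv_fourier_def eq by (simp only: integral_completion)
  qed
  also have "\<dots> = (\<integral>\<xi>. cos (x \<bullet> \<xi>) * ?m \<xi> \<partial>lborel) / (2 * pi) ^ CARD('n)"
    by (simp only: Re_divide_of_real integral_cis_real(1)[OF int])
  also have "(\<integral>\<xi>. cos (x \<bullet> \<xi>) * ?m \<xi> \<partial>lborel)
    = (\<integral>\<xi>. - (\<xi> $ j * \<xi> $ k / (norm \<xi>)\<^sup>2 * cos (\<xi> \<bullet> x) * exp (- (\<tau> * (norm \<xi>)\<^sup>2))) \<partial>lborel)"
    by (rule Bochner_Integration.integral_cong) (auto simp: inner_commute)
  finally show ?thesis by simp
qed

text \<open>The third factor of xi is what legitimises Fubini: the integral in s of the absolute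
  value is at most |xi|^3 exp(-\<tau> |xi|^2) / |xi|^2, which is integrable. For fixed s the
  integral in xi is the third sine moment, hence a third derivative of the heat kernel.\<close>

lemma integral_inverse_laplacian_gaussian:
  fixes z :: "real ^ 'n"
  assumes \<tau>: "0 < \<tau>"
  shows "(\<integral>\<xi>. \<xi> $ j * \<xi> $ k / (norm \<xi>)\<^sup>2 * \<xi> $ i * sin (\<xi> \<bullet> z) * exp (- (\<tau> * (norm \<xi>)\<^sup>2)) \<partial>lborel)
      = (2 * pi) ^ CARD('n) * (LBINT s. indicator {\<tau>..} s * heat_kernel_deriv3 i j k s z)"
proof -
  let ?f = "\<lambda>(\<xi>::real^'n, s::real). indicator {\<tau>..} s * (\<xi> $ i * \<xi> $ j * \<xi> $ k * sin (\<xi> \<bullet> z) * exp (- (s * (norm \<xi>)\<^sup>2)))"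
  have AE0: "AE \<xi> in lborel. (\<xi>::real^'n) \<noteq> 0" by (rule AE_lborel_singleton)
  have fs: "?f (\<xi>, s) = (\<xi> $ i * \<xi> $ j * \<xi> $ k * sin (\<xi> \<bullet> z)) * (indicator {\<tau>..} s * exp (- (s * (norm \<xi>)\<^sup>2)))" for \<xi> s
    by simp
  have int: "integrable (lborel \<Otimes>\<^sub>M lborel) ?f"
  proof (rule lborel_pair.Fubini_integrable)
    have "?f \<in> borel_measurable (borel \<Otimes>\<^sub>M borel)" by measurable
    then show "?f \<in> borel_measurable (lborel \<Otimes>\<^sub>M lborel)" by (simp add: lborel_prod borel_prod)
    show "AE \<xi> in lborel. integrable lborel (\<lambda>s. ?f (\<xi>, s))"
      using AE0
    proof eventually_elim
      case (elim \<xi>)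
      then show ?case unfolding fs by (intro integrable_mult_right integral_exp_to_infinity) auto
    qed
    have "integrable lborel (\<lambda>\<xi>::real^'n. norm \<xi> ^ 1 * exp (- (\<tau> * (norm \<xi>)\<^sup>2)))"
      by (rule integrable_power_norm_gaussian[OF \<tau>])
    then show "integrable lborel (\<lambda>\<xi>. LBINT s. norm (?f (\<xi>, s)))"
    proof (rule Bochner_Integration.integrable_bound)
      show "AE \<xi> in lborel. norm (LBINT s. norm (?f (\<xi>, s))) \<le> norm (norm \<xi> ^ 1 * exp (- (\<tau> * (norm \<xi>)\<^sup>2)))"
        using AE0
      proof eventually_elim
        case (elim \<xi>)
        have "(LBINT s. norm (?f (\<xi>, s)))
            = \<bar>\<xi> $ i * \<xi> $ j * \<xi> $ k * sin (\<xi> \<bullet> z)\<bar> * (exp (- (\<tau> * (norm \<xi>)\<^sup>2)) / (norm \<xi>)\<^sup>2)"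
          unfolding fs real_norm_def abs_mult[of _ "indicator _ _ * _"]
          using elim integral_exp_to_infinity(2)[of "(norm \<xi>)\<^sup>2" \<tau>] by (simp add: abs_mult[of "indicator _ _"])
        also have "\<dots> \<le> (norm \<xi> ^ 3 * 1) * (exp (- (\<tau> * (norm \<xi>)\<^sup>2)) / (norm \<xi>)\<^sup>2)"
          unfolding abs_mult[of _ "sin _"] by (intro mult_right_mono mult_mono abs_monomial_le) auto
        also have "\<dots> = norm \<xi> * exp (- (\<tau> * (norm \<xi>)\<^sup>2))"
          using elim by (simp add: power3_eq_cube power2_eq_square)
        finally show ?case by (simp add: integral_nonneg_AE)
      qed
    qed measurable
  qed
  have "(\<integral>\<xi>. \<xi> $ j * \<xi> $ k / (norm \<xi>)\<^sup>2 * \<xi> $ i * sin (\<xi> \<bullet> z) * exp (- (\<tau> * (norm \<xi>)\<^sup>2)) \<partial>lborel)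
      = (\<integral>\<xi>. (LBINT s. ?f (\<xi>, s)) \<partial>lborel)"
  proof (rule integral_cong_AE)
    show "AE \<xi> in lborel. \<xi> $ j * \<xi> $ k / (norm \<xi>)\<^sup>2 * \<xi> $ i * sin (\<xi> \<bullet> z) * exp (- (\<tau> * (norm \<xi>)\<^sup>2))
       = (LBINT s. ?f (\<xi>, s))"
      using AE0
    proof eventually_elim
      case (elim \<xi>)
      then show ?case unfolding fs integral_mult_right_zero
        using integral_exp_to_infinity(2)[of "(norm \<xi>)\<^sup>2" \<tau>] by simp
    qed
  qed measurable
  also have "\<dots> = (\<integral>s. (\<integral>\<xi>. ?f (\<xi>, s) \<partial>lborel) \<partial>lborel)"
    by (rule lborel_pair.Fubini_integral[symmetric, of "\<lambda>\<xi> s. ?f (\<xi>, s)"]) (use int in simp)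
  also have "\<dots> = (LBINT s. (2 * pi) ^ CARD('n) * (indicator {\<tau>..} s * heat_kernel_deriv3 i j k s z))"
  proof (rule Bochner_Integration.integral_cong[OF refl])
    fix s :: real
    show "(\<integral>\<xi>. ?f (\<xi>, s) \<partial>lborel) = (2 * pi) ^ CARD('n) * (indicator {\<tau>..} s * heat_kernel_deriv3 i j k s z)"
    proof (cases "\<tau> \<le> s")
      case True
      with \<tau> have s: "0 < s" by simp
      show ?thesis
        using True by (simp add: heat_kernel_deriv3_def heat_kernel_eq_gauss_transform[OF s] integral_sin_gaussian_3[OF s])
    qed simp
  qed
  finally show ?thesis by simp
qed

text \<open>Two derivatives contribute the factor -1 to the multiplier and the derivative of cos
  contributes another, so the tail integral enters with a plus sign.\<close>

lemma leray_heat_kernel_component: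
  fixes z :: "real ^ 'n"
  assumes \<tau>: "0 < \<tau>"
  shows "leray (\<lambda>z. partial_deriv k (heat_kernel \<tau>) z *\<^sub>R axis j 1) z $ i
     = - (if i = j then 1 else 0) * z $ k / (2 * \<tau>) * heat_kernel \<tau> z
       + (LBINT s. indicator {\<tau>..} s * heat_kernel_deriv3 i j k s z)"
proof -
  let ?p = "\<lambda>\<xi>::real^'n. \<xi> $ j * \<xi> $ k / (norm \<xi>)\<^sup>2"
  have b: "\<bar>?p \<xi>\<bar> \<le> norm \<xi> ^ 0" for \<xi> :: "real^'n"
    using abs_monomial_le(2)[of \<xi> j k] by (simp add: divide_le_eq del: abs_mult)
  have "((\<lambda>h. LBINT x. ?p x * cos (x \<bullet> (z + h *\<^sub>R axis i 1)) * exp (- (\<tau> * (norm x)\<^sup>2)))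
    has_real_derivative
      (LBINT x. (?p x * x $ i) * - sin (x \<bullet> (z + 0 *\<^sub>R axis i 1)) * exp (- (\<tau> * (norm x)\<^sup>2)))) (at 0)"
    by (rule integral_gaussian_deriv[OF \<tau> b]) (simp_all add: DERIV_cos)
  then have "((\<lambda>h. LBINT x. ?p x * cos (x \<bullet> (z + h *\<^sub>R axis i 1)) * exp (- (\<tau> * (norm x)\<^sup>2)))
    has_real_derivative - ((2 * pi) ^ CARD('n) * (LBINT s. indicator {\<tau>..} s * heat_kernel_deriv3 i j k s z))) (at 0)"
    using integral_inverse_laplacian_gaussian[OF \<tau>, of j k i z] by simp
  from DERIV_cdivide[OF DERIV_minus[OF this], of "(2 * pi) ^ CARD('n)"]
  have "partial_deriv i (inv_neg_laplacian (partial_deriv j (partial_deriv k (heat_kernel \<tau>)))) z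
     = (LBINT s. indicator {\<tau>..} s * heat_kernel_deriv3 i j k s z)"
    unfolding inv_neg_laplacian_second_deriv_heat_kernel[OF \<tau>] partial_deriv_def[of i]
    by (intro DERIV_imp_deriv) simp
  then show ?thesis
    unfolding leray_def divergence_component_axis
    by (simp add: gradient_def partial_deriv_heat_kernel[OF \<tau>] axis_def)
qed

section \<open>Asymptotics of the kernel\<close>

lemma lborel_integral_of_has_integral:
  fixes f :: "real \<Rightarrow> real"
  assumes f: "(f has_integral I) S" and nonneg: "\<And>s. s \<in> S \<Longrightarrow> 0 \<le> f s"
    and [measurable]: "f \<in> borel_measurable borel" "S \<in> sets borel"
  shows "integrable lborel (\<lambda>s. indicator S s * f s)" and "(LBINT s. indicator S s * f s) = I"
proof -
  have "0 \<le> I" by (rule has_integral_nonneg[OF f nonneg])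
  have "has_bochner_integral lborel (\<lambda>s. indicator S s * f s) I"
  proof (rule has_bochner_integral_nn_integral)
    have "(\<lambda>s. indicator S s * f s) = (\<lambda>s. if s \<in> S then f s else 0)"
      by (auto simp: indicator_def)
    then have "((\<lambda>s. indicator S s * f s) has_integral I) UNIV"
      using f by (simp only: has_integral_restrict_UNIV)
    then show "(\<integral>\<^sup>+ s. ennreal (indicator S s * f s) \<partial>lborel) = ennreal I"
      by (intro nn_integral_has_integral_lborel) (auto simp: indicator_def nonneg)
  qed (use \<open>0 \<le> I\<close> in \<open>auto simp: indicator_def nonneg\<close>)
  then show "integrable lborel (\<lambda>s. indicator S s * f s)" "(LBINT s. indicator S s * f s) = I"
    by (auto simp: has_bochner_integral_iff)
qed

lemma integral_inverse_sqrt: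
  assumes "0 \<le> c"
  shows "integrable lborel (\<lambda>s. indicator {0..c} s * (1 / sqrt s))"
    and "(LBINT s. indicator {0..c} s * (1 / sqrt s)) = 2 * sqrt c"
proof -
  have "((\<lambda>s. s powr (- 1 / 2)) has_integral c powr (- 1 / 2 + 1) / (- 1 / 2 + 1)) {0..c}"
    by (rule has_integral_powr_from_0) (use assms in auto)
  moreover have "s powr (- 1 / 2) = 1 / sqrt s" if "s \<in> {0..c}" for s
    using that powr_minus_divide[of s "1 / 2"] by (auto simp: powr_half_sqrt)
  ultimately have "((\<lambda>s. 1 / sqrt s) has_integral c powr (- 1 / 2 + 1) / (- 1 / 2 + 1)) {0..c}"
    by (rule has_integral_eq[rotated])
  then have h: "((\<lambda>s. 1 / sqrt s) has_integral 2 * sqrt c) {0..c}"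
    using assms by (simp add: powr_half_sqrt mult.commute)
  show "integrable lborel (\<lambda>s. indicator {0..c} s * (1 / sqrt s))"
    by (rule lborel_integral_of_has_integral(1)[OF h]) auto
  show "(LBINT s. indicator {0..c} s * (1 / sqrt s)) = 2 * sqrt c"
    by (rule lborel_integral_of_has_integral(2)[OF h]) auto
qed

text \<open>The third derivative of G_s is a polynomial in z times G_s / s^2 and G_s / s^3. The
  projected kernel is therefore governed by the moments with m = 2 and m = 3.\<close>

definition heat_moment :: "nat \<Rightarrow> real \<Rightarrow> real ^ 'n \<Rightarrow> real" where
  "heat_moment m \<tau> z = (LBINT s. indicator {\<tau>..} s * (heat_kernel s z / s ^ m))"

lemma heat_kernel_le:
  fixes z :: "real ^ 'n"
  assumes "0 < s"
  shows "heat_kernel s z \<le> exp (- ((norm z)\<^sup>2 / (4 * s))) / sqrt s ^ CARD('n)"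
proof -
  have "1 \<le> 4 * pi" using pi_gt3 by simp
  then have "sqrt s \<le> sqrt (4 * pi * s)" using assms by simp
  then have "sqrt s ^ CARD('n) \<le> sqrt (4 * pi * s) ^ CARD('n)"
    using assms by (intro power_mono) auto
  then show ?thesis
    unfolding heat_kernel_eq[OF assms] using assms by (intro divide_left_mono) auto
qed

lemma heat_kernel_le_inverse_sqrt:
  fixes z :: "real ^ 'n"
  assumes "0 < s"
  shows "heat_kernel s z \<le> 1 / sqrt s ^ CARD('n)"
  by (rule order_trans[OF heat_kernel_le[OF assms]]) (use assms in \<open>auto intro!: divide_right_mono\<close>)

text \<open>Dropping the exponential loses only a constant factor for |z| at most sqrt(\<tau>), and
  that is where the size bound is applied.\<close>

lemma heat_moment_bound:
  fixes z :: "real ^ 'n"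
  assumes \<tau>: "0 < \<tau>" and m: "1 \<le> m"
  shows "integrable lborel (\<lambda>s. indicator {\<tau>..} s * (heat_kernel s z / s ^ Suc m))"
    and "heat_moment (Suc m) \<tau> z \<le> 1 / (\<tau> ^ m * sqrt \<tau> ^ CARD('n))"
proof -
  \<comment> \<open>The exponent of s^(-m-1) s^(-d/2). As it is at least 2, the factor 1 / (a - 1)
    produced by integration is at most 1.\<close>
  define a where "a = real (Suc m) + real CARD('n) / 2"
  have a: "2 \<le> a" using m by (simp add: a_def)
  have pw: "s powr - a = 1 / sqrt s ^ CARD('n) / s ^ Suc m" if "0 < s" for s
  proof -
    have "sqrt s ^ CARD('n) = s powr (real CARD('n) / 2)"
      using that by (simp add: powr_half_sqrt[symmetric] powr_powr powr_realpow[symmetric])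
    moreover have "s ^ Suc m = s powr real (Suc m)" using that by (simp only: powr_realpow)
    ultimately show ?thesis
      by (simp only: powr_minus_divide a_def powr_add) (simp add: field_simps)
  qed
  have "((\<lambda>s. s powr - a) has_integral -(\<tau> powr (- a + 1)) / (- a + 1)) {\<tau>..}"
    by (rule has_integral_powr_to_inf) (use a \<tau> in auto)
  note pi = lborel_integral_of_has_integral[OF this]
  have i: "integrable lborel (\<lambda>s. indicator {\<tau>..} s * s powr - a)"
    by (rule pi(1)) auto
  have le: "heat_kernel s z / s ^ Suc m \<le> s powr - a" if "\<tau> \<le> s" for s
  proof -
    have s: "0 < s" using that \<tau> by simp
    show ?thesis unfolding pw[OF s]
      by (rule divide_right_mono[OF heat_kernel_le_inverse_sqrt[OF s]]) (use s in auto)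
  qed
  show int: "integrable lborel (\<lambda>s. indicator {\<tau>..} s * (heat_kernel s z / s ^ Suc m))"
  proof (rule Bochner_Integration.integrable_bound[OF i])
    show "AE s in lborel. norm (indicator {\<tau>..} s * (heat_kernel s z / s ^ Suc m)) \<le> norm (indicator {\<tau>..} s * s powr - a)"
      using le \<tau> by (intro AE_I2) (auto simp: indicator_def abs_mult)
  qed measurable
  have "heat_moment (Suc m) \<tau> z \<le> (LBINT s. indicator {\<tau>..} s * s powr - a)"
    unfolding heat_moment_def by (rule integral_mono[OF int i]) (use le in \<open>auto simp: indicator_def\<close>)
  also have "\<dots> = -(\<tau> powr (- a + 1)) / (- a + 1)" by (rule pi(2)) auto
  also have "\<dots> = \<tau> powr (- a + 1) / (a - 1)"
    using minus_divide_divide[of "\<tau> powr (- a + 1)" "a - 1"] by (simp add: algebra_simps)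
  also have "\<dots> \<le> \<tau> powr (- a + 1)"
    using a mult_left_mono[of 1 "a - 1" "\<tau> powr (- a + 1)"] by (simp add: divide_le_eq)
  also have "\<dots> = \<tau> powr - a * \<tau>" using \<tau> powr_add[of \<tau> "- a" 1] by simp
  also have "\<dots> = 1 / (\<tau> ^ m * sqrt \<tau> ^ CARD('n))" unfolding pw[OF \<tau>] using \<tau> by simp
  finally show "heat_moment (Suc m) \<tau> z \<le> 1 / (\<tau> ^ m * sqrt \<tau> ^ CARD('n))" .
qed

lemma heat_moment_nonneg: "0 \<le> \<tau> \<Longrightarrow> 0 \<le> heat_moment m \<tau> z"
  unfolding heat_moment_def by (rule integral_nonneg_AE) (auto simp: indicator_def)

text \<open>The power d + 3 is chosen so that exactly s^(-1/2) remains: this is integrable at 0, and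
  integrating it up to \<tau> yields the factor sqrt(\<tau>).\<close>

lemma heat_kernel_le_far:
  fixes z :: "real ^ 'n"
  assumes s: "0 < s" and z: "z \<noteq> 0"
  shows "heat_kernel s z / s\<^sup>2 \<le> exp ((real (CARD('n) + 3))\<^sup>2) / (sqrt s * norm z ^ (CARD('n) + 3))"
proof -
  let ?d = "CARD('n)" and ?q = "norm z / sqrt s"
  have "?q ^ (?d + 3) * exp (- ((1/4) * ?q\<^sup>2)) \<le> exp ((real (?d + 3))\<^sup>2)"
    using gaussian_le_inverse_power[of ?q "1/4" "?d + 3" 0] s by simp
  moreover have "(1/4) * ?q\<^sup>2 = (norm z)\<^sup>2 / (4 * s)" using s by (simp add: power_divide)
  ultimately have "norm z ^ (?d + 3) * exp (- ((norm z)\<^sup>2 / (4 * s))) \<le> exp ((real (?d + 3))\<^sup>2) * sqrt s ^ (?d + 3)"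
    using s by (simp add: power_divide divide_le_eq)
  then have "exp (- ((norm z)\<^sup>2 / (4 * s))) \<le> exp ((real (?d + 3))\<^sup>2) * sqrt s ^ (?d + 3) / norm z ^ (?d + 3)"
    using z by (simp add: pos_le_divide_eq mult.commute)
  from divide_right_mono[OF this, of "sqrt s ^ ?d * s\<^sup>2"]
  have "heat_kernel s z / s\<^sup>2 \<le> exp ((real (?d + 3))\<^sup>2) * sqrt s ^ (?d + 3) / norm z ^ (?d + 3) / (sqrt s ^ ?d * s\<^sup>2)"
    using divide_right_mono[OF heat_kernel_le[OF s, of z], of "s\<^sup>2"] s by simp
  also have "\<dots> = exp ((real (?d + 3))\<^sup>2) / norm z ^ (?d + 3) * (sqrt s ^ (?d + 3) / (sqrt s ^ ?d * s\<^sup>2))"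
    by simp
  also have "sqrt s ^ (?d + 3) / (sqrt s ^ ?d * s\<^sup>2) = 1 / sqrt s"
  proof -
    have "s\<^sup>2 = sqrt s ^ 4" using s by (simp add: power4_eq_xxxx power2_eq_square)
    then show ?thesis using s by (simp add: power_add power4_eq_xxxx power3_eq_cube)
  qed
  finally show ?thesis by (simp add: mult.commute)
qed

lemma heat_kernel_time_deriv:
  fixes z :: "real ^ 'n"
  assumes s: "0 < s"
  shows "((\<lambda>s. heat_kernel s z / s) has_real_derivative
     (norm z)\<^sup>2 / 4 * (heat_kernel s z / s ^ 3) - (1 + real CARD('n) / 2) * (heat_kernel s z / s ^ 2)) (at s)"
proof -
  let ?a = "- (real CARD('n) / 2)"
  have d1: "((\<lambda>s. (4 * pi * s) powr ?a) has_real_derivative ?a * (4 * pi * s) powr ?a / s) (at s)"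
  proof -
    have "((\<lambda>s. (4 * pi * s) powr ?a) has_real_derivative ?a * (4 * pi * s) powr (?a - 1) * (4 * pi)) (at s)"
      using s by (auto intro!: derivative_eq_intros)
    moreover have "(4 * pi * s) powr (?a - 1) = (4 * pi * s) powr ?a / (4 * pi * s)"
      using s by (simp add: powr_diff)
    ultimately show ?thesis by simp
  qed
  have d3: "((\<lambda>s. 1 / s) has_real_derivative - (1 / s\<^sup>2)) (at s)"
    using s by (auto intro!: derivative_eq_intros simp: power2_eq_square)
  have d2: "((\<lambda>s. exp (- ((norm z)\<^sup>2 / (4 * s)))) has_real_derivative
      exp (- ((norm z)\<^sup>2 / (4 * s))) * ((norm z)\<^sup>2 / (4 * s\<^sup>2))) (at s)"
  proof (rule DERIV_chain2[OF DERIV_exp])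
    show "((\<lambda>s. - ((norm z)\<^sup>2 / (4 * s))) has_real_derivative (norm z)\<^sup>2 / (4 * s\<^sup>2)) (at s)"
      using DERIV_cmult[OF d3, of "- ((norm z)\<^sup>2 / 4)"] by simp
  qed
  have "((\<lambda>s. (4 * pi * s) powr ?a * exp (- ((norm z)\<^sup>2 / (4 * s))) * (1 / s)) has_real_derivative
     (norm z)\<^sup>2 / 4 * (heat_kernel s z / s ^ 3) - (1 + real CARD('n) / 2) * (heat_kernel s z / s ^ 2)) (at s)"
  proof (rule DERIV_cong[OF DERIV_mult[OF DERIV_mult[OF d1 d2] d3]])
    have alg: "(e * p / s * E + E * (n / (4 * s\<^sup>2)) * p) * (1 / s) + - (1 / s\<^sup>2) * (p * E)
        = n / 4 * (p * E / s ^ 3) - (1 - e) * (p * E / s ^ 2)" for e p E n :: real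
    proof -
      define w where "w = 1 / s"
      have w: "x / s = x * w" "x / s\<^sup>2 = x * w\<^sup>2" "x / s ^ 3 = x * w ^ 3" "x / (4 * s\<^sup>2) = x * w\<^sup>2 / 4" for x
        by (simp_all add: w_def power_divide)
      show ?thesis unfolding w by (simp add: algebra_simps power2_eq_square power3_eq_cube)
    qed
    show "(?a * (4 * pi * s) powr ?a / s * exp (- ((norm z)\<^sup>2 / (4 * s)))
       + exp (- ((norm z)\<^sup>2 / (4 * s))) * ((norm z)\<^sup>2 / (4 * s\<^sup>2)) * (4 * pi * s) powr ?a) * (1 / s)
       + - (1 / s\<^sup>2) * ((4 * pi * s) powr ?a * exp (- ((norm z)\<^sup>2 / (4 * s))))
      = (norm z)\<^sup>2 / 4 * (heat_kernel s z / s ^ 3) - (1 + real CARD('n) / 2) * (heat_kernel s z / s ^ 2)"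
      unfolding alg heat_kernel_def by simp
  qed
  then show ?thesis by (simp add: heat_kernel_def)
qed

text \<open>The fundamental theorem of calculus for G_s / s on (\<tau>, infinity), where the value
  at infinity is 0. It removes the third moment from the kernel and leaves a boundary term at
  \<tau>.\<close>

lemma heat_moment_recursion:
  fixes z :: "real ^ 'n"
  assumes \<tau>: "0 < \<tau>"
  shows "(norm z)\<^sup>2 / 4 * heat_moment 3 \<tau> z = (1 + real CARD('n) / 2) * heat_moment 2 \<tau> z - heat_kernel \<tau> z / \<tau>"
proof -
  let ?f = "\<lambda>s. (norm z)\<^sup>2 / 4 * (heat_kernel s z / s ^ 3) - (1 + real CARD('n) / 2) * (heat_kernel s z / s ^ 2)"
  have i2: "integrable lborel (\<lambda>s. indicator {\<tau>..} s * (heat_kernel s z / s ^ 2))"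
    and i3: "integrable lborel (\<lambda>s. indicator {\<tau>..} s * (heat_kernel s z / s ^ 3))"
    using heat_moment_bound(1)[OF \<tau>, of 1 z] heat_moment_bound(1)[OF \<tau>, of 2 z]
    by (simp_all add: numeral_2_eq_2 numeral_3_eq_3)
  have i: "integrable lborel (\<lambda>s. (norm z)\<^sup>2 / 4 * (indicator {\<tau>..} s * (heat_kernel s z / s ^ 3))
      - (1 + real CARD('n) / 2) * (indicator {\<tau>..} s * (heat_kernel s z / s ^ 2)))"
    by (intro Bochner_Integration.integrable_diff integrable_mult_right i2 i3)
  then have i': "integrable lborel (\<lambda>s. indicator {\<tau>..} s * ?f s)"
    by (rule back_subst[of "integrable lborel"]) (simp add: fun_eq_iff algebra_simps)
  have ei: "einterval (ereal \<tau>) \<infinity> = {\<tau><..}" by (auto simp: einterval_def)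
  have "(LBINT s=ereal \<tau>..\<infinity>. ?f s) = 0 - heat_kernel \<tau> z / \<tau>"
  proof (rule interval_integral_FTC_integrable)
    fix s assume "ereal \<tau> < ereal s"
    then have s: "0 < s" using \<tau> by simp
    show "((\<lambda>s. heat_kernel s z / s) has_vector_derivative ?f s) (at s)"
      using heat_kernel_time_deriv[OF s] by (simp only: has_real_derivative_iff_has_vector_derivative)
    show "isCont ?f s" using s unfolding heat_kernel_def by (auto intro!: continuous_intros)
  next
    have "set_integrable lborel {\<tau>..} ?f" using i' by (simp add: set_integrable_def)
    then show "set_integrable lborel (einterval (ereal \<tau>) \<infinity>) ?f"
      unfolding ei by (rule set_integrable_subset) auto
    have "isCont (\<lambda>s. heat_kernel s z / s) \<tau>"
      using heat_kernel_time_deriv[OF \<tau>] by (rule DERIV_isCont)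
    then show "(((\<lambda>s. heat_kernel s z / s) \<circ> real_of_ereal) \<longlongrightarrow> heat_kernel \<tau> z / \<tau>) (at_right (ereal \<tau>))"
      by (simp add: ereal_tendsto_simps isCont_def filterlim_at_split)
    have "((\<lambda>s. heat_kernel s z / s) \<longlongrightarrow> 0) at_top"
    proof (rule tendsto_sandwich[where f = "\<lambda>_. 0" and h = "\<lambda>s. 1 / s"])
      show "eventually (\<lambda>s. heat_kernel s z / s \<le> 1 / s) at_top"
      proof (rule eventually_at_top_linorderI[of 1])
        fix s :: real assume s: "1 \<le> s"
        have "heat_kernel s z \<le> 1 / sqrt s ^ CARD('n)" by (rule heat_kernel_le_inverse_sqrt) (use s in simp)
        also have "\<dots> \<le> 1" using s by simp
        finally show "heat_kernel s z / s \<le> 1 / s" using s by (intro divide_right_mono) auto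
      qed
      show "((\<lambda>s::real. 1 / s) \<longlongrightarrow> 0) at_top" by real_asymp
    qed (auto intro!: eventually_at_top_linorderI[of 0])
    then show "(((\<lambda>s. heat_kernel s z / s) \<circ> real_of_ereal) \<longlongrightarrow> 0) (at_left \<infinity>)"
      by (simp add: ereal_tendsto_simps)
  qed auto
  moreover have "(LBINT s=ereal \<tau>..\<infinity>. ?f s) = (LBINT s. indicator {\<tau><..} s * ?f s)"
    by (simp add: interval_lebesgue_integral_def ei set_lebesgue_integral_def)
  moreover have "\<dots> = (LBINT s. indicator {\<tau>..} s * ?f s)"
  proof (rule integral_cong_AE)
    show "AE s in lborel. indicator {\<tau><..} s * ?f s = indicator {\<tau>..} s * ?f s"
      using AE_lborel_singleton[of \<tau>] by eventually_elim (auto simp: indicator_def)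
  qed measurable
  moreover have "\<dots> = (LBINT s. (norm z)\<^sup>2 / 4 * (indicator {\<tau>..} s * (heat_kernel s z / s ^ 3))
      - (1 + real CARD('n) / 2) * (indicator {\<tau>..} s * (heat_kernel s z / s ^ 2)))"
    by (rule Bochner_Integration.integral_cong) (auto simp: algebra_simps)
  moreover have "\<dots> = (norm z)\<^sup>2 / 4 * heat_moment 3 \<tau> z - (1 + real CARD('n) / 2) * heat_moment 2 \<tau> z"
    unfolding heat_moment_def
    by (subst Bochner_Integration.integral_diff) (intro integrable_mult_right i2 i3, intro integrable_mult_right i2 i3, simp only: integral_mult_right_zero)
  ultimately show ?thesis by linarith
qed

lemma heat_moment_2_split:
  fixes z :: "real ^ 'n"
  assumes z: "z \<noteq> 0" and \<tau>: "0 < \<tau>"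
  shows "integrable lborel (\<lambda>s. indicator {0..} s * (heat_kernel s z / s\<^sup>2))"
    and "0 \<le> heat_moment 2 0 z - heat_moment 2 \<tau> z"
    and "heat_moment 2 0 z - heat_moment 2 \<tau> z
      \<le> 2 * exp ((real (CARD('n) + 3))\<^sup>2) * sqrt \<tau> / norm z ^ (CARD('n) + 3)"
proof -
  let ?C = "exp ((real (CARD('n) + 3))\<^sup>2) / norm z ^ (CARD('n) + 3)"
  let ?g = "\<lambda>s. heat_kernel s z / s\<^sup>2"
  have le: "?g s \<le> ?C * (1 / sqrt s)" if "0 \<le> s" for s
    using heat_kernel_le_far[OF _ z, of s] that by (cases "s = 0") (auto simp: mult.commute)
  have i1: "integrable lborel (\<lambda>s. indicator {0..<\<tau>} s * ?g s)"
  proof (rule Bochner_Integration.integrable_bound)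
    show "integrable lborel (\<lambda>s. ?C * (indicator {0..\<tau>} s * (1 / sqrt s)))"
      by (intro integrable_mult_right integral_inverse_sqrt) (use \<tau> in simp)
    show "AE s in lborel. norm (indicator {0..<\<tau>} s * ?g s) \<le> norm (?C * (indicator {0..\<tau>} s * (1 / sqrt s)))"
      using le by (intro AE_I2) (auto simp: indicator_def)
  qed measurable
  have i2: "integrable lborel (\<lambda>s. indicator {\<tau>..} s * ?g s)"
    using heat_moment_bound(1)[OF \<tau>, of 1 z] by (simp add: numeral_2_eq_2)
  have eq: "indicator {0..} s * ?g s = indicator {0..<\<tau>} s * ?g s + indicator {\<tau>..} s * ?g s" for s
    using \<tau> by (auto simp: indicator_def)
  show "integrable lborel (\<lambda>s. indicator {0..} s * ?g s)"
    unfolding eq by (intro Bochner_Integration.integrable_add i1 i2)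
  have diff: "heat_moment 2 0 z - heat_moment 2 \<tau> z = (LBINT s. indicator {0..<\<tau>} s * ?g s)"
    unfolding heat_moment_def eq using i1 i2 by simp
  show "0 \<le> heat_moment 2 0 z - heat_moment 2 \<tau> z"
    unfolding diff by (rule integral_nonneg_AE) (auto simp: indicator_def)
  have "(LBINT s. indicator {0..<\<tau>} s * ?g s) \<le> (LBINT s. ?C * (indicator {0..\<tau>} s * (1 / sqrt s)))"
  proof (rule integral_mono[OF i1])
    show "integrable lborel (\<lambda>s. ?C * (indicator {0..\<tau>} s * (1 / sqrt s)))"
      by (intro integrable_mult_right integral_inverse_sqrt) (use \<tau> in simp)
    show "indicator {0..<\<tau>} s * ?g s \<le> ?C * (indicator {0..\<tau>} s * (1 / sqrt s))" for s
      using le[of s] by (cases "0 \<le> s \<and> s < \<tau>") (auto simp: indicator_def)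
  qed
  also have "\<dots> = ?C * (2 * sqrt \<tau>)"
    unfolding integral_mult_right_zero by (subst integral_inverse_sqrt(2)) (use \<tau> in auto)
  finally show "heat_moment 2 0 z - heat_moment 2 \<tau> z
      \<le> 2 * exp ((real (CARD('n) + 3))\<^sup>2) * sqrt \<tau> / norm z ^ (CARD('n) + 3)"
    unfolding diff by (simp add: mult_ac)
qed

text \<open>The heat kernel depends on z only through |z|, so the substitution s -> |z|^2 s reduces
  everything to one unit vector. Strict positivity of \<open>c\<close> is what lets a vanishing far
  field force conditions on the matrix.\<close>

lemma heat_moment_2_0_homogeneous:
  obtains c where "0 < c" "\<And>z :: real ^ 'n. z \<noteq> 0 \<Longrightarrow> heat_moment 2 0 z = c / norm z ^ (CARD('n) + 2)"
proof -
  obtain e :: "real ^ 'n" where e: "norm e = 1"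
    using vector_choose_size[of 1] by auto
  then have e0: "e \<noteq> 0" by auto
  let ?g = "\<lambda>s. indicator {0..} s * (heat_kernel s e / s\<^sup>2)"
  have hom: "heat_moment 2 0 z = heat_moment 2 0 e / norm z ^ (CARD('n) + 2)" if z: "z \<noteq> 0" for z :: "real ^ 'n"
  proof -
    define r where "r = norm z"
    have r: "0 < r" using z by (simp add: r_def)
    have scale: "indicator {0..} (0 + r\<^sup>2 * s) * (heat_kernel (0 + r\<^sup>2 * s) z / (0 + r\<^sup>2 * s)\<^sup>2) = 1 / r ^ (CARD('n) + 4) * ?g s" for s
    proof (cases "0 < s")
      case True
      have "sqrt (4 * pi * (r\<^sup>2 * s)) = r * sqrt (4 * pi * s)"
        using r by (simp add: real_sqrt_mult)
      then have "heat_kernel (r\<^sup>2 * s) z = 1 / r ^ CARD('n) * heat_kernel s e"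
        using True r e by (simp add: heat_kernel_eq r_def[symmetric] power_mult_distrib)
      then show ?thesis using True r
        by (simp add: power_add power_mult_distrib power4_eq_xxxx power2_eq_square zero_le_mult_iff)
    next
      case False
      then show ?thesis using r by (cases "s = 0") (auto simp: indicator_def zero_le_mult_iff)
    qed
    have "heat_moment 2 0 z = \<bar>r\<^sup>2\<bar> *\<^sub>R (LBINT s. indicator {0..} (0 + r\<^sup>2 * s) * (heat_kernel (0 + r\<^sup>2 * s) z / (0 + r\<^sup>2 * s)\<^sup>2))"
      unfolding heat_moment_def by (rule lborel_integral_real_affine) (use r in auto)
    also have "\<dots> = r\<^sup>2 * (1 / r ^ (CARD('n) + 4) * heat_moment 2 0 e)"
      unfolding scale heat_moment_def integral_mult_right_zero by simp
    also have "\<dots> = heat_moment 2 0 e / norm z ^ (CARD('n) + 2)"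
      using r by (simp add: r_def[symmetric] power_add power4_eq_xxxx power2_eq_square)
    finally show ?thesis .
  qed
  \<comment> \<open>A lower bound for G_s(e) / s^2 on 1 <= s <= 2: the exponential is smallest at s
    = 1, the denominator largest at s = 2.\<close>
  define k where "k = exp (- 1 / 4) / (sqrt (8 * pi) ^ CARD('n) * 4)"
  have k: "0 < k" by (simp add: k_def)
  have "(LBINT s. indicator {1..2::real} s * k) \<le> heat_moment 2 0 e"
    unfolding heat_moment_def
  proof (rule integral_mono)
    show "integrable lborel (\<lambda>s::real. indicator {1..2} s * k)" by simp
    show "integrable lborel ?g" by (rule heat_moment_2_split(1)[OF e0 zero_less_one])
    show "indicator {1..2} s * k \<le> ?g s" for s
    proof (cases "s \<in> {1..2}")
      case True
      then have s: "0 < s" by simp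
      have "exp (- 1 / 4) \<le> exp (- ((norm e)\<^sup>2 / (4 * s)))"
        using True e by (simp add: field_simps)
      moreover have "sqrt (4 * pi * s) ^ CARD('n) * s\<^sup>2 \<le> sqrt (8 * pi) ^ CARD('n) * 4"
      proof (intro mult_mono power_mono)
        show "s\<^sup>2 \<le> 4" using True power_mono[of s 2 2] by simp
      qed (use True in auto)
      ultimately have "k \<le> exp (- ((norm e)\<^sup>2 / (4 * s))) / (sqrt (4 * pi * s) ^ CARD('n) * s\<^sup>2)"
        unfolding k_def using s by (intro frac_le) auto
      then show ?thesis using True s by (simp add: heat_kernel_eq)
    qed (auto simp: indicator_def)
  qed
  then have "0 < heat_moment 2 0 e" using k by simp
  then show thesis using hom by (rule that)
qed

section \<open>The kernel and its homogeneous limit\<close>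

definition oseen_kernel :: "real \<Rightarrow> 'n \<Rightarrow> 'n \<Rightarrow> real ^ 'n \<Rightarrow> real ^ 'n" where
  "oseen_kernel \<tau> j k = leray (\<lambda>z. partial_deriv k (heat_kernel \<tau>) z *\<^sub>R axis j 1)"

text \<open>
  The moment at \<open>\<tau> = 0\<close> is the homogeneous factor \<open>c / \<bar>z\<bar>\<^sup>d\<^sup>+\<^sup>2\<close>.
\<close>

definition far_kernel :: "'n \<Rightarrow> 'n \<Rightarrow> real ^ 'n \<Rightarrow> real ^ 'n" where
  "far_kernel j k z = (\<chi> i. heat_moment 2 0 z / 4 *
     ((if i = j then 1 else 0) * z $ k + (if i = k then 1 else 0) * z $ j + (if j = k then 1 else 0) * z $ i
       - (real CARD('n) + 2) * (z $ i * z $ j * z $ k / (norm z)\<^sup>2)))"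

lemma oseen_kernel_component:
  fixes z :: "real ^ 'n"
  assumes \<tau>: "0 < \<tau>"
  shows "oseen_kernel \<tau> j k z $ i =
      ((if i = j then 1 else 0) * z $ k + (if i = k then 1 else 0) * z $ j + (if j = k then 1 else 0) * z $ i) / 4
        * heat_moment 2 \<tau> z
      - z $ i * z $ j * z $ k / 8 * heat_moment 3 \<tau> z
      - (if i = j then 1 else 0) * z $ k / 2 * (heat_kernel \<tau> z / \<tau>)"
proof -
  let ?D = "(if i = j then 1 else 0) * z $ k + (if i = k then 1 else 0) * z $ j + (if j = k then 1 else 0) * z $ i"
  have i2: "integrable lborel (\<lambda>s. indicator {\<tau>..} s * (heat_kernel s z / s ^ 2))"
    and i3: "integrable lborel (\<lambda>s. indicator {\<tau>..} s * (heat_kernel s z / s ^ 3))"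
    using heat_moment_bound(1)[OF \<tau>, of 1 z] heat_moment_bound(1)[OF \<tau>, of 2 z]
    by (simp_all add: numeral_2_eq_2 numeral_3_eq_3)
  have alg: "i * ((D / (4 * S) - P / (8 * T)) * G) = D / 4 * (i * (G / S)) - P / 8 * (i * (G / T))"
    for i D P S T G :: real by (simp add: algebra_simps)
  have "(LBINT s. indicator {\<tau>..} s * heat_kernel_deriv3 i j k s z)
     = (LBINT s. ?D / 4 * (indicator {\<tau>..} s * (heat_kernel s z / s ^ 2))
       - z $ i * z $ j * z $ k / 8 * (indicator {\<tau>..} s * (heat_kernel s z / s ^ 3)))"
    unfolding heat_kernel_deriv3_def alg ..
  also have "\<dots> = ?D / 4 * heat_moment 2 \<tau> z - z $ i * z $ j * z $ k / 8 * heat_moment 3 \<tau> z"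
    unfolding heat_moment_def
    by (subst Bochner_Integration.integral_diff)
      (intro integrable_mult_right i2 i3, intro integrable_mult_right i2 i3, simp only: integral_mult_right_zero)
  finally show ?thesis
    unfolding oseen_kernel_def leray_heat_kernel_component[OF \<tau>] by simp
qed

lemma abs_delta_le:
  fixes z :: "real ^ 'n"
  shows "\<bar>(if i = j then 1 else 0) * z $ k + (if i = k then 1 else 0) * z $ j + (if j = k then 1 else 0) * z $ i\<bar> \<le> 3 * norm z"
  using abs_monomial_le(1)[of z i] abs_monomial_le(1)[of z j] abs_monomial_le(1)[of z k] norm_ge_zero[of z]
  by (auto simp del: norm_ge_zero)

lemma abs_cubic_quotient_le:
  fixes z :: "real ^ 'n"
  shows "\<bar>z $ i * z $ j * z $ k / (norm z)\<^sup>2\<bar> \<le> norm z"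
  using abs_monomial_le(3)[of z i j k]
  by (cases "z = 0") (simp_all add: divide_le_eq power3_eq_cube power2_eq_square mult.assoc)

text \<open>With the third moment eliminated, the difference has two sources only: the part of the
  second moment over (0, \<tau>) and the boundary term G_\<tau>(z) / \<tau>. Both are O(sqrt(\<tau>)
  |z|^(-d-3)) and are multiplied by quantities of size |z|.\<close>

lemma oseen_kernel_minus_far_kernel:
  fixes z :: "real ^ 'n"
  assumes \<tau>: "0 < \<tau>" and z: "z \<noteq> 0"
  shows "norm (oseen_kernel \<tau> j k z - far_kernel j k z)
    \<le> real CARD('n) * (real CARD('n) + 6) * exp ((real (CARD('n) + 3))\<^sup>2) * sqrt \<tau> / norm z ^ (CARD('n) + 2)"
proof -
  let ?d = "CARD('n)"
  let ?E = "exp ((real (?d + 3))\<^sup>2) * sqrt \<tau> / norm z ^ (?d + 3)"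
  have G: "0 \<le> heat_kernel \<tau> z / \<tau>" "heat_kernel \<tau> z / \<tau> \<le> ?E"
  proof -
    have "heat_kernel \<tau> z / \<tau> = heat_kernel \<tau> z / \<tau>\<^sup>2 * \<tau>" using \<tau> by (simp add: power2_eq_square)
    also have "\<dots> \<le> exp ((real (?d + 3))\<^sup>2) / (sqrt \<tau> * norm z ^ (?d + 3)) * \<tau>"
      by (rule mult_right_mono[OF heat_kernel_le_far[OF \<tau> z]]) (use \<tau> in simp)
    also have "\<dots> = exp ((real (?d + 3))\<^sup>2) / norm z ^ (?d + 3) * (\<tau> / sqrt \<tau>)" by simp
    also have "\<tau> / sqrt \<tau> = sqrt \<tau>" using \<tau> by (simp add: real_div_sqrt)
    finally show "heat_kernel \<tau> z / \<tau> \<le> ?E" by simp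
  qed (use \<tau> in simp)
  let ?m = "heat_moment 2 0 z - heat_moment 2 \<tau> z"
  have M: "0 \<le> ?m" "?m \<le> 2 * ?E"
    using heat_moment_2_split(2,3)[OF z \<tau>] by simp_all
  have E: "0 \<le> ?E" using \<tau> by simp
  have comp: "\<bar>(oseen_kernel \<tau> j k z - far_kernel j k z) $ i\<bar> \<le> (real ?d + 6) * ?E * norm z" for i
  proof -
    define D where "D = (if i = j then 1 else 0) * z $ k + (if i = k then 1 else 0) * z $ j + (if j = k then 1 else 0) * z $ i"
    define q where "q = z $ i * z $ j * z $ k / (norm z)\<^sup>2"
    define e where "e = (if i = j then 1 else 0) * z $ k"
    have D: "\<bar>D\<bar> \<le> 3 * norm z" unfolding D_def by (rule abs_delta_le)
    have q: "\<bar>q\<bar> \<le> norm z" unfolding q_def by (rule abs_cubic_quotient_le)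
    have e: "\<bar>e\<bar> \<le> norm z" using abs_monomial_le(1)[of z k] by (simp add: e_def)
    \<comment> \<open>Trades the third moment for the second at the price of the boundary
      term.\<close>
    have rec: "z $ i * z $ j * z $ k / 8 * heat_moment 3 \<tau> z
        = q / 2 * ((1 + real ?d / 2) * heat_moment 2 \<tau> z - heat_kernel \<tau> z / \<tau>)"
      unfolding heat_moment_recursion[OF \<tau>, symmetric] q_def using z by simp
    have alg: "D / 4 * M2 - q / 2 * ((1 + n / 2) * M2 - g) - e / 2 * g - M0 / 4 * (D - (n + 2) * q)
        = - ((M0 - M2) / 4) * (D - (n + 2) * q) + g * (q / 2 - e / 2)" for M0 M2 n g :: real
      by (simp add: field_simps)
    have "(oseen_kernel \<tau> j k z - far_kernel j k z) $ i
       = - (?m / 4) * (D - (real ?d + 2) * q) + heat_kernel \<tau> z / \<tau> * (q / 2 - e / 2)"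
      unfolding vector_minus_component oseen_kernel_component[OF \<tau>] rec far_kernel_def
        D_def[symmetric] q_def[symmetric] vec_lambda_beta
      unfolding e_def[symmetric] by (rule alg)
    also have "\<bar>\<dots>\<bar> \<le> ?m / 4 * \<bar>D - (real ?d + 2) * q\<bar> + heat_kernel \<tau> z / \<tau> * \<bar>q / 2 - e / 2\<bar>"
      using M G \<tau> by (intro order_trans[OF abs_triangle_ineq]) (simp add: abs_mult)
    also have "\<dots> \<le> (2 * ?E) / 4 * ((real ?d + 5) * norm z) + ?E * norm z"
    proof (intro add_mono mult_mono divide_right_mono M G)
      have "\<bar>(real ?d + 2) * q\<bar> \<le> (real ?d + 2) * norm z" using q by (simp add: abs_mult mult_left_mono)
      then show "\<bar>D - (real ?d + 2) * q\<bar> \<le> (real ?d + 5) * norm z"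
        using D by (simp add: algebra_simps)
      show "\<bar>q / 2 - e / 2\<bar> \<le> norm z" using q e by linarith
    qed (use E \<tau> in auto)
    also have "\<dots> = ((real ?d + 5) / 2 + 1) * (?E * norm z)"
    proof -
      have "(2 * E) / 4 * ((n + 5) * r) + E * r = ((n + 5) / 2 + 1) * (E * r)" for E n r :: real
        by (simp add: field_simps)
      then show ?thesis .
    qed
    also have "\<dots> \<le> (real ?d + 6) * (?E * norm z)"
      by (rule mult_right_mono[OF _ mult_nonneg_nonneg[OF E norm_ge_zero]]) simp
    finally show ?thesis by (simp only: mult.assoc)
  qed
  have "norm (oseen_kernel \<tau> j k z - far_kernel j k z)
     \<le> (\<Sum>i\<in>UNIV. \<bar>(oseen_kernel \<tau> j k z - far_kernel j k z) $ i\<bar>)"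
    by (rule norm_le_l1_cart)
  also have "\<dots> \<le> (\<Sum>i\<in>(UNIV::'n set). (real ?d + 6) * ?E * norm z)"
    by (rule sum_mono) (rule comp)
  also have "\<dots> = real ?d * (real ?d + 6) * (?E * norm z)" by simp
  also have "?E * norm z = exp ((real (?d + 3))\<^sup>2) * sqrt \<tau> / norm z ^ (?d + 2)"
    using z by (simp add: power_add power3_eq_cube power2_eq_square)
  finally show ?thesis by simp
qed

section \<open>Variation of the limit kernel under small shifts\<close>

text \<open>
  Satisfied by smooth functions that are homogeneous of degree \<open>- p\<close>. It is closed under sums and
  products, which reduces the far kernel to the functions \<open>x\<^sub>i / \<bar>x\<bar>\<close> and \<open>1 / \<bar>x\<bar>\<close>.
\<close>

definition far_lipschitz :: "nat \<Rightarrow> (real ^ 'n \<Rightarrow> real) \<Rightarrow> bool" where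
  "far_lipschitz p f \<longleftrightarrow> (\<exists>L\<ge>0. \<forall>x y. x \<noteq> 0 \<and> norm y \<le> norm x / 2 \<longrightarrow>
     \<bar>f (x - y)\<bar> \<le> L / norm x ^ p \<and> \<bar>f (x - y) - f x\<bar> \<le> L * norm y / norm x ^ (p + 1))"

lemma far_lipschitz_cong:
  assumes "far_lipschitz p f" "\<And>x. x \<noteq> 0 \<Longrightarrow> g x = f x"
  shows "far_lipschitz p g"
proof -
  \<comment> \<open>The restriction on the shift keeps \<open>x - y\<close> off the origin, so
    agreement away from 0 suffices.\<close>
  have "x - y \<noteq> 0" if "x \<noteq> 0" "norm y \<le> norm x / 2" for x y :: "real ^ 'a"
    using that by auto
  with assms show ?thesis unfolding far_lipschitz_def by (metis (no_types, lifting))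
qed

lemma far_lipschitz_const: "far_lipschitz 0 (\<lambda>_. c)"
  unfolding far_lipschitz_def by (rule exI[of _ "\<bar>c\<bar>"]) auto

lemma far_lipschitz_add:
  assumes "far_lipschitz p f" "far_lipschitz p g"
  shows "far_lipschitz p (\<lambda>x. f x + g x)"
proof -
  obtain L M where LM: "L \<ge> 0" "M \<ge> 0"
    "\<And>x y. x \<noteq> 0 \<and> norm y \<le> norm x / 2 \<Longrightarrow> \<bar>f (x - y)\<bar> \<le> L / norm x ^ p \<and> \<bar>f (x - y) - f x\<bar> \<le> L * norm y / norm x ^ (p + 1)"
    "\<And>x y. x \<noteq> 0 \<and> norm y \<le> norm x / 2 \<Longrightarrow> \<bar>g (x - y)\<bar> \<le> M / norm x ^ p \<and> \<bar>g (x - y) - g x\<bar> \<le> M * norm y / norm x ^ (p + 1)"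
    using assms unfolding far_lipschitz_def by blast
  show ?thesis unfolding far_lipschitz_def
  proof (rule exI[of _ "L + M"], intro conjI allI impI)
    fix x y :: "real ^ 'a" assume xy: "x \<noteq> 0 \<and> norm y \<le> norm x / 2"
    show "\<bar>f (x - y) + g (x - y)\<bar> \<le> (L + M) / norm x ^ p"
      unfolding add_divide_distrib using LM(3,4)[OF xy] by linarith
    show "\<bar>f (x - y) + g (x - y) - (f x + g x)\<bar> \<le> (L + M) * norm y / norm x ^ (p + 1)"
      unfolding add_divide_distrib distrib_right using LM(3,4)[OF xy] by linarith
  qed (use LM in simp)
qed

lemma far_lipschitz_mult:
  assumes "far_lipschitz p f" "far_lipschitz q g"
  shows "far_lipschitz (p + q) (\<lambda>x. f x * g x)"
proof -
  obtain L M where LM: "L \<ge> 0" "M \<ge> 0"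
    "\<And>x y. x \<noteq> 0 \<and> norm y \<le> norm x / 2 \<Longrightarrow> \<bar>f (x - y)\<bar> \<le> L / norm x ^ p \<and> \<bar>f (x - y) - f x\<bar> \<le> L * norm y / norm x ^ (p + 1)"
    "\<And>x y. x \<noteq> 0 \<and> norm y \<le> norm x / 2 \<Longrightarrow> \<bar>g (x - y)\<bar> \<le> M / norm x ^ q \<and> \<bar>g (x - y) - g x\<bar> \<le> M * norm y / norm x ^ (q + 1)"
    using assms unfolding far_lipschitz_def by blast
  show ?thesis unfolding far_lipschitz_def
  proof (rule exI[of _ "2 * (L * M)"], intro conjI allI impI)
    fix x y :: "real ^ 'a" assume xy: "x \<noteq> 0 \<and> norm y \<le> norm x / 2"
    \<comment> \<open>The shift 0 is admissible and gives the size bound at \<open>x\<close> itself,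
      which the second term of the product rule needs.\<close>
    have x0: "x \<noteq> 0 \<and> norm (0::real^'a) \<le> norm x / 2" using xy by simp
    have fx: "\<bar>f x\<bar> \<le> L / norm x ^ p" using LM(3)[OF x0] by simp
    note f = LM(3)[OF xy] and g = LM(4)[OF xy]
    have "\<bar>f (x - y) * g (x - y)\<bar> \<le> (L / norm x ^ p) * (M / norm x ^ q)"
      unfolding abs_mult using f g LM by (intro mult_mono) auto
    also have "\<dots> = (L * M) / norm x ^ (p + q)" by (simp add: power_add)
    also have "\<dots> \<le> 2 * (L * M) / norm x ^ (p + q)" using LM by (intro divide_right_mono) auto
    finally show "\<bar>f (x - y) * g (x - y)\<bar> \<le> 2 * (L * M) / norm x ^ (p + q)" .
    have "\<bar>f (x - y) * g (x - y) - f x * g x\<bar> = \<bar>(f (x - y) - f x) * g (x - y) + f x * (g (x - y) - g x)\<bar>"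
      by (simp add: algebra_simps)
    also have "\<dots> \<le> \<bar>f (x - y) - f x\<bar> * \<bar>g (x - y)\<bar> + \<bar>f x\<bar> * \<bar>g (x - y) - g x\<bar>"
      by (rule order_trans[OF abs_triangle_ineq]) (simp add: abs_mult)
    also have "\<dots> \<le> (L * norm y / norm x ^ (p + 1)) * (M / norm x ^ q) + (L / norm x ^ p) * (M * norm y / norm x ^ (q + 1))"
      using f g fx LM by (intro add_mono mult_mono) auto
    also have "\<dots> = 2 * (L * M) * norm y / norm x ^ (p + q + 1)" by (simp add: power_add)
    finally show "\<bar>f (x - y) * g (x - y) - f x * g x\<bar> \<le> 2 * (L * M) * norm y / norm x ^ (p + q + 1)" .
  qed (use LM in simp)
qed

lemma far_lipschitz_inverse_norm: "far_lipschitz 1 (\<lambda>x. 1 / norm x)"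
  unfolding far_lipschitz_def
proof (rule exI[of _ 2], intro conjI allI impI)
  fix x y :: "real ^ 'a" assume xy: "x \<noteq> 0 \<and> norm y \<le> norm x / 2"
  then have n: "0 < norm x" by simp
  have h: "norm x / 2 \<le> norm (x - y)" using xy norm_triangle_ineq2[of x y] by linarith
  then have p: "0 < norm (x - y)" using n by linarith
  show 1: "\<bar>1 / norm (x - y)\<bar> \<le> 2 / norm x ^ 1" using h n p by (simp add: field_simps)
  have "1 / norm (x - y) - 1 / norm x = (norm x - norm (x - y)) * (1 / norm (x - y)) * (1 / norm x)"
    using n p by (simp add: field_simps)
  also have "\<bar>\<dots>\<bar> \<le> norm y * (2 / norm x) * (1 / norm x)"
    unfolding abs_mult
  proof (intro mult_mono)
    show "\<bar>norm x - norm (x - y)\<bar> \<le> norm y" using norm_triangle_ineq3[of x "x - y"] by simp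
  qed (use 1 n in auto)
  finally show "\<bar>1 / norm (x - y) - 1 / norm x\<bar> \<le> 2 * norm y / norm x ^ (1 + 1)" by (simp add: mult.commute)
qed simp

lemma far_lipschitz_direction: "far_lipschitz 0 (\<lambda>x. x $ i / norm x)"
  unfolding far_lipschitz_def
proof (rule exI[of _ 2], intro conjI allI impI)
  fix x y :: "real ^ 'a" assume xy: "x \<noteq> 0 \<and> norm y \<le> norm x / 2"
  then have n: "0 < norm x" by simp
  have h: "norm x / 2 \<le> norm (x - y)" using xy norm_triangle_ineq2[of x y] by linarith
  then have p: "0 < norm (x - y)" using n by linarith
  have c: "\<bar>(x - y) $ i\<bar> \<le> norm (x - y)" by (rule component_le_norm_cart)
  then have c1: "\<bar>(x - y) $ i / norm (x - y)\<bar> \<le> 1" using p by (simp add: divide_le_eq)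
  then show "\<bar>(x - y) $ i / norm (x - y)\<bar> \<le> 2 / norm x ^ 0" by simp
  have "(x - y) $ i / norm (x - y) - x $ i / norm x
     = ((x - y) $ i / norm (x - y)) * ((norm x - norm (x - y)) * (1 / norm x)) - y $ i * (1 / norm x)"
    using n p by (simp add: field_simps)
  also have "\<bar>\<dots>\<bar> \<le> 1 * (norm y * (1 / norm x)) + norm y * (1 / norm x)"
  proof (rule order_trans[OF abs_triangle_ineq4 add_mono])
    have "\<bar>norm x - norm (x - y)\<bar> \<le> norm y" using norm_triangle_ineq3[of x "x - y"] by simp
    then show "\<bar>(x - y) $ i / norm (x - y) * ((norm x - norm (x - y)) * (1 / norm x))\<bar> \<le> 1 * (norm y * (1 / norm x))"
      unfolding abs_mult[of "_ / _"] abs_mult[of _ "1 / _"] using c1 by (intro mult_mono) auto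
    show "\<bar>y $ i * (1 / norm x)\<bar> \<le> norm y * (1 / norm x)"
      unfolding abs_mult using component_le_norm_cart[of y i] by (intro mult_mono) auto
  qed
  finally show "\<bar>(x - y) $ i / norm (x - y) - x $ i / norm x\<bar> \<le> 2 * norm y / norm x ^ (0 + 1)" by simp
qed simp

lemma far_lipschitz_power:
  assumes "far_lipschitz 1 f"
  shows "far_lipschitz m (\<lambda>x. f x ^ m)"
proof (induction m)
  case 0
  show ?case using far_lipschitz_const[of 1] by simp
next
  case (Suc m)
  from far_lipschitz_mult[OF assms this] show ?case by simp
qed

text \<open>The bracket in the kernel is homogeneous of degree 1. One of the d + 2 inverse powers of
  |z| turns it into a polynomial in the directions, and the other d + 1 carry the decay.\<close>

lemma far_lipschitz_far_kernel: "far_lipschitz (CARD('n) + 1) (\<lambda>z :: real ^ 'n. far_kernel j k z $ i)"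
proof -
  obtain c where c: "\<And>z :: real ^ 'n. z \<noteq> 0 \<Longrightarrow> heat_moment 2 0 z = c / norm z ^ (CARD('n) + 2)"
    using heat_moment_2_0_homogeneous by blast
  let ?e = "\<lambda>i z. z $ i / norm (z :: real ^ 'n)"
  let ?h = "\<lambda>z. c / 4 * ((if i = j then 1 else 0) * ?e k z + (if i = k then 1 else 0) * ?e j z + (if j = k then 1 else 0) * ?e i z
       + (- (real CARD('n) + 2)) * (?e i z * ?e j z * ?e k z))"
  have mult: "far_lipschitz 0 (\<lambda>x. f x * g x)" if "far_lipschitz 0 f" "far_lipschitz 0 g" for f g :: "real ^ 'n \<Rightarrow> real"
    using far_lipschitz_mult[OF that] by simp
  have "far_lipschitz 0 ?h"
    by (intro mult far_lipschitz_const far_lipschitz_add far_lipschitz_direction)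
  from far_lipschitz_mult[OF this far_lipschitz_power[OF far_lipschitz_inverse_norm, of "CARD('n) + 1"]]
  have "far_lipschitz (CARD('n) + 1) (\<lambda>z. ?h z * (1 / norm z) ^ (CARD('n) + 1))" by simp
  then show ?thesis
  proof (rule far_lipschitz_cong)
    fix z :: "real ^ 'n" assume z: "z \<noteq> 0"
    have alg: "c / (r ^ m * r ^ 2) / 4 * (a * z1 + b * z2 + d * z3 - D * (z4 * z5 * z6 / r\<^sup>2))
        = c / 4 * (a * (z1 / r) + b * (z2 / r) + d * (z3 / r) + - D * (z4 / r * (z5 / r) * (z6 / r))) * (1 / r ^ m * (1 / r))"
      if "r \<noteq> 0" for r z1 z2 z3 z4 z5 z6 a b d D :: real and m
    proof -
      define w where "w = 1 / r"
      have "x / (r ^ m * r ^ 2) = x * (1 / r ^ m) * w\<^sup>2" "x / r = x * w" "x / r\<^sup>2 = x * w\<^sup>2" for x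
        by (simp_all add: w_def power_divide)
      then show ?thesis by (simp add: algebra_simps add_divide_distrib diff_divide_distrib power2_eq_square)
    qed
    show "far_kernel j k z $ i = ?h z * (1 / norm z) ^ (CARD('n) + 1)"
      unfolding far_kernel_def vec_lambda_beta c[OF z] power_add power_one_right power_one_over
      by (rule alg) (use z in simp)
  qed
qed

lemma far_kernel_bounds:
  obtains C where "0 \<le> C"
    "\<And>j k (x :: real ^ 'n). x \<noteq> 0 \<Longrightarrow> norm (far_kernel j k x) \<le> C / norm x ^ (CARD('n) + 1)"
    "\<And>j k (x :: real ^ 'n) y. x \<noteq> 0 \<Longrightarrow> norm y \<le> norm x / 2 \<Longrightarrow>
      norm (far_kernel j k (x - y) - far_kernel j k x) \<le> C * norm y / norm x ^ (CARD('n) + 2)"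
proof -
  \<comment> \<open>The three indices are packed into a triple, so that constants can be chosen for
    all of them and summed over the finitely many triples into a single one.\<close>
  have "\<forall>t. \<exists>L\<ge>0. \<forall>(x :: real ^ 'n) y. x \<noteq> 0 \<and> norm y \<le> norm x / 2 \<longrightarrow>
     \<bar>far_kernel (fst t) (fst (snd t)) (x - y) $ (snd (snd t))\<bar> \<le> L / norm x ^ (CARD('n) + 1) \<and>
     \<bar>far_kernel (fst t) (fst (snd t)) (x - y) $ (snd (snd t)) - far_kernel (fst t) (fst (snd t)) x $ (snd (snd t))\<bar>
       \<le> L * norm y / norm x ^ (CARD('n) + 1 + 1)"
    using far_lipschitz_far_kernel unfolding far_lipschitz_def by blast
  then obtain L where L: "\<And>t. 0 \<le> L t" "\<And>t (x :: real ^ 'n) y. x \<noteq> 0 \<and> norm y \<le> norm x / 2 \<longrightarrow>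
     \<bar>far_kernel (fst t) (fst (snd t)) (x - y) $ (snd (snd t))\<bar> \<le> L t / norm x ^ (CARD('n) + 1) \<and>
     \<bar>far_kernel (fst t) (fst (snd t)) (x - y) $ (snd (snd t)) - far_kernel (fst t) (fst (snd t)) x $ (snd (snd t))\<bar>
       \<le> L t * norm y / norm x ^ (CARD('n) + 1 + 1)"
    by metis
  define C where "C = (\<Sum>t\<in>UNIV. L t)"
  have LC: "(\<Sum>i\<in>UNIV. L (j, k, i)) \<le> C" for j k
  proof -
    have "(\<Sum>i\<in>UNIV. L (j, k, i)) = (\<Sum>t\<in>(\<lambda>i. (j, k, i)) ` UNIV. L t)"
      by (subst sum.reindex) (auto simp: inj_on_def)
    also have "\<dots> \<le> C" unfolding C_def by (rule sum_mono2) (auto simp: L)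
    finally show ?thesis .
  qed
  show ?thesis
  proof (rule that[of C])
    show "0 \<le> C" unfolding C_def by (intro sum_nonneg L)
    fix j k and x :: "real ^ 'n"
    assume x: "x \<noteq> 0"
    have "norm (far_kernel j k x) \<le> (\<Sum>i\<in>UNIV. \<bar>far_kernel j k x $ i\<bar>)" by (rule norm_le_l1_cart)
    also have "\<dots> \<le> (\<Sum>i\<in>UNIV. L (j, k, i) / norm x ^ (CARD('n) + 1))"
      using L(2)[of x 0] x by (intro sum_mono) force
    also have "\<dots> \<le> C / norm x ^ (CARD('n) + 1)"
      unfolding sum_divide_distrib[symmetric] by (intro divide_right_mono LC) auto
    finally show "norm (far_kernel j k x) \<le> C / norm x ^ (CARD('n) + 1)" .
  next
    fix j k and x y :: "real ^ 'n"
    assume xy: "x \<noteq> 0" "norm y \<le> norm x / 2"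
    have "norm (far_kernel j k (x - y) - far_kernel j k x) \<le> (\<Sum>i\<in>UNIV. \<bar>(far_kernel j k (x - y) - far_kernel j k x) $ i\<bar>)"
      by (rule norm_le_l1_cart)
    also have "\<dots> \<le> (\<Sum>i\<in>UNIV. L (j, k, i) * (norm y / norm x ^ (CARD('n) + 1 + 1)))"
      using L(2)[of x y "(j, k, _)"] xy by (intro sum_mono) simp
    also have "\<dots> \<le> C * (norm y / norm x ^ (CARD('n) + 1 + 1))"
      unfolding sum_distrib_right[symmetric] by (intro mult_right_mono LC) auto
    finally show "norm (far_kernel j k (x - y) - far_kernel j k x) \<le> C * norm y / norm x ^ (CARD('n) + 2)"
      by simp
  qed
qed

section \<open>Size of the kernel, uniformly in time\<close>

lemma oseen_kernel_near:
  fixes z :: "real ^ 'n"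
  assumes \<tau>: "0 < \<tau>" and z: "norm z \<le> sqrt \<tau>"
  shows "norm (oseen_kernel \<tau> j k z) \<le> 2 * real CARD('n) / sqrt \<tau> ^ (CARD('n) + 1)"
proof -
  define r where "r = sqrt \<tau>"
  have r: "0 < r" "\<tau> = r\<^sup>2" "norm z \<le> r" using \<tau> z by (auto simp: r_def)
  let ?d = "CARD('n)"
  have M2: "heat_moment 2 \<tau> z \<le> 1 / r ^ (?d + 2)"
    using heat_moment_bound(2)[OF \<tau>, of 1 z] r(1) unfolding r_def[symmetric] r(2)
    by (simp add: numeral_2_eq_2 power_add mult_ac)
  have M3: "heat_moment 3 \<tau> z \<le> 1 / r ^ (?d + 4)"
    using heat_moment_bound(2)[OF \<tau>, of 2 z] r(1) unfolding r_def[symmetric] r(2)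
    by (simp add: numeral_3_eq_3 power_add mult_ac power4_eq_xxxx power2_eq_square)
  have G: "heat_kernel \<tau> z / \<tau> \<le> 1 / r ^ (?d + 2)"
    using divide_right_mono[OF heat_kernel_le_inverse_sqrt[OF \<tau>, of z], of \<tau>] \<tau> unfolding r_def[symmetric]
    by (simp add: r(2) power_add power2_eq_square mult_ac)
  have comp: "\<bar>oseen_kernel \<tau> j k z $ i\<bar> \<le> 2 / r ^ (?d + 1)" for i
  proof -
    define D where "D = (if i = j then 1 else 0) * z $ k + (if i = k then 1 else 0) * z $ j + (if j = k then 1 else 0) * z $ i"
    define q where "q = z $ i * z $ j * z $ k"
    define e where "e = (if i = j then 1 else 0) * z $ k"
    have D: "\<bar>D\<bar> \<le> 3 * r" using abs_delta_le[of i j z k] r by (simp add: D_def)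
    have q: "\<bar>q\<bar> \<le> r ^ 3"
      using abs_monomial_le(3)[of z i j k] power_mono[OF r(3) norm_ge_zero, of 3] unfolding q_def by linarith
    have e: "\<bar>e\<bar> \<le> r" using abs_monomial_le(1)[of z k] r by (simp add: e_def)
    have "oseen_kernel \<tau> j k z $ i = D / 4 * heat_moment 2 \<tau> z - q / 8 * heat_moment 3 \<tau> z - e / 2 * (heat_kernel \<tau> z / \<tau>)"
      unfolding oseen_kernel_component[OF \<tau>] D_def q_def e_def by simp
    also have "\<bar>\<dots>\<bar> \<le> \<bar>D\<bar> / 4 * heat_moment 2 \<tau> z + \<bar>q\<bar> / 8 * heat_moment 3 \<tau> z + \<bar>e\<bar> / 2 * (heat_kernel \<tau> z / \<tau>)"
    proof -
      have t: "\<bar>a - b - c\<bar> \<le> \<bar>a\<bar> + \<bar>b\<bar> + \<bar>c\<bar>" for a b c :: real by linarith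
      show ?thesis using t[of "D / 4 * heat_moment 2 \<tau> z" "q / 8 * heat_moment 3 \<tau> z" "e / 2 * (heat_kernel \<tau> z / \<tau>)"]
          heat_moment_nonneg[of \<tau> 2 z] heat_moment_nonneg[of \<tau> 3 z] \<tau>
        by (simp add: abs_mult)
    qed
    also have "\<dots> \<le> (3 * r) / 4 * (1 / r ^ (?d + 2)) + r ^ 3 / 8 * (1 / r ^ (?d + 4)) + r / 2 * (1 / r ^ (?d + 2))"
      using \<tau> r by (intro add_mono mult_mono divide_right_mono D q e M2 M3 G heat_moment_nonneg) auto
    \<comment> \<open>All three terms scale like r^(-d-1); the coefficients add up to 11/8, rounded
      up to 2.\<close>
    also have "\<dots> = (3 / 4 + 1 / 8 + 1 / 2) * (1 / r ^ (?d + 1))"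
      using r by (simp add: power_add power4_eq_xxxx power3_eq_cube power2_eq_square)
    also have "\<dots> \<le> 2 * (1 / r ^ (?d + 1))" using r by (intro mult_right_mono) auto
    finally show ?thesis by simp
  qed
  have "norm (oseen_kernel \<tau> j k z) \<le> (\<Sum>i\<in>UNIV. \<bar>oseen_kernel \<tau> j k z $ i\<bar>)" by (rule norm_le_l1_cart)
  also have "\<dots> \<le> (\<Sum>i\<in>(UNIV :: 'n set). 2 / r ^ (?d + 1))" by (rule sum_mono) (rule comp)
  finally show ?thesis by (simp add: r_def mult.commute)
qed

text \<open>The size bound has two regimes. For |z| <= sqrt(\<tau>) the moment bounds apply;
  otherwise the kernel is its limit plus an error that the inequality sqrt(\<tau>) <= |z| makes as
  small as the limit itself. The last bound passes through the limit kernel at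
  \<open>x - y\<close>.\<close>

lemma oseen_kernel_bounds:
  obtains C where "0 \<le> C"
    "\<And>\<tau> j k (z :: real ^ 'n). 0 < \<tau> \<Longrightarrow> norm (oseen_kernel \<tau> j k z) \<le> C / (sqrt \<tau> + norm z) ^ (CARD('n) + 1)"
    "\<And>j k (x :: real ^ 'n). x \<noteq> 0 \<Longrightarrow> norm (far_kernel j k x) \<le> C / norm x ^ (CARD('n) + 1)"
    "\<And>\<tau> j k (x :: real ^ 'n) y. 0 < \<tau> \<Longrightarrow> x \<noteq> 0 \<Longrightarrow> norm y \<le> norm x / 2 \<Longrightarrow>
      norm (oseen_kernel \<tau> j k (x - y) - far_kernel j k x) \<le> C * (sqrt \<tau> + norm y) / norm x ^ (CARD('n) + 2)"
proof -
  let ?d = "CARD('n)"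
  obtain C0 where C0: "0 \<le> C0"
    "\<And>j k (x :: real ^ 'n). x \<noteq> 0 \<Longrightarrow> norm (far_kernel j k x) \<le> C0 / norm x ^ (?d + 1)"
    "\<And>j k (x :: real ^ 'n) y. x \<noteq> 0 \<Longrightarrow> norm y \<le> norm x / 2 \<Longrightarrow>
      norm (far_kernel j k (x - y) - far_kernel j k x) \<le> C0 * norm y / norm x ^ (?d + 2)"
    using far_kernel_bounds by blast
  define C1 where "C1 = real ?d * (real ?d + 6) * exp ((real (?d + 3))\<^sup>2)"
  have C1: "0 \<le> C1" by (simp add: C1_def)
  have mf: "norm (oseen_kernel \<tau> j k z - far_kernel j k z) \<le> C1 * sqrt \<tau> / norm z ^ (?d + 2)"
    if "0 < \<tau>" "z \<noteq> 0" for \<tau> j k and z :: "real ^ 'n"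
    using oseen_kernel_minus_far_kernel[OF that] by (simp add: C1_def)
  \<comment> \<open>The power of 2 pays for replacing the larger of |z| and sqrt(\<tau>) by half of
    their sum, and |x - y| by |x| / 2.\<close>
  define C where "C = 2 ^ (?d + 2) * (C0 + C1 + 2 * real ?d)"
  have le: "B \<le> C" if "0 \<le> B" "B \<le> C0 + C1 + 2 * real ?d" for B
  proof -
    have "(1::real) \<le> 2 ^ (?d + 2)" by (rule one_le_power) simp
    then have "1 * B \<le> C" unfolding C_def using that by (intro mult_mono) auto
    then show ?thesis by simp
  qed
  show ?thesis
  proof (rule that[of C])
    show "0 \<le> C" using C0 C1 by (simp add: C_def)
    show "norm (far_kernel j k x) \<le> C / norm x ^ (?d + 1)" if "x \<noteq> 0" for j k and x :: "real ^ 'n"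
      by (rule order_trans[OF C0(2)[OF that]]) (intro divide_right_mono le, use C0 C1 in auto)
    show "norm (oseen_kernel \<tau> j k z) \<le> C / (sqrt \<tau> + norm z) ^ (?d + 1)" if \<tau>: "0 < \<tau>" for \<tau> j k and z :: "real ^ 'n"
    proof -
      have *: "B / m ^ (?d + 1) \<le> C / (sqrt \<tau> + norm z) ^ (?d + 1)"
        if m: "0 < m" "sqrt \<tau> + norm z \<le> 2 * m" and B: "0 \<le> B" "B \<le> C0 + C1 + 2 * real ?d" for B m
      proof -
        have p: "0 < sqrt \<tau> + norm z" using \<tau> by (simp add: add_pos_nonneg)
        have "B / m ^ (?d + 1) = 2 ^ (?d + 1) * B / (2 * m) ^ (?d + 1)"
          using m by (simp add: power_mult_distrib)
        also have "\<dots> \<le> C / (2 * m) ^ (?d + 1)"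
          unfolding C_def using B m by (intro divide_right_mono mult_mono power_increasing) auto
        also have "\<dots> \<le> C / (sqrt \<tau> + norm z) ^ (?d + 1)"
          using m p C0 C1 by (intro divide_left_mono power_mono mult_pos_pos) (auto simp: C_def intro!: zero_less_power)
        finally show ?thesis .
      qed
      show ?thesis
      proof (cases "norm z \<le> sqrt \<tau>")
        case True
        show ?thesis
          by (rule order_trans[OF oseen_kernel_near[OF \<tau> True] *]) (use \<tau> True C0 C1 in auto)
      next
        case False
        then have z: "z \<noteq> 0" "sqrt \<tau> \<le> norm z" using \<tau> real_sqrt_gt_zero[OF \<tau>] by auto
        have "norm (oseen_kernel \<tau> j k z) \<le> norm (oseen_kernel \<tau> j k z - far_kernel j k z) + norm (far_kernel j k z)"
          using norm_triangle_ineq[of "oseen_kernel \<tau> j k z - far_kernel j k z" "far_kernel j k z"] by simp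
        also have "\<dots> \<le> C1 * sqrt \<tau> / norm z ^ (?d + 2) + C0 / norm z ^ (?d + 1)"
          by (intro add_mono mf \<tau> z C0)
        also have "C1 * sqrt \<tau> / norm z ^ (?d + 2) \<le> C1 * norm z / norm z ^ (?d + 2)"
          using z C1 by (intro divide_right_mono mult_left_mono) auto
        also have "C1 * norm z / norm z ^ (?d + 2) + C0 / norm z ^ (?d + 1) = (C0 + C1) / norm z ^ (?d + 1)"
          using z by (simp add: add_divide_distrib)
        also have "\<dots> \<le> C / (sqrt \<tau> + norm z) ^ (?d + 1)"
          by (rule *) (use z C0 C1 in auto)
        finally show ?thesis by simp
      qed
    qed
    show "norm (oseen_kernel \<tau> j k (x - y) - far_kernel j k x) \<le> C * (sqrt \<tau> + norm y) / norm x ^ (?d + 2)"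
      if \<tau>: "0 < \<tau>" and xy: "x \<noteq> 0" "norm y \<le> norm x / 2" for \<tau> j k and x y :: "real ^ 'n"
    proof -
      have n: "0 < norm x" using xy by simp
      have h: "norm x / 2 \<le> norm (x - y)" using xy norm_triangle_ineq2[of x y] by linarith
      then have p: "0 < norm (x - y)" using n by linarith
      have "norm (oseen_kernel \<tau> j k (x - y) - far_kernel j k x)
        \<le> norm (oseen_kernel \<tau> j k (x - y) - far_kernel j k (x - y)) + norm (far_kernel j k (x - y) - far_kernel j k x)"
        using norm_triangle_ineq[of "oseen_kernel \<tau> j k (x - y) - far_kernel j k (x - y)" "far_kernel j k (x - y) - far_kernel j k x"] by simp
      also have "\<dots> \<le> C1 * sqrt \<tau> / norm (x - y) ^ (?d + 2) + C0 * norm y / norm x ^ (?d + 2)"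
        by (intro add_mono mf \<tau> C0 xy) (use p in auto)
      also have "C1 * sqrt \<tau> / norm (x - y) ^ (?d + 2) \<le> C1 * sqrt \<tau> / (norm x / 2) ^ (?d + 2)"
        using n p h C1 \<tau> by (intro divide_left_mono power_mono mult_pos_pos zero_less_power mult_nonneg_nonneg) auto
      also have "\<dots> = (2 ^ (?d + 2) * C1) * sqrt \<tau> / norm x ^ (?d + 2)"
        by (simp add: power_divide)
      also have "\<dots> \<le> C * sqrt \<tau> / norm x ^ (?d + 2)"
        unfolding C_def using C0 C1 \<tau> by (intro divide_right_mono mult_right_mono mult_left_mono) auto
      also have "C0 * norm y / norm x ^ (?d + 2) \<le> C * norm y / norm x ^ (?d + 2)"
        using C0 C1 by (intro divide_right_mono mult_right_mono le) auto
      finally show ?thesis by (simp add: distrib_left add_divide_distrib)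
    qed
  qed
qed

lemma borel_measurable_heat_moment [measurable (raw)]:
  assumes [measurable]: "f \<in> borel_measurable M" "g \<in> borel_measurable M"
  shows "(\<lambda>x. heat_moment m (f x) (g x :: real ^ 'n)) \<in> borel_measurable M"
proof -
  \<comment> \<open>As a condition in the integrand, the lower limit of integration can vary
    measurably with \<open>x\<close>.\<close>
  have "heat_moment m (f x) (g x) = (LBINT s. (if f x \<le> s then 1 else 0) * (heat_kernel s (g x) / s ^ m))" for x
    unfolding heat_moment_def by (rule Bochner_Integration.integral_cong) (auto simp: indicator_def)
  then show ?thesis by simp
qed

text \<open>The indicator confines time to the range in which the explicit components are available;
  from them joint measurability in time and space can be read off.\<close>

lemma borel_measurable_oseen_kernel [measurable (raw)]:
  assumes [measurable]: "f \<in> borel_measurable M" "g \<in> borel_measurable M"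
  shows "(\<lambda>x. indicator {0<..} (f x) *\<^sub>R oseen_kernel (f x) j k (g x :: real ^ 'n)) \<in> borel_measurable M"
proof -
  let ?K = "\<lambda>i \<tau> z. ((if i = j then 1 else 0) * z $ k + (if i = k then 1 else 0) * z $ j + (if j = k then 1 else 0) * z $ i) / 4
        * heat_moment 2 \<tau> z
      - z $ i * z $ j * z $ k / 8 * heat_moment 3 \<tau> z
      - (if i = j then 1 else 0) * z $ k / 2 * (heat_kernel \<tau> (z :: real ^ 'n) / \<tau>)"
  have eq: "(indicator {0<..} (f x) *\<^sub>R oseen_kernel (f x) j k (g x)) $ i = indicator {0<..} (f x) * ?K i (f x) (g x)" for x i
    by (cases "0 < f x") (simp_all add: oseen_kernel_component)
  have "(\<lambda>x. (indicator {0<..} (f x) *\<^sub>R oseen_kernel (f x) j k (g x)) $ i) \<in> borel_measurable M" for i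
    unfolding eq by measurable
  then show ?thesis
    by (subst borel_measurable_euclidean_space) (auto simp: Basis_vec_def inner_axis)
qed

section \<open>Decay of the solution\<close>

text \<open>A non-integrable \<open>f\<close> has integral 0 by convention, while \<open>g\<close>
  is nonnegative almost everywhere. This permits estimates of the Duhamel integral before its
  integrand is known to be measurable.\<close>

lemma norm_integral_le_of_AE:
  fixes f :: "'a \<Rightarrow> 'b::{banach, second_countable_topology}"
  assumes g: "integrable M g" and le: "AE x in M. norm (f x) \<le> g x"
  shows "norm (\<integral>x. f x \<partial>M) \<le> (\<integral>x. g x \<partial>M)"
proof (cases "integrable M f")
  case True
  then show ?thesis
    by (intro order_trans[OF integral_norm_bound] integral_mono_AE g le integrable_norm)
next
  case False
  have "0 \<le> (\<integral>x. g x \<partial>M)"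
    using le by (intro integral_nonneg_AE) (auto elim!: eventually_mono intro: order_trans[OF norm_ge_zero])
  with False show ?thesis by (simp add: not_integrable_integral_eq)
qed

lemma norm_lebesgue_integral_le:
  fixes f :: "'a::euclidean_space \<Rightarrow> 'b::{banach, second_countable_topology}"
  assumes g: "integrable lborel g" and le: "AE x in lebesgue. norm (f x) \<le> g x"
  shows "norm (\<integral>x. f x \<partial>lebesgue) \<le> (LBINT x. g x)"
proof -
  have "(\<integral>x. g x \<partial>lebesgue) = (LBINT x. g x)"
    using g by (intro integral_completion) auto
  moreover have "integrable lebesgue g"
    using g by (subst integrable_completion) auto
  ultimately show ?thesis
    using norm_integral_le_of_AE[OF _ le] by simp
qed

lemma one_divide_le_divide:
  fixes a b c :: real
  assumes "0 < a" "0 < b" "a \<le> c * b"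
  shows "1 / b \<le> c / a"
  using assms by (simp add: field_simps)

section \<open>Weighted bounds for the heat flow\<close>

definition tail_integral :: "'n::finite itself \<Rightarrow> real" where
  "tail_integral _ = (LBINT y. 1 / (1 + norm (y :: real ^ 'n)) ^ (CARD('n) + 1))"

lemma tail_integral_nonneg: "0 \<le> tail_integral TYPE('n::finite)"
  unfolding tail_integral_def by (rule integral_nonneg_AE) auto

text \<open>Rescaling by sqrt(\<tau>) makes the integral exactly proportional to \<tau>^(-1/2), a
  singularity integrable in time. Closing the Duhamel estimate depends on this.\<close>

lemma integral_parabolic_decay:
  fixes x :: "real ^ 'n"
  assumes \<tau>: "0 < \<tau>"
  shows "integrable lborel (\<lambda>y. 1 / (sqrt \<tau> + norm (x - y)) ^ (CARD('n) + 1))"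
    and "(LBINT y. 1 / (sqrt \<tau> + norm (x - y)) ^ (CARD('n) + 1)) = tail_integral TYPE('n) / sqrt \<tau>"
proof -
  define r where "r = sqrt \<tau>"
  have r: "0 < r" using \<tau> by (simp add: r_def)
  let ?f = "\<lambda>y :: real ^ 'n. 1 / (1 + norm y) ^ (CARD('n) + 1)"
  have eq: "1 / (r + norm (x - y)) ^ (CARD('n) + 1) = (1 / r ^ (CARD('n) + 1)) * ?f ((1 / r) *\<^sub>R x + (- (1 / r)) *\<^sub>R y)" for y
  proof -
    have "(1 / r) *\<^sub>R x + (- (1 / r)) *\<^sub>R y = (1 / r) *\<^sub>R (x - y)"
      by (simp add: scaleR_diff_right)
    then have "norm ((1 / r) *\<^sub>R x + (- (1 / r)) *\<^sub>R y) = norm (x - y) / r"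
      using r by simp
    then have "r * (1 + norm ((1 / r) *\<^sub>R x + (- (1 / r)) *\<^sub>R y)) = r + norm (x - y)"
      using r by (simp add: distrib_left)
    then have "(r + norm (x - y)) ^ (CARD('n) + 1)
        = r ^ (CARD('n) + 1) * (1 + norm ((1 / r) *\<^sub>R x + (- (1 / r)) *\<^sub>R y)) ^ (CARD('n) + 1)"
      by (simp only: power_mult_distrib[symmetric])
    then show ?thesis by simp
  qed
  have c: "- (1 / r) \<noteq> 0" using r by simp
  have "integrable lborel (\<lambda>y. 1 / (r + norm (x - y)) ^ (CARD('n) + 1))"
    unfolding eq by (intro integrable_mult_right lborel_integrable_translate_scale(1)[OF c] integrable_inverse_power_norm)
  then show "integrable lborel (\<lambda>y. 1 / (sqrt \<tau> + norm (x - y)) ^ (CARD('n) + 1))" by (simp add: r_def)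
  have "(LBINT y. 1 / (r + norm (x - y)) ^ (CARD('n) + 1))
      = 1 / r ^ (CARD('n) + 1) * ((1 / \<bar>- (1 / r)\<bar> ^ DIM(real ^ 'n)) *\<^sub>R tail_integral TYPE('n))"
    unfolding eq integral_mult_right_zero lborel_integrable_translate_scale(2)[OF c integrable_inverse_power_norm]
      tail_integral_def ..
  also have "\<dots> = tail_integral TYPE('n) / r" using r by (simp add: power_divide)
  finally show "(LBINT y. 1 / (sqrt \<tau> + norm (x - y)) ^ (CARD('n) + 1)) = tail_integral TYPE('n) / sqrt \<tau>"
    by (simp add: r_def)
qed

text \<open>In the variable |z| / sqrt(\<tau>) the Gaussian absorbs m + d + 1 powers: m of them pay
  for the weight, since 1 + |z| <= (1 + sqrt(\<tau>)) (1 + |z| / sqrt(\<tau>)). The others leave a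
  profile whose integral is bounded independently of \<tau>.\<close>

lemma heat_kernel_weighted_le:
  fixes z :: "real ^ 'n"
  assumes \<tau>: "0 < \<tau>"
  shows "heat_kernel \<tau> z * (1 + norm z) ^ m
    \<le> (1 + sqrt \<tau>) ^ m * exp ((real (m + CARD('n) + 1))\<^sup>2) * (sqrt \<tau> / (sqrt \<tau> + norm z) ^ (CARD('n) + 1))"
proof -
  define r where "r = sqrt \<tau>"
  have r: "0 < r" "\<tau> = r\<^sup>2" using \<tau> by (auto simp: r_def)
  let ?w = "norm z / r" and ?d = "CARD('n)"
  let ?E = "exp ((real (m + CARD('n) + 1))\<^sup>2)"
  have "1 + norm z \<le> (1 + r) * (1 + ?w)"
  proof -
    have "(1 + r) * (1 + ?w) = 1 + norm z + (r + ?w)" using r by (simp add: field_simps)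
    moreover have "0 \<le> r + ?w" using r by simp
    ultimately show ?thesis by linarith
  qed
  then have 1: "(1 + norm z) ^ m \<le> (1 + r) ^ m * (1 + ?w) ^ m"
    unfolding power_mult_distrib[symmetric] by (intro power_mono) auto
  have e: "(norm z)\<^sup>2 / (4 * \<tau>) = 1 / 4 * ?w\<^sup>2" using r by (simp add: power_divide)
  have 2: "exp (- (1 / 4 * ?w\<^sup>2)) \<le> ?E / (1 + ?w) ^ (m + ?d + 1)"
    using gaussian_le_inverse_power[of ?w "1/4" 0 "m + ?d + 1"] r by simp
  have "heat_kernel \<tau> z * (1 + norm z) ^ m \<le> (?E / (1 + ?w) ^ (m + ?d + 1) / r ^ ?d) * ((1 + r) ^ m * (1 + ?w) ^ m)"
  proof (rule mult_mono[OF order_trans[OF heat_kernel_le[OF \<tau>]] 1])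
    show "exp (- ((norm z)\<^sup>2 / (4 * \<tau>))) / sqrt \<tau> ^ ?d \<le> ?E / (1 + ?w) ^ (m + ?d + 1) / r ^ ?d"
      unfolding e r_def[symmetric] using 2 r by (intro divide_right_mono) auto
  qed (use r in auto)
  also have "\<dots> = (1 + r) ^ m * ?E * (1 / (r ^ ?d * (1 + ?w) ^ (?d + 1)))"
  proof -
    have "0 < 1 + ?w" using r by (simp add: add_pos_nonneg)
    then show ?thesis by (simp add: power_add mult_ac)
  qed
  also have "1 / (r ^ ?d * (1 + ?w) ^ (?d + 1)) = r / (r * (1 + ?w)) ^ (?d + 1)"
    using r by (simp add: power_mult_distrib)
  also have "r * (1 + ?w) = r + norm z" using r by (simp add: distrib_left)
  finally show ?thesis by (simp add: r_def)
qed

text \<open>Convolution preserves polynomial weights because 1 + |x| <= (1 + |x - y|) (1 + |y|): the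
  first factor is charged to the kernel, the second to \<open>f\<close>.\<close>

lemma heat_flow_decay:
  fixes T :: real
  obtains E where "0 \<le> E"
    "\<And>\<tau> f B (x :: real ^ 'n). 0 < \<tau> \<Longrightarrow> \<tau> \<le> T \<Longrightarrow> 0 \<le> B \<Longrightarrow>
      AE y in lebesgue. norm (f y) \<le> B / (1 + norm y) ^ m \<Longrightarrow>
      norm (heat_flow \<tau> f x) \<le> B * E / (1 + norm x) ^ m"
proof -
  let ?d = "CARD('n)"
  define E where "E = (1 + sqrt \<bar>T\<bar>) ^ m * exp ((real (m + ?d + 1))\<^sup>2) * tail_integral TYPE('n)"
  show ?thesis
  proof (rule that[of E])
    show "0 \<le> E" unfolding E_def by (intro mult_nonneg_nonneg tail_integral_nonneg) auto
    fix \<tau> B and f :: "real ^ 'n \<Rightarrow> real ^ 'n" and x :: "real ^ 'n"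
    assume \<tau>: "0 < \<tau>" "\<tau> \<le> T" and B: "0 \<le> B" and f: "AE y in lebesgue. norm (f y) \<le> B / (1 + norm y) ^ m"
    let ?c = "B * ((1 + sqrt \<bar>T\<bar>) ^ m * exp ((real (m + ?d + 1))\<^sup>2)) * sqrt \<tau> / (1 + norm x) ^ m"
    let ?g = "\<lambda>y. ?c * (1 / (sqrt \<tau> + norm (x - y)) ^ (?d + 1))"
    have "norm (heat_flow \<tau> f x) \<le> (LBINT y. ?g y)"
      unfolding heat_flow_def
    proof (rule norm_lebesgue_integral_le)
      show "integrable lborel ?g" by (intro integrable_mult_right integral_parabolic_decay \<tau>)
      show "AE y in lebesgue. norm (heat_kernel \<tau> (x - y) *\<^sub>R f y) \<le> ?g y"
        using f
      proof eventually_elim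
        case (elim y)
        have n: "0 < 1 + norm y" "0 < 1 + norm x" by (auto simp: add_pos_nonneg)
        have "norm x \<le> norm (x - y) + norm y" using norm_triangle_ineq[of "x - y" y] by simp
        moreover have "0 \<le> norm (x - y) * norm y" by simp
        ultimately have "1 + norm x \<le> (1 + norm (x - y)) * (1 + norm y)"
          unfolding distrib_left distrib_right by linarith
        then have "(1 + norm x) ^ m \<le> (1 + norm (x - y)) ^ m * (1 + norm y) ^ m"
          unfolding power_mult_distrib[symmetric] by (intro power_mono) auto
        then have w: "1 / (1 + norm y) ^ m \<le> (1 + norm (x - y)) ^ m / (1 + norm x) ^ m"
          by (intro one_divide_le_divide zero_less_power n)
        have "norm (heat_kernel \<tau> (x - y) *\<^sub>R f y) \<le> heat_kernel \<tau> (x - y) * (B * (1 / (1 + norm y) ^ m))"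
          using mult_left_mono[OF elim heat_kernel_nonneg[of \<tau> "x - y"]] by simp
        also have "\<dots> \<le> heat_kernel \<tau> (x - y) * (B * ((1 + norm (x - y)) ^ m / (1 + norm x) ^ m))"
          by (intro mult_left_mono w B) auto
        also have "\<dots> = B * (heat_kernel \<tau> (x - y) * (1 + norm (x - y)) ^ m) / (1 + norm x) ^ m" by simp
        also have "\<dots> \<le> B * ((1 + sqrt \<tau>) ^ m * exp ((real (m + ?d + 1))\<^sup>2) * (sqrt \<tau> / (sqrt \<tau> + norm (x - y)) ^ (?d + 1))) / (1 + norm x) ^ m"
          by (intro divide_right_mono mult_left_mono heat_kernel_weighted_le \<tau> B) auto
        also have "\<dots> \<le> B * ((1 + sqrt \<bar>T\<bar>) ^ m * exp ((real (m + ?d + 1))\<^sup>2) * (sqrt \<tau> / (sqrt \<tau> + norm (x - y)) ^ (?d + 1))) / (1 + norm x) ^ m"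
          using \<tau> B by (intro divide_right_mono mult_left_mono mult_right_mono power_mono) auto
        finally show ?case by (simp add: mult_ac)
      qed
    qed
    also have "\<dots> = B * E / (1 + norm x) ^ m"
      unfolding integral_mult_right_zero integral_parabolic_decay(2)[OF \<tau>(1)] E_def using \<tau> by simp
    finally show "norm (heat_flow \<tau> f x) \<le> B * E / (1 + norm x) ^ m" .
  qed
qed

section \<open>The Duhamel term in truncated weighted norms\<close>

text \<open>
  The truncation at \<open>N\<close> makes the weighted norm of a bounded function finite, as the Gronwall
  argument needs; all bounds below are uniform in \<open>N\<close>.
\<close>

definition weight :: "real \<Rightarrow> real ^ 'n \<Rightarrow> real" where
  "weight N x = min ((1 + norm x) ^ (CARD('n) + 1)) N"

lemma weight_ge_1: "1 \<le> N \<Longrightarrow> 1 \<le> weight N x"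
  unfolding weight_def by (simp del: power_Suc add: one_le_power)

lemma weight_cases:
  fixes x :: "real ^ 'n"
  shows "weight N x = (1 + norm x) ^ (CARD('n) + 1) \<or> weight N x = N"
  unfolding weight_def by linarith

text \<open>Replaces the weight at \<open>y\<close> by the weight at \<open>x\<close> under the
  convolution. If |y| is at least |x| / 2, or |x| is bounded, the weights are comparable; otherwise
  |x - y| is at least |x| / 2 and the kernel supplies the weight at \<open>x\<close>. Both remaining
  terms are integrable in \<open>y\<close>, and the constant does not see the truncation
  level.\<close>

lemma parabolic_decay_div_weight:
  fixes x y :: "real ^ 'n"
  assumes N: "1 \<le> N" and r: "0 < r"
  shows "1 / (r + norm (x - y)) ^ (CARD('n) + 1) / weight N y
    \<le> 4 ^ (CARD('n) + 1) / weight N x * (2 / (r + norm (x - y)) ^ (CARD('n) + 1) + 1 / (1 + norm y) ^ (CARD('n) + 1))"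
proof -
  let ?m = "CARD('n) + 1"
  define P where "P = 1 / (r + norm (x - y)) ^ ?m"
  define q where "q = 1 / (1 + norm y) ^ ?m"
  have W: "1 \<le> weight N x" "1 \<le> weight N y" using weight_ge_1[OF N] by auto
  have p: "0 < r + norm (x - y)" using r by (simp add: add_pos_nonneg)
  have P: "0 \<le> P" using p by (simp add: P_def)
  have q: "0 \<le> q" by (simp add: q_def)
  have "P / weight N y \<le> 4 ^ ?m / weight N x * (2 * P + q)"
  proof (cases "norm x \<le> 1 \<or> norm x / 2 \<le> norm y")
    case True
    then have "1 + norm x \<le> 2 * (1 + norm y)"
    proof
      assume "norm x \<le> 1"
      then have "norm x \<le> 1 + 2 * norm y" by (rule order_trans) simp
      then show ?thesis by (simp add: distrib_left)
    qed simp
    then have "(1 + norm x) ^ ?m \<le> 2 ^ ?m * (1 + norm y) ^ ?m"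
      unfolding power_mult_distrib[symmetric] by (intro power_mono) auto
    moreover have "N \<le> 2 ^ ?m * N" using N mult_right_mono[of 1 "2 ^ ?m" N] one_le_power[of "2 :: real" ?m] by simp
    ultimately have "weight N x \<le> 2 ^ ?m * (1 + norm y) ^ ?m" "weight N x \<le> 2 ^ ?m * N"
      unfolding weight_def min_le_iff_disj by auto
    then have "weight N x \<le> 2 ^ ?m * weight N y"
      using weight_cases[of N y] by (elim disjE) (simp_all only:)
    then have "1 / weight N y \<le> 2 ^ ?m / weight N x"
      using W by (intro one_divide_le_divide) auto
    from mult_left_mono[OF this P]
    have "P / weight N y \<le> 2 ^ ?m / weight N x * P" by (simp add: mult.commute)
    also have "\<dots> \<le> 4 ^ ?m / weight N x * (2 * P + q)"
      using W P q by (intro mult_mono divide_right_mono power_mono) auto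
    finally show ?thesis .
  next
    case False
    then have xy: "1 < norm x" "norm y < norm x / 2" by auto
    then have "norm x / 2 \<le> norm (x - y)" using norm_triangle_ineq2[of x y] by linarith
    \<comment> \<open>From 1 <= |x| and |x| <= 2 |x - y|; this is the origin of the base 4.\<close>
    then have "1 + norm x \<le> 4 * (r + norm (x - y))" unfolding distrib_left using xy r by linarith
    then have "(1 + norm x) ^ ?m \<le> 4 ^ ?m * (r + norm (x - y)) ^ ?m"
      unfolding power_mult_distrib[symmetric] by (intro power_mono) auto
    moreover have "weight N x \<le> (1 + norm x) ^ ?m" by (simp add: weight_def)
    ultimately have "weight N x \<le> 4 ^ ?m * (r + norm (x - y)) ^ ?m" by linarith
    then have Pw: "P \<le> 4 ^ ?m / weight N x"
      unfolding P_def using W p by (intro one_divide_le_divide zero_less_power) auto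
    \<comment> \<open>The reciprocal of a minimum is at most the sum of the reciprocals. The second
      one is harmless because the weight at \<open>x\<close> never exceeds \<open>N\<close>.\<close>
    have "1 / weight N y \<le> q + 1 / N"
      using weight_cases[of N y]
    proof
      assume "weight N y = (1 + norm y) ^ ?m"
      then show ?thesis using N by (simp add: q_def)
    next
      assume "weight N y = N"
      then show ?thesis using q by simp
    qed
    also have "1 / N \<le> 1 / weight N x" using W N by (intro divide_left_mono) (auto simp: weight_def)
    finally have Wy: "1 / weight N y \<le> q + 1 / weight N x" by simp
    have "P / weight N y = P * (1 / weight N y)" by simp
    also have "\<dots> \<le> P * (q + 1 / weight N x)" by (rule mult_left_mono[OF Wy P])
    also have "\<dots> = P * q + 1 / weight N x * P" by (simp add: distrib_left)
    also have "\<dots> \<le> 4 ^ ?m / weight N x * q + 4 ^ ?m / weight N x * (2 * P)"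
    proof (intro add_mono mult_mono Pw divide_right_mono)
      show "(1::real) \<le> 4 ^ ?m" by (rule one_le_power) simp
    qed (use W P q in auto)
    also have "\<dots> = 4 ^ ?m / weight N x * (2 * P + q)" by (simp add: distrib_left)
    finally show ?thesis .
  qed
  then show ?thesis by (simp only: P_def q_def times_divide_eq_right mult_1_right)
qed

lemma abs_tensor_le: "\<bar>tensor a b $ j $ k\<bar> \<le> norm a * norm b"
  unfolding tensor_def by (simp add: abs_mult mult_mono component_le_norm_cart)

text \<open>The hypothesis concerns the squared norm so that one factor can later be bounded by the
  sup norm and the other by the weighted norm. The estimate thereby becomes linear in the weighted
  norm.\<close>

lemma heat_leray_div_weighted_bound:
  obtains K where "0 \<le> K"
    "\<And>\<tau> Q N v (x :: real ^ 'n). 0 < \<tau> \<Longrightarrow> 0 \<le> Q \<Longrightarrow> 1 \<le> N \<Longrightarrow>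
      AE y in lebesgue. (norm (v y))\<^sup>2 \<le> Q / weight N y \<Longrightarrow>
      norm (heat_leray_div \<tau> (\<lambda>y. tensor (v y) (v y)) x) \<le> K * Q / weight N x * (1 / sqrt \<tau> + 1)"
proof -
  let ?d = "CARD('n)"
  obtain C where C: "0 \<le> C"
    "\<And>\<tau> j k (z :: real ^ 'n). 0 < \<tau> \<Longrightarrow> norm (oseen_kernel \<tau> j k z) \<le> C / (sqrt \<tau> + norm z) ^ (?d + 1)"
  proof (rule oseen_kernel_bounds[where 'n = 'n])
    fix C assume "0 \<le> C"
      "\<And>\<tau> j k (z :: real ^ 'n). 0 < \<tau> \<Longrightarrow> norm (oseen_kernel \<tau> j k z) \<le> C / (sqrt \<tau> + norm z) ^ (?d + 1)"
    then show thesis by (rule that)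
  qed
  let ?I = "tail_integral TYPE('n)"
  define K where "K = real ?d * real ?d * (2 * C * 4 ^ (?d + 1) * ?I)"
  show ?thesis
  proof (rule that[of K])
    show "0 \<le> K" unfolding K_def by (intro mult_nonneg_nonneg tail_integral_nonneg C) auto
    fix \<tau> Q N :: real and v :: "real ^ 'n \<Rightarrow> real ^ 'n" and x :: "real ^ 'n"
    assume \<tau>: "0 < \<tau>" and Q: "0 \<le> Q" and N: "1 \<le> N" and v: "AE y in lebesgue. (norm (v y))\<^sup>2 \<le> Q / weight N y"
    have W: "1 \<le> weight N y" for y :: "real ^ 'n" using weight_ge_1[OF N] .
    let ?c = "Q * C * 4 ^ (?d + 1) / weight N x"
    let ?g = "\<lambda>y. ?c * (2 * (1 / (sqrt \<tau> + norm (x - y)) ^ (?d + 1)) + 1 / (1 + norm y) ^ (?d + 1))"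
    have g: "integrable lborel ?g"
      by (intro integrable_mult_right Bochner_Integration.integrable_add integral_parabolic_decay \<tau> integrable_inverse_power_norm)
    have c: "0 \<le> ?c" using W[of x] C Q by simp
    have gi: "(LBINT y. ?g y) \<le> 2 * C * 4 ^ (?d + 1) * ?I * (Q / weight N x * (1 / sqrt \<tau> + 1))"
    proof -
      have "(LBINT y. ?g y) = ?c * (2 * (?I / sqrt \<tau>) + ?I)"
        by (simp only: integral_mult_right_zero Bochner_Integration.integral_add[OF
            integrable_mult_right[OF integral_parabolic_decay(1)[OF \<tau>]] integrable_inverse_power_norm]
            integral_parabolic_decay(2)[OF \<tau>] tail_integral_def)
      also have "\<dots> \<le> ?c * (2 * (?I / sqrt \<tau>) + 2 * ?I)"
        by (intro mult_left_mono c) (simp add: tail_integral_nonneg)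
      also have "\<dots> = 2 * C * 4 ^ (?d + 1) * ?I * (Q / weight N x * (1 / sqrt \<tau> + 1))"
      proof -
        have "Q * C * P / w * (2 * (I / s) + 2 * I) = 2 * C * P * I * (Q / w * (1 / s + 1))" for P w I s :: real
          by (simp add: divide_inverse algebra_simps)
        then show ?thesis .
      qed
      finally show ?thesis .
    qed
    have 1: "norm (\<integral>y. (tensor (v y) (v y) $ j $ k) *\<^sub>R oseen_kernel \<tau> j k (x - y) \<partial>lebesgue)
        \<le> 2 * C * 4 ^ (?d + 1) * ?I * (Q / weight N x * (1 / sqrt \<tau> + 1))" for j k
    proof (rule order_trans[OF norm_lebesgue_integral_le[OF g] gi])
      show "AE y in lebesgue. norm ((tensor (v y) (v y) $ j $ k) *\<^sub>R oseen_kernel \<tau> j k (x - y)) \<le> ?g y"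
        using v
      proof eventually_elim
        case (elim y)
        have "norm ((tensor (v y) (v y) $ j $ k) *\<^sub>R oseen_kernel \<tau> j k (x - y))
            \<le> (Q / weight N y) * (C / (sqrt \<tau> + norm (x - y)) ^ (?d + 1))"
          unfolding norm_scaleR
        proof (intro mult_mono C \<tau>)
          show "\<bar>tensor (v y) (v y) $ j $ k\<bar> \<le> Q / weight N y"
            using abs_tensor_le[of "v y" "v y" j k] elim unfolding power2_eq_square by linarith
          show "0 \<le> Q / weight N y" using W[of y] Q by (intro divide_nonneg_pos) linarith+
        qed simp
        also have "\<dots> = Q * C * (1 / (sqrt \<tau> + norm (x - y)) ^ (?d + 1) / weight N y)" by simp
        also have "\<dots> \<le> Q * C * (4 ^ (?d + 1) / weight N x * (2 / (sqrt \<tau> + norm (x - y)) ^ (?d + 1) + 1 / (1 + norm y) ^ (?d + 1)))"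
          by (rule mult_left_mono[OF parabolic_decay_div_weight[OF N]]) (use \<tau> Q C in auto)
        also have "\<dots> = ?g y"
        proof -
          have "Q * C * (P / w * (2 / p + q)) = Q * C * P / w * (2 * (1 / p) + q)" for P w p q :: real
            by simp
          then show ?thesis .
        qed
        finally show ?case .
      qed
    qed
    have "norm (heat_leray_div \<tau> (\<lambda>y. tensor (v y) (v y)) x)
       \<le> (\<Sum>j\<in>(UNIV::'n set). \<Sum>k\<in>(UNIV::'n set). 2 * C * 4 ^ (?d + 1) * ?I * (Q / weight N x * (1 / sqrt \<tau> + 1)))"
      unfolding heat_leray_div_def oseen_kernel_def[symmetric]
      by (intro sum_norm_le 1)
    also have "\<dots> = K * Q / weight N x * (1 / sqrt \<tau> + 1)" by (simp add: K_def)
    finally show "norm (heat_leray_div \<tau> (\<lambda>y. tensor (v y) (v y)) x) \<le> K * Q / weight N x * (1 / sqrt \<tau> + 1)" .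
  qed
qed

section \<open>Contraction in time and decay of the solution\<close>

text \<open>
  Replaces the singular Gronwall inequality: a large exponential weight in time makes the Duhamel
  operator a contraction.
\<close>

lemma exponential_time_integral:
  fixes \<nu> T \<epsilon> :: real
  assumes \<nu>: "0 < \<nu>" and T: "0 \<le> T" and \<epsilon>: "0 < \<epsilon>"
  obtains l where "0 \<le> l"
    "\<And>s. 0 \<le> s \<Longrightarrow> s \<le> T \<Longrightarrow> integrable lborel (\<lambda>r. indicator {0..s} r * (exp (l * r) * (1 / sqrt (\<nu> * (s - r)) + 1)))"
    "\<And>s. 0 \<le> s \<Longrightarrow> s \<le> T \<Longrightarrow> (LBINT r. indicator {0..s} r * (exp (l * r) * (1 / sqrt (\<nu> * (s - r)) + 1))) \<le> \<epsilon> * exp (l * s)"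
proof -
  define h where "h q = 1 / sqrt (\<nu> * q) + 1" for q
  have [measurable]: "h \<in> borel_measurable borel" unfolding h_def by measurable
  have h0: "0 \<le> h q" if "0 \<le> q" for q using that \<nu> by (simp add: h_def)
  have hint: "integrable lborel (\<lambda>q. indicator {0..s} q * h q)" if "0 \<le> s" for s
  proof -
    have "integrable lborel (\<lambda>q. (1 / sqrt \<nu>) * (indicator {0..s} q * (1 / sqrt q)) + indicator {0..s} q)"
      by (intro Bochner_Integration.integrable_add integrable_mult_right integral_inverse_sqrt that
          integrable_real_indicator) (use that in \<open>auto simp: emeasure_lborel_Icc_eq\<close>)
    moreover have "(1 / sqrt \<nu>) * (indicator {0..s} q * (1 / sqrt q)) + indicator {0..s} q = indicator {0..s} q * h q" for q
      by (simp add: h_def real_sqrt_mult indicator_def)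
    ultimately show ?thesis by simp
  qed
  have kint: "integrable lborel (\<lambda>q. indicator {0..s} q * (exp (- (l * q)) * h q))" if "0 \<le> s" "0 \<le> l" for s l
  proof (rule Bochner_Integration.integrable_bound[OF hint[OF that(1)]])
    show "AE q in lborel. norm (indicator {0..s} q * (exp (- (l * q)) * h q)) \<le> norm (indicator {0..s} q * h q)"
    proof (rule AE_I2)
      fix q
      show "norm (indicator {0..s} q * (exp (- (l * q)) * h q)) \<le> norm (indicator {0..s} q * h q)"
      proof (cases "q \<in> {0..s}")
        case True
        then have "exp (- (l * q)) * h q \<le> 1 * h q" using that by (intro mult_right_mono h0) auto
        then show ?thesis using True h0 by (simp add: indicator_def)
      qed simp
    qed
  qed measurable
  \<comment> \<open>The rate \<open>l\<close> is found among the integers by dominated convergence: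
    the factor exp(-n q) kills the integrable singularity as n grows.\<close>
  have "(\<lambda>n. LBINT q. indicator {0..T} q * (exp (- (real n * q)) * h q)) \<longlonglongrightarrow> (\<integral>q. 0 \<partial>(lborel :: real measure))"
  proof (rule integral_dominated_convergence[OF _ _ hint[OF T]])
    show "AE q in lborel. (\<lambda>n. indicator {0..T} q * (exp (- (real n * q)) * h q)) \<longlonglongrightarrow> 0"
      using AE_lborel_singleton[of 0]
    proof eventually_elim
      case (elim q)
      show ?case
      proof (cases "q \<in> {0..T}")
        case True
        then have "0 < q" using elim by simp
        then have "(\<lambda>n. exp (- (real n * q))) \<longlonglongrightarrow> 0" by real_asymp
        from tendsto_mult_left[OF tendsto_mult_right[OF this, of "h q"], of "indicator {0..T} q"] show ?thesis by simp
      qed simp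
    qed
    show "AE q in lborel. norm (indicator {0..T} q * (exp (- (real n * q)) * h q)) \<le> indicator {0..T} q * h q" for n
    proof (rule AE_I2)
      fix q
      show "norm (indicator {0..T} q * (exp (- (real n * q)) * h q)) \<le> indicator {0..T} q * h q"
      proof (cases "q \<in> {0..T}")
        case True
        then have "exp (- (real n * q)) * h q \<le> 1 * h q" by (intro mult_right_mono h0) auto
        then show ?thesis using True h0 by (simp add: indicator_def)
      qed simp
    qed
  qed measurable
  then have "eventually (\<lambda>n. (LBINT q. indicator {0..T} q * (exp (- (real n * q)) * h q)) < \<epsilon>) sequentially"
    by (rule order_tendstoD(2)) (use \<epsilon> in simp)
  then obtain n where n: "(LBINT q. indicator {0..T} q * (exp (- (real n * q)) * h q)) < \<epsilon>"
    by (auto simp: eventually_sequentially)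
  show ?thesis
  proof (rule that[of "real n"])
    fix s :: real assume s: "0 \<le> s" "s \<le> T"
    let ?k = "\<lambda>q. indicator {0..s} q * (exp (- (real n * q)) * h q)"
    have k: "integrable lborel ?k" by (rule kint) (use s in auto)
    \<comment> \<open>Time reversal q = s - r pulls out exp(n s). What remains is the integral of a
      nonnegative function over [0, s], which is largest for s = T; the choice of \<open>n\<close>
      is thus uniform in \<open>s\<close>.\<close>
    have eq: "indicator {0..s} r * (exp (real n * r) * (1 / sqrt (\<nu> * (s - r)) + 1)) = exp (real n * s) * ?k (s + (-1) *\<^sub>R r)" for r
    proof -
      have "exp (real n * r) = exp (real n * s) * exp (- (real n * (s - r)))"
        by (simp add: exp_add[symmetric] algebra_simps)
      moreover have "indicator {0..s} r = (indicator {0..s} (s - r) :: real)" by (auto simp: indicator_def)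
      ultimately show ?thesis by (simp add: h_def)
    qed
    show "integrable lborel (\<lambda>r. indicator {0..s} r * (exp (real n * r) * (1 / sqrt (\<nu> * (s - r)) + 1)))"
      unfolding eq by (intro integrable_mult_right lborel_integrable_translate_scale(1) k) simp
    have "(LBINT r. indicator {0..s} r * (exp (real n * r) * (1 / sqrt (\<nu> * (s - r)) + 1))) = exp (real n * s) * (LBINT q. ?k q)"
      unfolding eq integral_mult_right_zero
      by (subst lborel_integrable_translate_scale(2)[OF _ k]) auto
    also have "\<dots> \<le> exp (real n * s) * (LBINT q. indicator {0..T} q * (exp (- (real n * q)) * h q))"
    proof (intro mult_left_mono integral_mono k kint)
      show "?k q \<le> indicator {0..T} q * (exp (- (real n * q)) * h q)" for q
        using s h0[of q] by (cases "q \<in> {0..s}") (auto simp: indicator_def)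
    qed (use T in auto)
    also have "\<dots> \<le> exp (real n * s) * \<epsilon>" using n by (intro mult_left_mono) auto
    finally show "(LBINT r. indicator {0..s} r * (exp (real n * r) * (1 / sqrt (\<nu> * (s - r)) + 1))) \<le> \<epsilon> * exp (real n * s)"
      by (simp add: mult.commute)
  qed simp
qed

lemma heat_kernel_le_inverse_power:
  assumes \<tau>: "0 < \<tau>"
  obtains B where "0 \<le> B" "\<And>x :: real ^ 'n. heat_kernel \<tau> x \<le> B / (1 + norm x) ^ m"
proof -
  define B where "B = (1 + sqrt \<tau>) ^ m * exp ((real (m + CARD('n) + 1))\<^sup>2) * (sqrt \<tau> / sqrt \<tau> ^ (CARD('n) + 1))"
  show ?thesis
  proof (rule that[of B])
    show "0 \<le> B" using \<tau> by (simp add: B_def)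
    fix x :: "real ^ 'n"
    have n: "0 < 1 + norm x" by (simp add: add_pos_nonneg)
    have "heat_kernel \<tau> x * (1 + norm x) ^ m
      \<le> (1 + sqrt \<tau>) ^ m * exp ((real (m + CARD('n) + 1))\<^sup>2) * (sqrt \<tau> / (sqrt \<tau> + norm x) ^ (CARD('n) + 1))"
      by (rule heat_kernel_weighted_le[OF \<tau>])
    also have "\<dots> \<le> B"
      unfolding B_def using \<tau>
      by (intro mult_left_mono divide_left_mono power_mono mult_pos_pos zero_less_power add_pos_nonneg mult_nonneg_nonneg) auto
    finally show "heat_kernel \<tau> x \<le> B / (1 + norm x) ^ m"
      using n by (subst pos_le_divide_eq) auto
  qed
qed

text \<open>Continuity in L^infinity gives a bound near each time, compactness of [0, t] leaves
  finitely many of them, and their sum dominates each. The exceptional null set may depend on the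
  time.\<close>

lemma continuous_Linf_bounded:
  assumes u: "continuous_Linf I u" and I: "{0..t} \<subseteq> I"
  obtains M where "0 \<le> M" "\<And>s. s \<in> {0..t} \<Longrightarrow> AE x in lebesgue. norm (u s x) \<le> M"
proof -
  have loc: "\<exists>d m. 0 < d \<and> 0 \<le> m \<and> (\<forall>r\<in>I. dist r s < d \<longrightarrow> (AE x in lebesgue. norm (u r x) \<le> m))"
    if s: "s \<in> {0..t}" for s
  proof -
    have sI: "s \<in> I" using s I by blast
    have "Linf_norm (u s) < \<infinity>" using u sI unfolding continuous_Linf_def Linf_def by blast
    then obtain m where m: "Linf_norm (u s) \<le> ereal m"
      by (cases "Linf_norm (u s)") auto
    have us: "AE x in lebesgue. norm (u s x) \<le> m"
      using esssup_AE[of "\<lambda>x. ereal (norm (u s x))" lebesgue]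
    proof eventually_elim
      case (elim x)
      then have "ereal (norm (u s x)) \<le> ereal m" using m unfolding Linf_norm_def by (rule order_trans)
      then show ?case by simp
    qed
    have "((\<lambda>r. Linf_norm (\<lambda>x. u r x - u s x)) \<longlongrightarrow> 0) (at s within I)"
      using u sI unfolding continuous_Linf_def by blast
    then have "eventually (\<lambda>r. Linf_norm (\<lambda>x. u r x - u s x) < 1) (at s within I)"
      by (rule order_tendstoD(2)) simp
    then obtain d where d: "0 < d" "\<And>r. r \<in> I \<Longrightarrow> r \<noteq> s \<Longrightarrow> dist r s < d \<Longrightarrow> Linf_norm (\<lambda>x. u r x - u s x) < 1"
      unfolding eventually_at by blast
    have "AE x in lebesgue. norm (u r x) \<le> \<bar>m\<bar> + 1" if r: "r \<in> I" "dist r s < d" for r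
    proof (cases "r = s")
      case True
      with us show ?thesis by (auto elim!: eventually_mono)
    next
      case False
      show ?thesis
        using us esssup_AE[of "\<lambda>x. ereal (norm (u r x - u s x))" lebesgue]
      proof eventually_elim
        case (elim x)
        have "ereal (norm (u r x - u s x)) < 1"
          using elim(2) d(2)[OF r(1) False r(2)] unfolding Linf_norm_def by (rule order_le_less_trans)
        then have "norm (u r x - u s x) < 1" by (simp add: one_ereal_def)
        moreover have "norm (u r x) \<le> norm (u r x - u s x) + norm (u s x)"
          using norm_triangle_ineq[of "u r x - u s x" "u s x"] by simp
        ultimately show ?case using elim(1) by linarith
      qed
    qed
    then show ?thesis using d(1) by (intro exI[of _ d] exI[of _ "\<bar>m\<bar> + 1"]) auto
  qed
  then obtain d m where dm: "\<And>s. s \<in> {0..t} \<Longrightarrow> 0 < d s" "\<And>s. s \<in> {0..t} \<Longrightarrow> 0 \<le> m s"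
    "\<And>s r. s \<in> {0..t} \<Longrightarrow> r \<in> I \<Longrightarrow> dist r s < d s \<Longrightarrow> AE x in lebesgue. norm (u r x) \<le> m s"
    by metis
  have "{0..t} \<subseteq> (\<Union>s\<in>{0..t}. ball s (d s))" using dm(1) by force
  then obtain F where F: "F \<subseteq> {0..t}" "finite F" "{0..t} \<subseteq> (\<Union>s\<in>F. ball s (d s))"
    using compactE_image[OF compact_Icc, of "{0..t}" "\<lambda>s. ball s (d s)" 0 t] by (metis open_ball)
  show ?thesis
  proof (rule that[of "\<Sum>s\<in>F. m s"])
    show "0 \<le> (\<Sum>s\<in>F. m s)" using F dm(2) by (intro sum_nonneg) auto
    fix r assume r: "r \<in> {0..t}"
    then obtain s where s: "s \<in> F" "r \<in> ball s (d s)" using F(3) by blast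
    then have "AE x in lebesgue. norm (u r x) \<le> m s"
      using F(1) r I by (intro dm(3)) (auto simp: dist_commute)
    moreover have "m s \<le> (\<Sum>s\<in>F. m s)" using F dm(2) s by (intro member_le_sum) auto
    ultimately show "AE x in lebesgue. norm (u r x) \<le> (\<Sum>s\<in>F. m s)" by (auto elim!: eventually_mono)
  qed
qed

text \<open>One pass through the Duhamel formula improves a weighted bound S to A + S / 2. The
  truncated weight makes N M a legitimate start, iteration drives the bound to the fixed point 2 A,
  and only then is the truncation removed; the exponential in time ends up in the constant.\<close>

lemma mild_solution_decay:
  fixes u0 :: "real ^ 'n \<Rightarrow> real ^ 'n" and u :: "real \<Rightarrow> real ^ 'n \<Rightarrow> real ^ 'n"
  assumes \<nu>: "0 < \<nu>" and t: "0 < t" and M: "0 \<le> M" and B: "0 \<le> B"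
    and bound: "\<And>s. s \<in> {0..t} \<Longrightarrow> AE x in lebesgue. norm (u s x) \<le> M"
    and init: "AE x in lebesgue. u 0 x = u0 x"
    and duhamel: "\<And>s. 0 < s \<Longrightarrow> s \<le> t \<Longrightarrow> AE x in lebesgue. u s x =
           heat_flow (\<nu> * s) u0 x
           - (LINT r:{0..s}|lebesgue. heat_leray_div (\<nu> * (s - r)) (\<lambda>y. tensor (u r y) (u r y)) x)"
    and data: "AE x in lebesgue. norm (u0 x) \<le> B / (1 + norm x) ^ (CARD('n) + 1)"
  obtains A where "0 \<le> A" "\<And>s. s \<in> {0..t} \<Longrightarrow> AE x in lebesgue. norm (u s x) \<le> A / (1 + norm x) ^ (CARD('n) + 1)"
proof -
  let ?m = "CARD('n) + 1"
  obtain E where E: "0 \<le> E"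
    "\<And>\<tau> f B (x :: real ^ 'n). 0 < \<tau> \<Longrightarrow> \<tau> \<le> \<nu> * t \<Longrightarrow> 0 \<le> B \<Longrightarrow>
      AE y in lebesgue. norm (f y) \<le> B / (1 + norm y) ^ ?m \<Longrightarrow>
      norm (heat_flow \<tau> f x) \<le> B * E / (1 + norm x) ^ ?m"
    by (rule heat_flow_decay[where 'n = 'n and T = "\<nu> * t" and m = ?m]) (rule that)
  obtain K where K: "0 \<le> K"
    "\<And>\<tau> Q N v (x :: real ^ 'n). 0 < \<tau> \<Longrightarrow> 0 \<le> Q \<Longrightarrow> 1 \<le> N \<Longrightarrow>
      AE y in lebesgue. (norm (v y))\<^sup>2 \<le> Q / weight N y \<Longrightarrow>
      norm (heat_leray_div \<tau> (\<lambda>y. tensor (v y) (v y)) x) \<le> K * Q / weight N x * (1 / sqrt \<tau> + 1)"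
    by (rule heat_leray_div_weighted_bound[where 'n = 'n]) (rule that)
  \<comment> \<open>Chosen so that K M \<epsilon> <= 1/2, the contraction factor; adding 1 keeps the
    denominator positive.\<close>
  define \<epsilon> where "\<epsilon> = 1 / (2 * (K * M + 1))"
  have KM: "0 \<le> K * M" using K M by simp
  have \<epsilon>: "0 < \<epsilon>" "K * M * \<epsilon> \<le> 1 / 2" using KM by (auto simp: \<epsilon>_def field_simps)
  obtain l where l: "0 \<le> l"
    "\<And>s. 0 \<le> s \<Longrightarrow> s \<le> t \<Longrightarrow> integrable lborel (\<lambda>r. indicator {0..s} r * (exp (l * r) * (1 / sqrt (\<nu> * (s - r)) + 1)))"
    "\<And>s. 0 \<le> s \<Longrightarrow> s \<le> t \<Longrightarrow> (LBINT r. indicator {0..s} r * (exp (l * r) * (1 / sqrt (\<nu> * (s - r)) + 1))) \<le> \<epsilon> * exp (l * s)"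
    by (rule exponential_time_integral[OF \<nu> less_imp_le[OF t] \<epsilon>(1)]) (rule that)
  define A where "A = B * E + B"
  have A: "0 \<le> A" "B * E \<le> A" "B \<le> A" using B E by (auto simp: A_def)
  define P where "P N S \<longleftrightarrow> (\<forall>s\<in>{0..t}. AE x in lebesgue. weight N x * norm (u s x) \<le> S * exp (l * s))" for N S
  have step: "P N (A + S / 2)" if N: "1 \<le> N" and S: "0 \<le> S" and PS: "P N S" for N S
    unfolding P_def
  proof
    fix s assume s: "s \<in> {0..t}"
    have wle: "weight N x \<le> (1 + norm x) ^ ?m" for x :: "real ^ 'n" by (simp add: weight_def)
    have wB: "weight N x * (c / (1 + norm x) ^ ?m) \<le> c" if "0 \<le> c" for c and x :: "real ^ 'n"
    proof -
      have p: "0 < (1 + norm x) ^ ?m" by (intro zero_less_power) (simp add: add_pos_nonneg)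
      have "weight N x * (c / (1 + norm x) ^ ?m) \<le> (1 + norm x) ^ ?m * (c / (1 + norm x) ^ ?m)"
        using that p by (intro mult_right_mono wle) auto
      also have "\<dots> = c"
      proof -
        have "P * (c / P) = c" if "0 < P" for P :: real using that by simp
        then show ?thesis using p .
      qed
      finally show ?thesis .
    qed
    have e1: "1 \<le> exp (l * s)" using l s by simp
    show "AE x in lebesgue. weight N x * norm (u s x) \<le> (A + S / 2) * exp (l * s)"
    proof (cases "s = 0")
      case True
      show ?thesis using init data
      proof eventually_elim
        case (elim x)
        have "weight N x * norm (u s x) \<le> weight N x * (B / (1 + norm x) ^ ?m)"
          using elim True weight_ge_1[OF N, of x] by (intro mult_left_mono) auto
        also have "\<dots> \<le> B" by (rule wB[OF B])
        also have "\<dots> \<le> A + S / 2" using A S by simp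
        also have "\<dots> = (A + S / 2) * exp (l * s)" using True by simp
        finally show ?case .
      qed
    next
      case False
      then have s0: "0 < s" "s \<le> t" using s by auto
      have HF: "norm (heat_flow (\<nu> * s) u0 x) \<le> B * E / (1 + norm x) ^ ?m" for x
        using \<nu> s0 by (intro E(2) B data) auto
      have I: "norm (LINT r:{0..s}|lebesgue. heat_leray_div (\<nu> * (s - r)) (\<lambda>y. tensor (u r y) (u r y)) x)
          \<le> S / 2 * exp (l * s) / weight N x" for x
      proof -
        have W: "1 \<le> weight N x" by (rule weight_ge_1[OF N])
        let ?g = "\<lambda>r. K * M * S / weight N x * (indicator {0..s} r * (exp (l * r) * (1 / sqrt (\<nu> * (s - r)) + 1)))"
        have "norm (LINT r:{0..s}|lebesgue. heat_leray_div (\<nu> * (s - r)) (\<lambda>y. tensor (u r y) (u r y)) x)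
          \<le> (LBINT r. ?g r)"
          unfolding set_lebesgue_integral_def
        proof (rule norm_lebesgue_integral_le)
          show "integrable lborel ?g" using s0 by (intro integrable_mult_right l) auto
          have "AE r in lebesgue. r \<noteq> s" using AE_lborel_singleton[of s] by (rule AE_completion)
          then show "AE r in lebesgue. norm (indicator {0..s} r *\<^sub>R heat_leray_div (\<nu> * (s - r)) (\<lambda>y. tensor (u r y) (u r y)) x) \<le> ?g r"
          proof eventually_elim
            case (elim r)
            show ?case
            proof (cases "r \<in> {0..s}")
              case True
              with elim have r: "0 \<le> r" "r < s" by auto
              then have rt: "r \<in> {0..t}" using s0 by auto
              have "AE y in lebesgue. (norm (u r y))\<^sup>2 \<le> (M * S * exp (l * r)) / weight N y"
                using bound[OF rt] PS[unfolded P_def, rule_format, OF rt]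
              proof eventually_elim
                case (elim y)
                have Wy: "1 \<le> weight N y" by (rule weight_ge_1[OF N])
                \<comment> \<open>Linearisation: one factor goes to the sup bound \<open>M\<close>,
                  the other to the weighted bound that is being improved.\<close>
                have "(norm (u r y))\<^sup>2 \<le> M * norm (u r y)"
                  unfolding power2_eq_square by (intro mult_right_mono elim) auto
                also have "norm (u r y) \<le> S * exp (l * r) / weight N y"
                  using elim(2) Wy by (subst pos_le_divide_eq) (auto simp: mult.commute)
                finally show ?case using M by (simp add: mult_left_mono mult.assoc)
              qed
              then have "norm (heat_leray_div (\<nu> * (s - r)) (\<lambda>y. tensor (u r y) (u r y)) x)
                  \<le> K * (M * S * exp (l * r)) / weight N x * (1 / sqrt (\<nu> * (s - r)) + 1)"
                using \<nu> r M S N by (intro K(2)) auto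
              then show ?thesis using True by (simp add: mult.assoc)
            qed simp
          qed
        qed
        also have "\<dots> \<le> K * M * S / weight N x * (\<epsilon> * exp (l * s))"
          unfolding integral_mult_right_zero using s0 W KM S by (intro mult_left_mono l) auto
        also have "\<dots> = (K * M * \<epsilon>) * (S * exp (l * s) / weight N x)" by simp
        also have "\<dots> \<le> 1 / 2 * (S * exp (l * s) / weight N x)"
          using W S by (intro mult_right_mono \<epsilon>) auto
        finally show ?thesis by simp
      qed
      show ?thesis using duhamel[OF s0]
      proof eventually_elim
        case (elim x)
        have W: "1 \<le> weight N x" by (rule weight_ge_1[OF N])
        have "norm (u s x) \<le> B * E / (1 + norm x) ^ ?m + S / 2 * exp (l * s) / weight N x"
          unfolding elim by (rule order_trans[OF norm_triangle_ineq4 add_mono[OF HF I]])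
        then have "weight N x * norm (u s x) \<le> weight N x * (B * E / (1 + norm x) ^ ?m + S / 2 * exp (l * s) / weight N x)"
          using W by (intro mult_left_mono) auto
        also have "\<dots> = weight N x * (B * E / (1 + norm x) ^ ?m) + S / 2 * exp (l * s)"
          using W by (simp add: distrib_left)
        also have "\<dots> \<le> B * E + S / 2 * exp (l * s)" using B E by (intro add_right_mono wB) auto
        also have "\<dots> \<le> A * exp (l * s) + S / 2 * exp (l * s)"
          using mult_mono[OF A(2) e1 A(1)] by simp
        finally show ?case by (simp add: distrib_right)
      qed
    qed
  qed
  \<comment> \<open>2 A is the fixed point of S -> A + S / 2, and the excess over it is halved at
    every pass.\<close>
  have PN: "P N (2 * A + N * M * (1 / 2) ^ n)" if N: "1 \<le> N" for N n
  proof (induction n)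
    case 0
    show ?case unfolding P_def
    proof
      fix s assume s: "s \<in> {0..t}"
      show "AE x in lebesgue. weight N x * norm (u s x) \<le> (2 * A + N * M * (1 / 2) ^ 0) * exp (l * s)"
        using bound[OF s]
      proof eventually_elim
        case (elim x)
        have "weight N x * norm (u s x) \<le> N * M"
          using elim weight_ge_1[OF N, of x] by (intro mult_mono) (auto simp: weight_def)
        also have "\<dots> \<le> (2 * A + N * M) * exp (l * s)"
          using l s A N M mult_mono[of "N * M" "2 * A + N * M" 1 "exp (l * s)"] by simp
        finally show ?case by simp
      qed
    qed
  next
    case (Suc n)
    have "P N (A + (2 * A + N * M * (1 / 2) ^ n) / 2)"
      by (rule step[OF N _ Suc]) (use A N M in simp)
    moreover have "A + (2 * A + N * M * (1 / 2) ^ n) / 2 = 2 * A + N * M * (1 / 2) ^ Suc n" by simp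
    ultimately show ?case by (simp only:)
  qed
  show ?thesis
  proof (rule that[of "2 * A * exp (l * t)"])
    show "0 \<le> 2 * A * exp (l * t)" using A by simp
    fix s assume s: "s \<in> {0..t}"
    \<comment> \<open>Countably many truncation levels and iterations share one null set, so that
      both limits can be taken at a fixed point \<open>x\<close>.\<close>
    have "AE x in lebesgue. \<forall>N n. weight (real (Suc N)) x * norm (u s x) \<le> (2 * A + real (Suc N) * M * (1 / 2) ^ n) * exp (l * s)"
      unfolding AE_all_countable using PN[unfolded P_def] s by fastforce
    then show "AE x in lebesgue. norm (u s x) \<le> 2 * A * exp (l * t) / (1 + norm x) ^ ?m"
    proof eventually_elim
      case (elim x)
      \<comment> \<open>At a given point the truncation is inactive as soon as \<open>N\<close>
        exceeds the full weight there.\<close>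
      obtain N where N: "(1 + norm x) ^ ?m \<le> real N" using real_arch_simple by blast
      have w: "weight (real (Suc N)) x = (1 + norm x) ^ ?m"
        unfolding weight_def by (rule min_absorb1) (use N in linarith)
      have lim: "(\<lambda>n. (2 * A + real (Suc N) * M * (1 / 2) ^ n) * exp (l * s)) \<longlonglongrightarrow> (2 * A + real (Suc N) * M * 0) * exp (l * s)"
        by (intro tendsto_intros LIMSEQ_power_zero) auto
      have "weight (real (Suc N)) x * norm (u s x) \<le> (2 * A + real (Suc N) * M * 0) * exp (l * s)"
        by (rule LIMSEQ_le_const[OF lim]) (use elim in blast)
      then have "(1 + norm x) ^ ?m * norm (u s x) \<le> 2 * A * exp (l * s)" unfolding w by simp
      also have "\<dots> \<le> 2 * A * exp (l * t)" using A l s by (intro mult_left_mono) (auto intro: mult_left_mono)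
      finally have le: "(1 + norm x) ^ ?m * norm (u s x) \<le> 2 * A * exp (l * t)" .
      have "0 < (1 + norm x) ^ ?m" by (intro zero_less_power) (simp add: add_pos_nonneg)
      then show ?case using le by (simp only: pos_le_divide_eq mult.commute)
    qed
  qed
qed

section \<open>The far field of the solution\<close>

text \<open>Completeness of \<open>lebesgue\<close> carries measurability over from \<open>g\<close>
  to \<open>f\<close>. This is the bridge from the integrals in the definitions to Fubini for
  \<open>lborel\<close>.\<close>

lemma lebesgue_integral_eq_lborel_of_AE:
  fixes f g :: "'a::euclidean_space \<Rightarrow> 'b::{banach, second_countable_topology}"
  assumes g: "g \<in> borel_measurable borel" and ae: "AE x in lborel. f x = g x"
  shows "(\<integral>x. f x \<partial>lebesgue) = (LBINT x. g x)"
proof -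
  have gl: "g \<in> borel_measurable lebesgue" using g by (intro measurable_completion) simp
  have ae': "AE x in lebesgue. f x = g x" using ae by (rule AE_completion)
  have fl: "f \<in> borel_measurable lebesgue"
  proof (rule measurableI)
    fix A :: "'b set" assume A: "A \<in> sets borel"
    show "f -` A \<inter> space lebesgue \<in> sets lebesgue"
    proof (rule completion.in_sets_AE)
      show "AE x in lebesgue. x \<in> g -` A \<inter> space lebesgue \<longleftrightarrow> x \<in> f -` A \<inter> space lebesgue"
        using ae' by eventually_elim simp
      show "g -` A \<inter> space lebesgue \<in> sets lebesgue" by (rule measurable_sets[OF gl A])
    qed simp
  qed simp
  have "(\<integral>x. f x \<partial>lebesgue) = (\<integral>x. g x \<partial>lebesgue)"
    by (rule integral_cong_AE[OF fl gl ae'])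
  also have "\<dots> = (LBINT x. g x)" using g by (intro integral_completion) simp
  finally show ?thesis .
qed

text \<open>The factor \<open>w\<close> decays like the square of an integrable weight. For |y| <=
  |x| / 2 one copy of the weight pays for the factor sqrt(\<tau>) + |y| in the kernel comparison and
  the other is left for integration in \<open>y\<close>. For larger |y| the weight itself yields
  powers of 1 / |x|, and the two kernels are bounded separately.\<close>

lemma oseen_kernel_far_difference:
  fixes C D T \<tau> w :: real and x y :: "real ^ 'n"
  assumes C: "0 \<le> C"
    "\<And>\<tau> j k (z :: real ^ 'n). 0 < \<tau> \<Longrightarrow> norm (oseen_kernel \<tau> j k z) \<le> C / (sqrt \<tau> + norm z) ^ (CARD('n) + 1)"
    "\<And>j k (x :: real ^ 'n). x \<noteq> 0 \<Longrightarrow> norm (far_kernel j k x) \<le> C / norm x ^ (CARD('n) + 1)"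
    "\<And>\<tau> j k (x :: real ^ 'n) y. 0 < \<tau> \<Longrightarrow> x \<noteq> 0 \<Longrightarrow> norm y \<le> norm x / 2 \<Longrightarrow>
      norm (oseen_kernel \<tau> j k (x - y) - far_kernel j k x) \<le> C * (sqrt \<tau> + norm y) / norm x ^ (CARD('n) + 2)"
    and D: "0 \<le> D" and w: "\<bar>w\<bar> \<le> D / (1 + norm y) ^ (2 * (CARD('n) + 1))"
    and \<tau>: "0 < \<tau>" "\<tau> \<le> T" and x: "1 \<le> norm x"
  shows "norm (w *\<^sub>R oseen_kernel \<tau> j k (x - y) - w *\<^sub>R far_kernel j k x)
    \<le> C * D * 4 ^ (CARD('n) + 1) * (1 + sqrt T) / norm x ^ (CARD('n) + 2)
      * (2 * (1 / (1 + norm y) ^ (CARD('n) + 1)) + 1 / (sqrt \<tau> + norm (x - y)) ^ (CARD('n) + 1))"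
proof -
  define m where "m = CARD('n) + 1"
  have m: "1 \<le> m" "CARD('n) + 2 = m + 1" by (auto simp: m_def)
  define q where "q = 1 / (1 + norm y) ^ m"
  define P where "P = 1 / (sqrt \<tau> + norm (x - y)) ^ m"
  define X where "X = 1 / norm x ^ (m + 1)"
  have x0: "x \<noteq> 0" using x by auto
  have y1: "0 < 1 + norm y" by (simp add: add_pos_nonneg)
  have T: "1 \<le> 1 + sqrt T" "sqrt \<tau> \<le> sqrt T" using \<tau> by auto
  have q: "0 \<le> q" by (simp add: q_def)
  have P: "0 \<le> P" using \<tau> by (simp add: P_def)
  have X: "0 \<le> X" by (simp add: X_def)
  have four: "(1::real) \<le> 4 ^ m" "2 ^ m \<le> (4::real) ^ m" by (auto intro: one_le_power power_mono)
  have w': "\<bar>w\<bar> \<le> D * q * q"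
    using w unfolding q_def m_def[symmetric] by (simp add: power_add mult_2)
  have "norm (w *\<^sub>R oseen_kernel \<tau> j k (x - y) - w *\<^sub>R far_kernel j k x) \<le> C * D * 4 ^ m * (1 + sqrt T) * X * (2 * q + P)"
  proof (cases "norm y \<le> norm x / 2")
    case True
    have "norm (w *\<^sub>R oseen_kernel \<tau> j k (x - y) - w *\<^sub>R far_kernel j k x)
        = \<bar>w\<bar> * norm (oseen_kernel \<tau> j k (x - y) - far_kernel j k x)"
      unfolding scaleR_diff_right[symmetric] norm_scaleR ..
    also have "\<dots> \<le> (D * q * q) * (C * (sqrt \<tau> + norm y) / norm x ^ (CARD('n) + 2))"
      using D q by (intro mult_mono w' C(4) \<tau> x0 True) auto
    also have "\<dots> = C * D * X * q * (q * (sqrt \<tau> + norm y))"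
      unfolding X_def m(2) by (simp add: mult_ac)
    also have "\<dots> \<le> C * D * X * q * (1 + sqrt T)"
    proof -
      have "sqrt \<tau> + norm y \<le> (1 + sqrt T) * (1 + norm y)"
      proof -
        have "(1 + sqrt T) * (1 + norm y) = 1 + sqrt T + norm y + sqrt T * norm y" by (simp add: algebra_simps)
        moreover have "0 \<le> sqrt T * norm y" using T by simp
        ultimately show ?thesis using T by linarith
      qed
      also have "\<dots> \<le> (1 + sqrt T) * (1 + norm y) ^ m"
        using T m self_le_power[of "1 + norm y" m] by (intro mult_left_mono) auto
      finally have "q * (sqrt \<tau> + norm y) \<le> 1 + sqrt T"
        using y1 by (simp add: q_def divide_le_eq)
      then show ?thesis using C D X q by (intro mult_left_mono) auto
    qed
    also have "\<dots> \<le> (4 ^ m * (2 * q + P)) * (C * D * X * (1 + sqrt T))"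
    proof -
      have "1 * q \<le> 4 ^ m * (2 * q + P)" using four q P by (intro mult_mono) auto
      then have "q * (C * D * X * (1 + sqrt T)) \<le> (4 ^ m * (2 * q + P)) * (C * D * X * (1 + sqrt T))"
        using C D X T by (intro mult_right_mono mult_nonneg_nonneg) auto
      then show ?thesis by (simp add: mult_ac)
    qed
    finally show ?thesis by (simp add: mult_ac)
  next
    case False
    then have yx: "norm x \<le> 2 * (1 + norm y)" by simp
    have nx: "0 < norm x" using x by linarith
    have qX: "q \<le> 2 ^ m / norm x ^ m"
    proof -
      have "norm x ^ m \<le> 2 ^ m * (1 + norm y) ^ m"
        unfolding power_mult_distrib[symmetric] by (intro power_mono yx) auto
      then show ?thesis unfolding q_def using nx y1 by (intro one_divide_le_divide zero_less_power) auto
    qed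
    \<comment> \<open>As |x| >= 1, the power 2 m may be lowered to m + 1 = d + 2, the order of the
      error.\<close>
    have XX: "1 / norm x ^ m * (1 / norm x ^ m) \<le> X"
    proof -
      have "norm x ^ (m + 1) \<le> norm x ^ (m + m)" using x m by (intro power_increasing) auto
      then show ?thesis using nx unfolding X_def by (simp add: power_add[symmetric] frac_le)
    qed
    have far: "\<bar>w\<bar> * norm (far_kernel j k x) \<le> C * D * 4 ^ m * X * q"
    proof -
      have "\<bar>w\<bar> * norm (far_kernel j k x) \<le> (D * q * q) * (C * (1 / norm x ^ m))"
        using C(3)[OF x0, of j k] D q by (intro mult_mono w') (auto simp: m_def)
      also have "\<dots> = C * D * q * (q * (1 / norm x ^ m))" by simp
      also have "\<dots> \<le> C * D * q * (2 ^ m / norm x ^ m * (1 / norm x ^ m))"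
        using C D q by (intro mult_left_mono mult_right_mono qX) auto
      also have "\<dots> = C * D * q * (2 ^ m * (1 / norm x ^ m * (1 / norm x ^ m)))" by simp
      also have "\<dots> \<le> C * D * q * (4 ^ m * X)"
        using C D q by (intro mult_left_mono mult_mono XX four) auto
      finally show ?thesis by (simp add: mult_ac)
    qed
    have os: "\<bar>w\<bar> * norm (oseen_kernel \<tau> j k (x - y)) \<le> C * D * 4 ^ m * X * P"
    proof -
      have "\<bar>w\<bar> * norm (oseen_kernel \<tau> j k (x - y)) \<le> (D * q * q) * (C * P)"
        using C(2)[OF \<tau>(1), of j k "x - y"] D q by (intro mult_mono w') (auto simp: m_def P_def)
      also have "\<dots> = C * D * P * (q * q)" by simp
      also have "\<dots> \<le> C * D * P * (2 ^ m / norm x ^ m * (2 ^ m / norm x ^ m))"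
        using C D q P by (intro mult_left_mono mult_mono qX) auto
      also have "\<dots> = C * D * P * (4 ^ m * (1 / norm x ^ m * (1 / norm x ^ m)))"
        by (simp add: power_mult_distrib[symmetric])
      also have "\<dots> \<le> C * D * P * (4 ^ m * X)"
        using C D P by (intro mult_left_mono XX) auto
      finally show ?thesis by (simp add: mult_ac)
    qed
    have "norm (w *\<^sub>R oseen_kernel \<tau> j k (x - y) - w *\<^sub>R far_kernel j k x)
       \<le> \<bar>w\<bar> * norm (oseen_kernel \<tau> j k (x - y)) + \<bar>w\<bar> * norm (far_kernel j k x)"
      by (rule order_trans[OF norm_triangle_ineq4]) simp
    also have "\<dots> \<le> C * D * 4 ^ m * X * P + C * D * 4 ^ m * X * q" by (intro add_mono far os)
    also have "\<dots> = (C * D * 4 ^ m * X) * (1 * (P + q))" by (simp add: algebra_simps)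
    also have "\<dots> \<le> (C * D * 4 ^ m * X) * ((1 + sqrt T) * (2 * q + P))"
      using C D X T P q by (intro mult_left_mono mult_mono) auto
    finally show ?thesis by (simp add: mult_ac)
  qed
  then show ?thesis unfolding X_def q_def P_def m(2) unfolding m_def by simp
qed

lemma integrable_parabolic_time:
  fixes \<nu> t :: real
  assumes \<nu>: "0 < \<nu>" and t: "0 < t"
  shows "integrable lborel (\<lambda>s. indicator {0<..<t} s * (a + b / sqrt (\<nu> * (t - s))))"
proof -
  have "integrable lborel (\<lambda>s. indicator {0..t} (t + (-1) *\<^sub>R s) * (1 / sqrt (t + (-1) *\<^sub>R s)))"
    by (rule lborel_integrable_translate_scale(1)[of "-1" "\<lambda>s. indicator {0..t} s * (1 / sqrt s)" t])
      (use integral_inverse_sqrt(1)[of t] t in auto)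
  then have "integrable lborel (\<lambda>s. a * indicator {0..t} s + b / sqrt \<nu> * (indicator {0..t} (t + (-1) *\<^sub>R s) * (1 / sqrt (t + (-1) *\<^sub>R s))))"
    by (intro Bochner_Integration.integrable_add integrable_mult_right integrable_real_indicator)
      (use t in \<open>auto simp: emeasure_lborel_Icc_eq\<close>)
  then show ?thesis
  proof (rule Bochner_Integration.integrable_bound)
    show "AE s in lborel. norm (indicator {0<..<t} s * (a + b / sqrt (\<nu> * (t - s))))
      \<le> norm (a * indicator {0..t} s + b / sqrt \<nu> * (indicator {0..t} (t + (-1) *\<^sub>R s) * (1 / sqrt (t + (-1) *\<^sub>R s))))"
      using t by (intro AE_I2) (auto simp: indicator_def real_sqrt_mult)
  qed measurable
qed

text \<open>Integrates the pointwise comparison. The integral in \<open>y\<close> costs (t -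
  s)^(-1/2), which is integrable up to s = t, so the order d + 2 of the error survives.\<close>

lemma oseen_convolution_asymptotics:
  fixes W :: "real \<times> (real ^ 'n) \<Rightarrow> real" and \<nu> t D :: real
  assumes \<nu>: "0 < \<nu>" and t: "0 < t" and D: "0 \<le> D" and W: "W \<in> borel_measurable borel"
    and bound: "\<And>s y. \<bar>W (s, y)\<bar> \<le> indicator {0<..<t} s * (D / (1 + norm y) ^ (2 * (CARD('n) + 1)))"
  obtains R where "0 \<le> R"
    "\<And>j k x. 1 \<le> norm x \<Longrightarrow> integrable lborel (\<lambda>s. LBINT y. W (s, y) *\<^sub>R (indicator {0<..} (\<nu> * (t - s)) *\<^sub>R oseen_kernel (\<nu> * (t - s)) j k (x - y)))"
    "\<And>j k x. 1 \<le> norm x \<Longrightarrow>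
      norm ((LBINT s. (LBINT y. W (s, y) *\<^sub>R (indicator {0<..} (\<nu> * (t - s)) *\<^sub>R oseen_kernel (\<nu> * (t - s)) j k (x - y))))
        - (LBINT p. W p) *\<^sub>R far_kernel j k x) \<le> R / norm x ^ (CARD('n) + 2)"
proof -
  let ?m = "CARD('n) + 1" and ?I = "tail_integral TYPE('n)"
  obtain C where C: "0 \<le> C"
    "\<And>\<tau> j k (z :: real ^ 'n). 0 < \<tau> \<Longrightarrow> norm (oseen_kernel \<tau> j k z) \<le> C / (sqrt \<tau> + norm z) ^ (CARD('n) + 1)"
    "\<And>j k (x :: real ^ 'n). x \<noteq> 0 \<Longrightarrow> norm (far_kernel j k x) \<le> C / norm x ^ (CARD('n) + 1)"
    "\<And>\<tau> j k (x :: real ^ 'n) y. 0 < \<tau> \<Longrightarrow> x \<noteq> 0 \<Longrightarrow> norm y \<le> norm x / 2 \<Longrightarrow>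
      norm (oseen_kernel \<tau> j k (x - y) - far_kernel j k x) \<le> C * (sqrt \<tau> + norm y) / norm x ^ (CARD('n) + 2)"
    by (rule oseen_kernel_bounds[where 'n = 'n]) (rule that)
  have [measurable]: "W \<in> borel_measurable (borel \<Otimes>\<^sub>M borel)" using W by (simp add: borel_prod)
  let ?g = "\<lambda>s. indicator {0<..<t} s * (D * ?I) :: real"
  let ?h = "\<lambda>s y. indicator {0<..<t} s * D * (1 / (1 + norm (y :: real ^ 'n)) ^ ?m)"
  have g: "integrable lborel ?g" using t by (intro integrable_mult_left integrable_real_indicator) auto
  have h: "integrable lborel (?h s)" for s by (intro integrable_mult_right integrable_inverse_power_norm)
  have W_le: "norm (W (s, y)) \<le> ?h s y" for s y
  proof -
    have "1 / (1 + norm y) ^ (2 * ?m) \<le> 1 / (1 + norm y) ^ ?m"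
      by (intro divide_left_mono power_increasing mult_pos_pos zero_less_power) (auto simp: add_pos_nonneg)
    from mult_left_mono[OF this, of "indicator {0<..<t} s * D"] D
    have "indicator {0<..<t} s * (D / (1 + norm y) ^ (2 * ?m)) \<le> ?h s y" by simp
    with bound[of s y] show ?thesis by simp
  qed
  have Wy: "integrable lborel (\<lambda>y. W (s, y))" for s
    by (rule integrable_of_norm_le[OF h _ W_le]) measurable
  have "norm (LBINT y. norm (W (s, y))) \<le> ?g s" for s
  proof -
    have "norm (LBINT y. norm (W (s, y))) \<le> (LBINT y. ?h s y)"
      by (rule norm_integral_le_of_AE[OF h]) (use W_le in simp)
    also have "\<dots> = indicator {0<..<t} s * D * ?I" by (simp only: integral_mult_right_zero tail_integral_def)
    finally show ?thesis by (simp only: mult.assoc)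
  qed
  then have Wn: "integrable lborel (\<lambda>s. LBINT y. norm (W (s, y)))"
    by (intro integrable_of_norm_le[OF g]) measurable
  have Wint: "integrable (lborel \<Otimes>\<^sub>M lborel) W"
    by (rule lborel_pair.Fubini_integrable[OF _ Wn]) (use W Wy in \<open>simp_all add: lborel_prod\<close>)
  have Ws: "integrable lborel (\<lambda>s. LBINT y. W (s, y))"
    by (rule lborel_pair.integrable_fst'[OF Wint])
  have Wp: "(LBINT p. W p) = (LBINT s. (LBINT y. W (s, y)))"
    using lborel_pair.integral_fst'[OF Wint] by (simp add: lborel_prod)
  define c where "c = C * D * 4 ^ ?m * (1 + sqrt (\<nu> * t))"
  have c: "0 \<le> c" using C D \<nu> t by (simp add: c_def)
  define R where "R = (LBINT s. indicator {0<..<t} s * (c * 2 * ?I + c * ?I / sqrt (\<nu> * (t - s))))"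
  have Rint: "integrable lborel (\<lambda>s. indicator {0<..<t} s * (c * 2 * ?I + c * ?I / sqrt (\<nu> * (t - s))))"
    by (rule integrable_parabolic_time[OF \<nu> t])
  have key: "integrable lborel (\<lambda>s. LBINT y. W (s, y) *\<^sub>R (indicator {0<..} (\<nu> * (t - s)) *\<^sub>R oseen_kernel (\<nu> * (t - s)) j k (x - y))) \<and>
      norm ((LBINT s. (LBINT y. W (s, y) *\<^sub>R (indicator {0<..} (\<nu> * (t - s)) *\<^sub>R oseen_kernel (\<nu> * (t - s)) j k (x - y))))
        - (LBINT p. W p) *\<^sub>R far_kernel j k x) \<le> R / norm x ^ (CARD('n) + 2)"
    if x: "1 \<le> norm x" for j k and x :: "real ^ 'n"
  proof -
    let ?\<phi> = "\<lambda>s y. W (s, y) *\<^sub>R (indicator {0<..} (\<nu> * (t - s)) *\<^sub>R oseen_kernel (\<nu> * (t - s)) j k (x - y))"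
    let ?B = "\<lambda>s. indicator {0<..<t} s * (c * 2 * ?I + c * ?I / sqrt (\<nu> * (t - s))) / norm x ^ (CARD('n) + 2)"
    let ?H = "far_kernel j k x"
    have [measurable]: "(\<lambda>p. ?\<phi> (fst p) (snd p)) \<in> borel_measurable (borel \<Otimes>\<^sub>M borel)" by measurable
    have fm: "(\<lambda>s. LBINT y. ?\<phi> s y) \<in> borel_measurable borel" by measurable
    have diff: "norm ((LBINT y. ?\<phi> s y) - (LBINT y. W (s, y)) *\<^sub>R ?H) \<le> ?B s" for s
    proof (cases "s \<in> {0<..<t}")
      case False
      then have "W (s, y) = 0" for y using bound[of s y] by simp
      then show ?thesis using False by simp
    next
      case True
      then have \<tau>: "0 < \<nu> * (t - s)" "\<nu> * (t - s) \<le> \<nu> * t" using \<nu> by auto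
      let ?g = "\<lambda>y. c / norm x ^ (CARD('n) + 2) * (2 * (1 / (1 + norm y) ^ ?m) + 1 / (sqrt (\<nu> * (t - s)) + norm (x - y)) ^ ?m)"
      have g: "integrable lborel ?g"
        by (intro integrable_mult_right Bochner_Integration.integrable_add integral_parabolic_decay \<tau> integrable_inverse_power_norm)
      have le: "norm (?\<phi> s y - W (s, y) *\<^sub>R ?H) \<le> ?g y" for y :: "real ^ 'n"
        using oseen_kernel_far_difference[OF C D _ \<tau> x, of "W (s, y)" y j k] bound[of s y] True \<tau>
        by (simp add: c_def)
      have W1: "integrable lborel (\<lambda>y. W (s, y) *\<^sub>R ?H)" by (intro integrable_scaleR_left Wy)
      \<comment> \<open>The bound at hand concerns the difference; integrability of the convolution
        integrand follows by adding back the integrable term that was subtracted.\<close>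
      have "integrable lborel (\<lambda>y. ?\<phi> s y - W (s, y) *\<^sub>R ?H)"
        by (rule integrable_of_norm_le[OF g _ le]) measurable
      from Bochner_Integration.integrable_add[OF this W1]
      have \<phi>1: "integrable lborel (?\<phi> s)" by simp
      have eq: "(LBINT y. ?\<phi> s y) - (LBINT y. W (s, y)) *\<^sub>R ?H = (LBINT y. ?\<phi> s y - W (s, y) *\<^sub>R ?H)"
        by (simp only: Bochner_Integration.integral_diff[OF \<phi>1 W1] integral_scaleR_left[OF Wy])
      have "norm ((LBINT y. ?\<phi> s y) - (LBINT y. W (s, y)) *\<^sub>R ?H) \<le> (LBINT y. ?g y)"
        unfolding eq by (rule norm_integral_le_of_AE[OF g]) (use le in simp)
      also have "\<dots> = c / norm x ^ (CARD('n) + 2) * (2 * ?I + ?I / sqrt (\<nu> * (t - s)))"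
      proof -
        have i: "integrable lborel (\<lambda>y :: real ^ 'n. 2 * (1 / (1 + norm y) ^ ?m))"
          by (intro integrable_mult_right integrable_inverse_power_norm)
        show ?thesis
          unfolding integral_mult_right_zero
            Bochner_Integration.integral_add[OF i integral_parabolic_decay(1)[OF \<tau>(1)]]
            integral_parabolic_decay(2)[OF \<tau>(1)]
          by (simp only: tail_integral_def)
      qed
      also have "\<dots> = ?B s" using True by (simp add: algebra_simps add_divide_distrib)
      finally show ?thesis .
    qed
    have Bint: "integrable lborel ?B" by (intro integrable_divide Rint)
    have WsH: "integrable lborel (\<lambda>s. (LBINT y. W (s, y)) *\<^sub>R ?H)" by (intro integrable_scaleR_left Ws)
    have gint: "integrable lborel (\<lambda>s. (LBINT y. ?\<phi> s y) - (LBINT y. W (s, y)) *\<^sub>R ?H)"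
      by (rule integrable_of_norm_le[OF Bint _ diff]) (use fm WsH in auto)
    from Bochner_Integration.integrable_add[OF this WsH]
    have fint: "integrable lborel (\<lambda>s. LBINT y. ?\<phi> s y)" by simp
    have eq: "(LBINT s. (LBINT y. ?\<phi> s y)) - (LBINT p. W p) *\<^sub>R ?H
       = (LBINT s. (LBINT y. ?\<phi> s y) - (LBINT y. W (s, y)) *\<^sub>R ?H)"
      by (simp only: Bochner_Integration.integral_diff[OF fint WsH] integral_scaleR_left[OF Ws] Wp)
    have "norm ((LBINT s. (LBINT y. ?\<phi> s y)) - (LBINT p. W p) *\<^sub>R ?H) \<le> (LBINT s. ?B s)"
      unfolding eq by (rule norm_integral_le_of_AE[OF Bint]) (use diff in simp)
    also have "\<dots> = R / norm x ^ (CARD('n) + 2)" unfolding R_def by simp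
    finally show ?thesis using fint by blast
  qed
  show ?thesis
  proof (rule that[of R])
    show "0 \<le> R" unfolding R_def using c \<nu>
      by (intro integral_nonneg_AE AE_I2) (auto simp: indicator_def tail_integral_nonneg intro!: add_nonneg_nonneg divide_nonneg_nonneg mult_nonneg_nonneg)
  qed (use key in auto)
qed

text \<open>A Lebesgue measurable function on space-time may have non-measurable sections. A Borel
  version restores Fubini, and it agrees with the product for almost every \<open>y\<close> at
  almost every time, which is all that the iterated integral in the Duhamel formula can see.\<close>

lemma product_borel_version:
  fixes u :: "real \<Rightarrow> real ^ 'n \<Rightarrow> real ^ 'n" and A t :: real and j k :: 'n
  assumes meas: "(\<lambda>(s, x). u s x) \<in> borel_measurable (lebesgue_on (I \<times> UNIV))" and I: "{0..t} \<subseteq> I"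
    and A: "0 \<le> A" and decay: "\<And>s. s \<in> {0..t} \<Longrightarrow> AE x in lebesgue. norm (u s x) \<le> A / (1 + norm x) ^ m"
  obtains W :: "real \<times> (real ^ 'n) \<Rightarrow> real" where "W \<in> borel_measurable borel"
    "\<And>s y. \<bar>W (s, y)\<bar> \<le> indicator {0<..<t} s * (A\<^sup>2 / (1 + norm y) ^ (2 * m))"
    "AE s in lborel. s \<in> {0<..<t} \<longrightarrow> (AE y in lborel. u s y $ j * u s y $ k = W (s, y))"
    "L2_inner t (\<lambda>s x. u s x $ j) (\<lambda>s x. u s x $ k) = (LBINT p. W p)"
proof -
  define S where "S = {0<..<t} \<times> (UNIV :: (real ^ 'n) set)"
  have "open S" by (simp add: S_def open_Times)
  then have S: "S \<in> sets lebesgue" by simp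
  define U where "U p = (if p \<in> S then (\<lambda>(s, x). u s x) p else 0)" for p
  have U: "U \<in> borel_measurable lebesgue"
    unfolding U_def
  proof (rule borel_measurable_if_I[OF measurable_restrict_mono[OF meas] S])
    show "S \<subseteq> I \<times> UNIV" using I by (auto simp: S_def)
  qed
  define F where "F p = U p $ j * U p $ k" for p
  have "F \<in> borel_measurable lebesgue"
    unfolding F_def using borel_measurable_vec_nth_compose[OF U] by (intro borel_measurable_times) auto
  then obtain W0 where W0: "W0 \<in> borel_measurable lborel" "AE p in lborel. F p = W0 p"
    using completion_ex_borel_measurable_real by blast
  have [measurable]: "W0 \<in> borel_measurable (borel \<Otimes>\<^sub>M borel)" using W0(1) by (simp add: borel_prod)
  define b where "b p = indicator {0<..<t} (fst p) * (A\<^sup>2 / (1 + norm (snd p)) ^ (2 * m))" for p :: "real \<times> (real ^ 'n)"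
  have [measurable]: "b \<in> borel_measurable (borel \<Otimes>\<^sub>M borel)" unfolding b_def by measurable
  \<comment> \<open>Cutting off where the bound fails makes it hold at every point while changing
    the function on a null set only.\<close>
  define W where "W p = (if \<bar>W0 p\<bar> \<le> b p then W0 p else 0)" for p
  have b0: "0 \<le> b p" for p by (simp add: b_def)
  have "AE s in lborel. AE y in lborel. F (s, y) = W0 (s, y)"
    by (rule lborel_pair.AE_pair) (use W0(2) in \<open>simp only: lborel_prod\<close>)
  then have "AE s in lborel. AE y in lborel. \<bar>W0 (s, y)\<bar> \<le> b (s, y)"
  proof eventually_elim
    case (elim s)
    show ?case
    proof (cases "s \<in> {0<..<t}")
      case False
      from elim show ?thesis by eventually_elim (use False in \<open>auto simp: F_def U_def S_def b_def\<close>)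
    next
      case True
      then have "AE y in lborel. norm (u s y) \<le> A / (1 + norm y) ^ m"
        using decay[of s] by (simp add: AE_completion_iff)
      with elim show ?thesis
      proof eventually_elim
        case (elim y)
        have "\<bar>W0 (s, y)\<bar> = \<bar>u s y $ j\<bar> * \<bar>u s y $ k\<bar>"
          using elim(1) True by (simp add: F_def U_def S_def abs_mult[symmetric])
        also have "\<dots> \<le> (A / (1 + norm y) ^ m) * (A / (1 + norm y) ^ m)"
          by (intro mult_mono order_trans[OF component_le_norm_cart elim(2)]) (use A in auto)
        also have "\<dots> = b (s, y)" using True by (simp add: b_def power2_eq_square mult_2 power_add)
        finally show ?case .
      qed
    qed
  qed
  \<comment> \<open>The decay is known at each time separately. For a measurable set of space-time,
    null sections at almost all times make the set null.\<close>
  then have "AE p in lborel \<Otimes>\<^sub>M lborel. \<bar>W0 p\<bar> \<le> b p"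
  proof (rule lborel_pair.AE_pair_measure[rotated])
    have "Measurable.pred (borel \<Otimes>\<^sub>M borel) (\<lambda>p. \<bar>W0 p\<bar> \<le> b p)" by measurable
    then show "{p \<in> space (lborel \<Otimes>\<^sub>M lborel). \<bar>W0 p\<bar> \<le> b p} \<in> sets (lborel \<Otimes>\<^sub>M lborel)"
      unfolding pred_def lborel_prod borel_prod by simp
  qed
  then have FW: "AE p in lborel. F p = W p"
    using W0(2) unfolding lborel_prod by eventually_elim (simp add: W_def)
  have Wm: "W \<in> borel_measurable borel"
  proof -
    have "W \<in> borel_measurable (borel \<Otimes>\<^sub>M borel)" unfolding W_def by measurable
    then show ?thesis by (simp add: borel_prod)
  qed
  show ?thesis
  proof (rule that[OF Wm])
    show "\<bar>W (s, y)\<bar> \<le> indicator {0<..<t} s * (A\<^sup>2 / (1 + norm y) ^ (2 * m))" for s y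
      using b0[of "(s, y)"] unfolding W_def by (auto simp: b_def)
    have "AE s in lborel. AE y in lborel. F (s, y) = W (s, y)"
      by (rule lborel_pair.AE_pair) (use FW in \<open>simp only: lborel_prod\<close>)
    then show "AE s in lborel. s \<in> {0<..<t} \<longrightarrow> (AE y in lborel. u s y $ j * u s y $ k = W (s, y))"
    proof eventually_elim
      case (elim s)
      show ?case
      proof
        assume s: "s \<in> {0<..<t}"
        from elim show "AE y in lborel. u s y $ j * u s y $ k = W (s, y)"
          by eventually_elim (use s in \<open>simp add: F_def U_def S_def\<close>)
      qed
    qed
    show "L2_inner t (\<lambda>s x. u s x $ j) (\<lambda>s x. u s x $ k) = (LBINT p. W p)"
      unfolding L2_inner_def set_lebesgue_integral_def
    proof (rule lebesgue_integral_eq_lborel_of_AE[OF Wm])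
      show "AE p in lborel. indicator ({0<..<t} \<times> UNIV) p *\<^sub>R (case p of (s, x) \<Rightarrow> u s x $ j * u s x $ k) = W p"
        using FW by eventually_elim (auto simp: F_def U_def S_def indicator_def split: if_splits)
    qed
  qed
qed

lemma mild_solution_asymptotics:
  fixes u0 :: "real ^ 'n \<Rightarrow> real ^ 'n" and u :: "real \<Rightarrow> real ^ 'n \<Rightarrow> real ^ 'n"
  assumes \<nu>: "0 < \<nu>" and t: "0 < t" and A: "0 \<le> A" and B: "0 \<le> B"
    and meas: "(\<lambda>(s, x). u s x) \<in> borel_measurable (lebesgue_on (I \<times> UNIV))" and I: "{0..t} \<subseteq> I"
    and decay: "\<And>s. s \<in> {0..t} \<Longrightarrow> AE x in lebesgue. norm (u s x) \<le> A / (1 + norm x) ^ (CARD('n) + 1)"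
    and duhamel: "AE x in lebesgue. u t x = heat_flow (\<nu> * t) u0 x
           - (LINT s:{0..t}|lebesgue. heat_leray_div (\<nu> * (t - s)) (\<lambda>y. tensor (u s y) (u s y)) x)"
    and data: "AE x in lebesgue. norm (u0 x) \<le> B / (1 + norm x) ^ (CARD('n) + 2)"
  obtains R where "AE x in lebesgue. 1 \<le> norm x \<longrightarrow>
    norm (u t x + (\<Sum>j\<in>UNIV. \<Sum>k\<in>UNIV. L2_inner t (\<lambda>s x. u s x $ j) (\<lambda>s x. u s x $ k) *\<^sub>R far_kernel j k x))
      \<le> R / norm x ^ (CARD('n) + 2)"
proof -
  let ?m = "CARD('n) + 1"
  let ?Q = "\<lambda>j k. L2_inner t (\<lambda>s x. u s x $ j) (\<lambda>s x. u s x $ k)"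
  obtain E where E: "0 \<le> E"
    "\<And>\<tau> f B (x :: real ^ 'n). 0 < \<tau> \<Longrightarrow> \<tau> \<le> \<nu> * t \<Longrightarrow> 0 \<le> B \<Longrightarrow>
      AE y in lebesgue. norm (f y) \<le> B / (1 + norm y) ^ (CARD('n) + 2) \<Longrightarrow>
      norm (heat_flow \<tau> f x) \<le> B * E / (1 + norm x) ^ (CARD('n) + 2)"
    by (rule heat_flow_decay[where 'n = 'n and T = "\<nu> * t" and m = "CARD('n) + 2"]) (rule that)
  \<comment> \<open>Bundling the four properties lets a representative be chosen for all index pairs
    simultaneously.\<close>
  define P where "P j k W \<longleftrightarrow> W \<in> borel_measurable borel \<and>
    (\<forall>s y. \<bar>W (s, y)\<bar> \<le> indicator {0<..<t} s * (A\<^sup>2 / (1 + norm y) ^ (2 * ?m))) \<and>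
    (AE s in lborel. s \<in> {0<..<t} \<longrightarrow> (AE y in lborel. u s y $ j * u s y $ k = W (s, y))) \<and>
    ?Q j k = (LBINT p. W p)" for j k W
  have "\<exists>W. P j k W" for j k
  proof (rule product_borel_version[OF meas I A decay, of j k])
    fix W :: "real \<times> (real ^ 'n) \<Rightarrow> real"
    assume "W \<in> borel_measurable borel"
      "\<And>s y. \<bar>W (s, y)\<bar> \<le> indicator {0<..<t} s * (A\<^sup>2 / (1 + norm y) ^ (2 * ?m))"
      "AE s in lborel. s \<in> {0<..<t} \<longrightarrow> (AE y in lborel. u s y $ j * u s y $ k = W (s, y))"
      "?Q j k = (LBINT p. W p)"
    then have "P j k W" unfolding P_def by blast
    then show ?thesis by (rule exI[of _ W])
  qed
  then obtain W where "\<And>j k. P j k (W j k)" by metis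
  then have W: "\<And>j k. W j k \<in> borel_measurable borel"
    "\<And>j k s y. \<bar>W j k (s, y)\<bar> \<le> indicator {0<..<t} s * (A\<^sup>2 / (1 + norm y) ^ (2 * ?m))"
    "\<And>j k. AE s in lborel. s \<in> {0<..<t} \<longrightarrow> (AE y in lborel. u s y $ j * u s y $ k = W j k (s, y))"
    "\<And>j k. ?Q j k = (LBINT p. W j k p)"
    unfolding P_def by blast+
  define f where "f j k x s = (LBINT y. W j k (s, y) *\<^sub>R (indicator {0<..} (\<nu> * (t - s)) *\<^sub>R oseen_kernel (\<nu> * (t - s)) j k (x - y)))"
    for j k x s
  define N where "N j k R \<longleftrightarrow> (\<forall>x. 1 \<le> norm x \<longrightarrow> integrable lborel (f j k x) \<and>
      norm ((LBINT s. f j k x s) - ?Q j k *\<^sub>R far_kernel j k x) \<le> R / norm x ^ (CARD('n) + 2))" for j k R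
  have "\<exists>R. N j k R" for j k
  proof (rule oseen_convolution_asymptotics[OF \<nu> t _ W(1) W(2), of j k])
    fix R
    assume "\<And>j' k' x. 1 \<le> norm x \<Longrightarrow> integrable lborel (\<lambda>s. LBINT y. W j k (s, y) *\<^sub>R (indicator {0<..} (\<nu> * (t - s)) *\<^sub>R oseen_kernel (\<nu> * (t - s)) j' k' (x - y)))"
      "\<And>j' k' x. 1 \<le> norm x \<Longrightarrow>
      norm ((LBINT s. (LBINT y. W j k (s, y) *\<^sub>R (indicator {0<..} (\<nu> * (t - s)) *\<^sub>R oseen_kernel (\<nu> * (t - s)) j' k' (x - y))))
        - (LBINT p. W j k p) *\<^sub>R far_kernel j' k' x) \<le> R / norm x ^ (CARD('n) + 2)"
    then have "N j k R" unfolding N_def f_def W(4) by blast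
    then show ?thesis by (rule exI[of _ R])
  qed simp
  then obtain R where "\<And>j k. N j k (R j k)" by metis
  then have R: "\<And>j k x. 1 \<le> norm x \<Longrightarrow> integrable lborel (f j k x)"
    "\<And>j k x. 1 \<le> norm x \<Longrightarrow> norm ((LBINT s. f j k x s) - ?Q j k *\<^sub>R far_kernel j k x) \<le> R j k / norm x ^ (CARD('n) + 2)"
    unfolding N_def by blast+
  have ae: "AE s in lborel. \<forall>j k. s \<in> {0<..<t} \<longrightarrow> (AE y in lborel. u s y $ j * u s y $ k = W j k (s, y))"
    unfolding AE_all_countable using W(3) by blast
  have int: "(LINT s:{0..t}|lebesgue. heat_leray_div (\<nu> * (t - s)) (\<lambda>y. tensor (u s y) (u s y)) x)
      = (\<Sum>j\<in>UNIV. \<Sum>k\<in>UNIV. LBINT s. f j k x s)" if x: "1 \<le> norm x" for x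
  proof -
    have "(LINT s:{0..t}|lebesgue. heat_leray_div (\<nu> * (t - s)) (\<lambda>y. tensor (u s y) (u s y)) x)
        = (LBINT s. (\<Sum>j\<in>UNIV. \<Sum>k\<in>UNIV. f j k x s))"
      unfolding set_lebesgue_integral_def
    proof (rule lebesgue_integral_eq_lborel_of_AE)
      show "(\<lambda>s. \<Sum>j\<in>UNIV. \<Sum>k\<in>UNIV. f j k x s) \<in> borel_measurable borel"
        using borel_measurable_integrable[OF R(1)[OF x]] by (intro borel_measurable_sum) simp
      show "AE s in lborel. indicator {0..t} s *\<^sub>R heat_leray_div (\<nu> * (t - s)) (\<lambda>y. tensor (u s y) (u s y)) x
          = (\<Sum>j\<in>UNIV. \<Sum>k\<in>UNIV. f j k x s)"
        using ae AE_lborel_singleton[of 0] AE_lborel_singleton[of t]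
      proof eventually_elim
        case (elim s)
        show ?case
        proof (cases "s \<in> {0<..<t}")
          case False
          then have "W j k (s, y) = 0" for j k y using W(2)[of j k s y] by simp
          then have "f j k x s = 0" for j k by (simp add: f_def)
          moreover have "s \<notin> {0..t}" using False elim(2,3) by auto
          ultimately show ?thesis by simp
        next
          case True
          then have \<tau>: "0 < \<nu> * (t - s)" using \<nu> by simp
          have "(\<integral>y. (tensor (u s y) (u s y) $ j $ k) *\<^sub>R oseen_kernel (\<nu> * (t - s)) j k (x - y) \<partial>lebesgue) = f j k x s" for j k
            unfolding f_def
          proof (rule lebesgue_integral_eq_lborel_of_AE)
            have [measurable]: "W j k \<in> borel_measurable (borel \<Otimes>\<^sub>M borel)" using W(1) by (simp add: borel_prod)
            show "(\<lambda>y. W j k (s, y) *\<^sub>R (indicator {0<..} (\<nu> * (t - s)) *\<^sub>R oseen_kernel (\<nu> * (t - s)) j k (x - y))) \<in> borel_measurable borel"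
              by measurable
            show "AE y in lborel. (tensor (u s y) (u s y) $ j $ k) *\<^sub>R oseen_kernel (\<nu> * (t - s)) j k (x - y)
                = W j k (s, y) *\<^sub>R (indicator {0<..} (\<nu> * (t - s)) *\<^sub>R oseen_kernel (\<nu> * (t - s)) j k (x - y))"
              using elim(1)[rule_format, OF True, of j k] by eventually_elim (use \<tau> in \<open>simp add: tensor_def\<close>)
          qed
          then show ?thesis using True unfolding heat_leray_div_def oseen_kernel_def[symmetric] by simp
        qed
      qed
    qed
    also have "\<dots> = (\<Sum>j\<in>UNIV. \<Sum>k\<in>UNIV. LBINT s. f j k x s)"
      using R(1)[OF x] by (simp add: Bochner_Integration.integral_sum Bochner_Integration.integrable_sum)
    finally show ?thesis .
  qed
  show ?thesis
  proof (rule that[of "B * E + (\<Sum>j\<in>UNIV. \<Sum>k\<in>UNIV. R j k)"])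
    show "AE x in lebesgue. 1 \<le> norm x \<longrightarrow> norm (u t x + (\<Sum>j\<in>UNIV. \<Sum>k\<in>UNIV. ?Q j k *\<^sub>R far_kernel j k x))
      \<le> (B * E + (\<Sum>j\<in>UNIV. \<Sum>k\<in>UNIV. R j k)) / norm x ^ (CARD('n) + 2)"
      using duhamel
    proof eventually_elim
      case (elim x)
      show ?case
      proof
        assume x: "1 \<le> norm x"
        then have nx: "0 < norm x" by linarith
        have HF: "norm (heat_flow (\<nu> * t) u0 x) \<le> B * E / norm x ^ (CARD('n) + 2)"
        proof (rule order_trans[OF E(2)[OF _ _ B data]])
          show "B * E / (1 + norm x) ^ (CARD('n) + 2) \<le> B * E / norm x ^ (CARD('n) + 2)"
            using nx B E(1) by (intro divide_left_mono power_mono mult_pos_pos zero_less_power) (auto intro: add_pos_pos)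
        qed (use \<nu> t in auto)
        \<comment> \<open>The Duhamel term carries a minus sign, so adding the far field to
          \<open>u\<close> leaves the heat flow minus the errors of the convolutions.\<close>
        have eq: "u t x + (\<Sum>j\<in>UNIV. \<Sum>k\<in>UNIV. ?Q j k *\<^sub>R far_kernel j k x)
          = heat_flow (\<nu> * t) u0 x - (\<Sum>j\<in>UNIV. \<Sum>k\<in>UNIV. (LBINT s. f j k x s) - ?Q j k *\<^sub>R far_kernel j k x)"
          unfolding elim int[OF x] by (simp add: sum_subtractf)
        have "norm (\<Sum>j\<in>UNIV. \<Sum>k\<in>UNIV. (LBINT s. f j k x s) - ?Q j k *\<^sub>R far_kernel j k x)
            \<le> (\<Sum>j\<in>UNIV. \<Sum>k\<in>UNIV. R j k / norm x ^ (CARD('n) + 2))"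
          by (intro sum_norm_le R x)
        with HF show "norm (u t x + (\<Sum>j\<in>UNIV. \<Sum>k\<in>UNIV. ?Q j k *\<^sub>R far_kernel j k x))
          \<le> (B * E + (\<Sum>j\<in>UNIV. \<Sum>k\<in>UNIV. R j k)) / norm x ^ (CARD('n) + 2)"
          unfolding eq add_divide_distrib sum_divide_distrib
          by (intro order_trans[OF norm_triangle_ineq4] add_mono)
      qed
    qed
  qed
qed

section \<open>Behaviour at infinity up to null sets\<close>

lemma eventually_inf_at_infinity_ae:
  "eventually P (inf at_infinity (ae_filter M)) \<longleftrightarrow> (\<exists>r. AE x in M. r \<le> norm x \<longrightarrow> P x)"
proof
  assume "eventually P (inf at_infinity (ae_filter M))"
  then obtain Q R where QR: "eventually Q at_infinity" "AE x in M. R x" "\<And>x. Q x \<Longrightarrow> R x \<Longrightarrow> P x"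
    unfolding eventually_inf by blast
  then obtain r where r: "\<And>x. r \<le> norm x \<Longrightarrow> Q x" unfolding eventually_at_infinity by blast
  have "AE x in M. r \<le> norm x \<longrightarrow> P x" using QR(2) by eventually_elim (use r QR(3) in blast)
  then show "\<exists>r. AE x in M. r \<le> norm x \<longrightarrow> P x" ..
next
  assume "\<exists>r. AE x in M. r \<le> norm x \<longrightarrow> P x"
  then obtain r where "AE x in M. r \<le> norm x \<longrightarrow> P x" ..
  then show "eventually P (inf at_infinity (ae_filter M))"
    unfolding eventually_inf eventually_at_infinity
    by (intro exI[of _ "\<lambda>x. r \<le> norm x"] exI[of _ "\<lambda>x. r \<le> norm x \<longrightarrow> P x"]) auto
qed

text \<open>Nonempty open sets have positive measure; this turns almost-everywhere bounds into
  bounds at a point near a prescribed one.\<close>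

lemma AE_lebesgue_open_ex:
  fixes S :: "'a::euclidean_space set"
  assumes "AE x in lebesgue. P x" "open S" "S \<noteq> {}"
  obtains x where "x \<in> S" "P x"
proof -
  have "\<exists>x\<in>S. P x"
  proof (rule ccontr)
    assume "\<not> (\<exists>x\<in>S. P x)"
    then have "AE x in lebesgue. x \<notin> S" using assms(1) by (auto elim!: eventually_mono)
    then have "S \<in> null_sets lebesgue"
      using assms(2) by (subst AE_iff_null_sets) auto
    then show False using open_not_negligible[OF assms(2,3)] by (simp add: negligible_iff_null_sets)
  qed
  then show thesis using that by blast
qed

section \<open>The limit field and its zeros\<close>

definition far_field :: "('n \<Rightarrow> 'n \<Rightarrow> real) \<Rightarrow> real ^ 'n \<Rightarrow> real ^ 'n" where
  "far_field Q x = (\<Sum>j\<in>UNIV. \<Sum>k\<in>UNIV. Q j k *\<^sub>R far_kernel j k x)"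

lemma far_field_component:
  fixes Q :: "'n::finite \<Rightarrow> 'n \<Rightarrow> real"
  shows "far_field Q x $ i = heat_moment 2 0 x / 4 *
    ((\<Sum>k\<in>UNIV. Q i k * x $ k) + (\<Sum>j\<in>UNIV. Q j i * x $ j) + (\<Sum>j\<in>UNIV. Q j j) * x $ i
      - (real CARD('n) + 2) * x $ i / (norm x)\<^sup>2 * (\<Sum>j\<in>UNIV. \<Sum>k\<in>UNIV. Q j k * x $ j * x $ k))"
proof -
  let ?h = "heat_moment 2 0 x / 4"
  let ?c = "(real CARD('n) + 2) * x $ i / (norm x)\<^sup>2"
  have "far_field Q x $ i = (\<Sum>j\<in>UNIV. \<Sum>k\<in>UNIV. ?h *
     ((if i = j then 1 else 0) * (Q j k * x $ k) + (if i = k then 1 else 0) * (Q j k * x $ j)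
      + (if j = k then 1 else 0) * (Q j k * x $ i) - ?c * (Q j k * x $ j * x $ k)))"
    unfolding far_field_def far_kernel_def sum_component vector_scaleR_component vec_lambda_beta
    by (intro sum.cong refl) (simp add: algebra_simps)
  also have "\<dots> = ?h *
    ((\<Sum>j\<in>UNIV. \<Sum>k\<in>UNIV. (if i = j then 1 else 0) * (Q j k * x $ k))
     + (\<Sum>j\<in>UNIV. \<Sum>k\<in>UNIV. (if i = k then 1 else 0) * (Q j k * x $ j))
     + (\<Sum>j\<in>UNIV. \<Sum>k\<in>UNIV. (if j = k then 1 else 0) * (Q j k * x $ i))
     - ?c * (\<Sum>j\<in>UNIV. \<Sum>k\<in>UNIV. Q j k * x $ j * x $ k))"
    by (simp only: sum_distrib_left[symmetric] sum.distrib sum_subtractf)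
  also have "(\<Sum>j\<in>UNIV. \<Sum>k\<in>UNIV. (if i = j then 1 else 0) * (Q j k * x $ k)) = (\<Sum>k\<in>UNIV. Q i k * x $ k)"
    by (subst sum.swap) (simp add: if_distrib[of "\<lambda>c. c * _"] sum.delta cong: if_cong)
  also have "(\<Sum>j\<in>UNIV. \<Sum>k\<in>UNIV. (if i = k then 1 else 0) * (Q j k * x $ j)) = (\<Sum>j\<in>UNIV. Q j i * x $ j)"
    by (simp add: if_distrib[of "\<lambda>c. c * _"] sum.delta cong: if_cong)
  also have "(\<Sum>j\<in>UNIV. \<Sum>k\<in>UNIV. (if j = k then 1 else 0) * (Q j k * x $ i)) = (\<Sum>j\<in>UNIV. Q j j) * x $ i"
    by (simp add: if_distrib[of "\<lambda>c. c * _"] sum.delta sum_distrib_right cong: if_cong)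
  finally show ?thesis .
qed

text \<open>For a multiple q of the identity the bracket is (1 + 1 + d - (d + 2)) q x_i = 0.\<close>

lemma far_field_isotropic:
  fixes x :: "real ^ 'n"
  assumes x: "x \<noteq> 0" and Q: "\<And>i j. Q i j = q * (if i = j then 1 else 0)"
  shows "far_field Q x = 0"
proof -
  have n: "(\<Sum>j\<in>UNIV. x $ j * x $ j) = (norm x)\<^sup>2"
    unfolding power2_norm_eq_inner inner_vec_def by simp
  have s1: "(\<Sum>k\<in>UNIV. Q i k * x $ k) = q * x $ i" "(\<Sum>j\<in>UNIV. Q j i * x $ j) = q * x $ i" for i
    by (simp_all add: Q if_distrib[of "\<lambda>c. c * _"] if_distrib[of "\<lambda>c. _ * c"] sum.delta cong: if_cong)
  have s2: "(\<Sum>j\<in>UNIV. Q j j) = real CARD('n) * q" by (simp add: Q)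
  have s3: "(\<Sum>j\<in>UNIV. \<Sum>k\<in>UNIV. Q j k * x $ j * x $ k) = q * (norm x)\<^sup>2"
    by (simp add: Q n[symmetric] if_distrib[of "\<lambda>c. c * _"] if_distrib[of "\<lambda>c. _ * c"] sum.delta sum_distrib_left
        mult.assoc cong: if_cong)
  have "far_field Q x $ i = 0" for i
    unfolding far_field_component s1 s2 s3 using x by (simp add: field_simps)
  then show ?thesis by (simp add: vec_eq_iff)
qed

text \<open>At the m-th axis the quadratic form reduces to \<open>Q m m\<close>. Components i other
  than m then give 2 \<open>Q i m\<close> = 0, and the m-th one says that d times
  \<open>Q m m\<close> equals the trace.\<close>

lemma far_field_zero_imp_isotropic:
  fixes Q :: "'n::finite \<Rightarrow> 'n \<Rightarrow> real"
  assumes sym: "\<And>i j. Q i j = Q j i" and zero: "\<And>m. far_field Q (axis m 1) = 0"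
  shows "Q i j = (\<Sum>k\<in>UNIV. Q k k) / real CARD('n) * (if i = j then 1 else 0)"
proof -
  obtain c where c: "0 < c" "\<And>z :: real ^ 'n. z \<noteq> 0 \<Longrightarrow> heat_moment 2 0 z = c / norm z ^ (CARD('n) + 2)"
    using heat_moment_2_0_homogeneous by blast
  have h: "heat_moment 2 0 (axis m 1 :: real ^ 'n) \<noteq> 0" for m
    using c(2)[of "axis m 1"] c(1) by (simp add: axis_eq_0_iff)
  have ax: "(axis m 1 :: real ^ 'n) $ k = (if k = m then 1 else 0)" for m k by (simp add: axis_def)
  have key: "2 * Q i m + (\<Sum>j\<in>UNIV. Q j j) * (if i = m then 1 else 0)
      - (real CARD('n) + 2) * (if i = m then 1 else 0) * Q m m = 0" for i m
  proof -
    have s: "(\<Sum>k\<in>UNIV. Q i k * (axis m 1 :: real ^ 'n) $ k) = Q i m" "(\<Sum>j\<in>UNIV. Q j i * (axis m 1 :: real ^ 'n) $ j) = Q i m"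
      "(\<Sum>j\<in>UNIV. \<Sum>k\<in>UNIV. Q j k * (axis m 1 :: real ^ 'n) $ j * (axis m 1 :: real ^ 'n) $ k) = Q m m"
      by (simp_all add: ax if_distrib[of "\<lambda>c. _ * c"] sum.delta sym[of m i] cong: if_cong)
    have "far_field Q (axis m 1) $ i = 0" by (simp add: zero)
    then show ?thesis
      unfolding far_field_component s using h[of m] by (simp add: ax split: if_splits)
  qed
  show ?thesis
  proof (cases "i = j")
    case True
    have "real CARD('n) * Q j j = (\<Sum>k\<in>UNIV. Q k k)" using key[of j j] by (simp add: algebra_simps)
    then show ?thesis using True by (simp add: field_simps)
  next
    case False
    then show ?thesis using key[of i j] by simp
  qed
qed

lemma far_field_scale:
  fixes x :: "real ^ 'n"
  assumes r: "0 < r" and x: "x \<noteq> 0"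
  shows "far_field Q (r *\<^sub>R x) = (1 / r ^ (CARD('n) + 1)) *\<^sub>R far_field Q x"
proof -
  obtain c where c: "\<And>z :: real ^ 'n. z \<noteq> 0 \<Longrightarrow> heat_moment 2 0 z = c / norm z ^ (CARD('n) + 2)"
    using heat_moment_2_0_homogeneous by blast
  have "heat_moment 2 0 (r *\<^sub>R x) = heat_moment 2 0 x / r ^ (CARD('n) + 2)"
    using c[of x] c[of "r *\<^sub>R x"] r x by (simp add: power_mult_distrib)
  then have h: "heat_moment 2 0 (r *\<^sub>R x) = heat_moment 2 0 x / (r ^ (CARD('n) + 1) * r)"
    by simp
  have alg: "H / (p * r) / 4 * (a * (r * z1) + b * (r * z2) + d * (r * z3) - D * (r * u * (r * v) * (r * w) / (r * n)\<^sup>2))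
      = 1 / p * (H / 4 * (a * z1 + b * z2 + d * z3 - D * (u * v * w / n\<^sup>2)))"
    for H p a b d D z1 z2 z3 u v w n :: real
  proof -
    have q: "r * u * (r * v) * (r * w) / (r * n)\<^sup>2 = r * (u * v * w / n\<^sup>2)"
      using r by (simp add: power2_eq_square)
    have f: "a * (r * z1) + b * (r * z2) + d * (r * z3) - D * (r * t) = r * (a * z1 + b * z2 + d * z3 - D * t)" for t
      by (simp add: algebra_simps)
    have "H / (p * r) / 4 * (r * s) = 1 / p * (H / 4 * s)" for s using r by simp
    then show ?thesis by (simp only: q f)
  qed
  have "norm (r *\<^sub>R x) = r * norm x" using r by simp
  then have "far_kernel j k (r *\<^sub>R x) $ i = 1 / r ^ (CARD('n) + 1) * far_kernel j k x $ i" for i j k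
    unfolding far_kernel_def vec_lambda_beta h vector_scaleR_component real_scaleR_def by (simp only: alg)
  then have "far_kernel j k (r *\<^sub>R x) = (1 / r ^ (CARD('n) + 1)) *\<^sub>R far_kernel j k x" for j k
    by (simp add: vec_eq_iff)
  then show ?thesis
    unfolding far_field_def by (simp add: scaleR_sum_right mult.commute)
qed

lemma far_field_lipschitz:
  fixes Q :: "'n::finite \<Rightarrow> 'n \<Rightarrow> real"
  obtains C where "0 \<le> C" "\<And>(x :: real ^ 'n) y. x \<noteq> 0 \<Longrightarrow> norm y \<le> norm x / 2 \<Longrightarrow>
      norm (far_field Q (x - y) - far_field Q x) \<le> C * norm y / norm x ^ (CARD('n) + 2)"
proof -
  obtain C where C: "0 \<le> C"
    "\<And>j k (x :: real ^ 'n). x \<noteq> 0 \<Longrightarrow> norm (far_kernel j k x) \<le> C / norm x ^ (CARD('n) + 1)"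
    "\<And>j k (x :: real ^ 'n) y. x \<noteq> 0 \<Longrightarrow> norm y \<le> norm x / 2 \<Longrightarrow>
      norm (far_kernel j k (x - y) - far_kernel j k x) \<le> C * norm y / norm x ^ (CARD('n) + 2)"
    by (rule far_kernel_bounds[where 'n = 'n]) (rule that)
  let ?S = "\<Sum>j\<in>UNIV. \<Sum>k\<in>UNIV. \<bar>Q j k\<bar>"
  show ?thesis
  proof (rule that[of "?S * C"])
    show "0 \<le> ?S * C" using C(1) by (intro mult_nonneg_nonneg sum_nonneg) auto
    fix x y :: "real ^ 'n" assume xy: "x \<noteq> 0" "norm y \<le> norm x / 2"
    have eq: "far_field Q (x - y) - far_field Q x = (\<Sum>j\<in>UNIV. \<Sum>k\<in>UNIV. Q j k *\<^sub>R (far_kernel j k (x - y) - far_kernel j k x))"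
      unfolding far_field_def by (simp add: sum_subtractf scaleR_diff_right)
    have "norm (far_field Q (x - y) - far_field Q x) \<le> (\<Sum>j\<in>UNIV. \<Sum>k\<in>UNIV. \<bar>Q j k\<bar> * (C * norm y / norm x ^ (CARD('n) + 2)))"
      unfolding eq by (intro sum_norm_le) (simp only: norm_scaleR mult_left_mono[OF C(3)[OF xy] abs_ge_zero])
    then show "norm (far_field Q (x - y) - far_field Q x) \<le> ?S * C * norm y / norm x ^ (CARD('n) + 2)"
      unfolding sum_distrib_right[symmetric] by (simp only: times_divide_eq_right mult.assoc)
  qed
qed

text \<open>Since \<open>v\<close> satisfies its bounds only almost everywhere, it cannot be
  evaluated at r e. On a ball about r e with radius proportional to r, the homogeneous field stays
  within half of its size at the centre, and some point of the ball satisfies both bounds.\<close>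

lemma far_field_zero_of_small:
  fixes v :: "real ^ 'n \<Rightarrow> real ^ 'n"
  assumes asy: "AE x in lebesgue. 1 \<le> norm x \<longrightarrow> norm (v x + far_field Q x) \<le> R / norm x ^ (CARD('n) + 2)"
    and small: "\<And>\<epsilon>. 0 < \<epsilon> \<Longrightarrow> \<exists>r. AE x in lebesgue. r \<le> norm x \<longrightarrow> norm (v x) \<le> \<epsilon> / norm x ^ (CARD('n) + 1)"
    and e: "norm e = 1"
  shows "far_field Q e = 0"
proof (rule ccontr)
  assume "far_field Q e \<noteq> 0"
  define \<delta> where "\<delta> = norm (far_field Q e)"
  have \<delta>: "0 < \<delta>" using \<open>far_field Q e \<noteq> 0\<close> by (simp add: \<delta>_def)
  let ?d = "CARD('n)"
  obtain C where C: "0 \<le> C" "\<And>(x :: real ^ 'n) y. x \<noteq> 0 \<Longrightarrow> norm y \<le> norm x / 2 \<Longrightarrow>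
      norm (far_field Q (x - y) - far_field Q x) \<le> C * norm y / norm x ^ (?d + 2)"
    by (rule far_field_lipschitz[where 'n = 'n and Q = Q]) (rule that)
  \<comment> \<open>The first entry keeps the shift within half of the norm, as the Lipschitz bound
    demands; the second makes the variation over the ball at most half of the main term.\<close>
  define \<eta> where "\<eta> = min (1 / 2) (\<delta> / (2 * (C + 1)))"
  have \<eta>: "0 < \<eta>" "\<eta> \<le> 1 / 2" "C * \<eta> \<le> \<delta> / 2"
  proof -
    have "C * \<eta> \<le> C * (\<delta> / (2 * (C + 1)))" unfolding \<eta>_def using C(1) by (intro mult_left_mono) auto
    also have "\<dots> = \<delta> / 2 * (C / (C + 1))" by simp
    also have "\<dots> \<le> \<delta> / 2 * 1" using C(1) \<delta> by (intro mult_left_mono) (auto simp: divide_le_eq)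
    finally show "C * \<eta> \<le> \<delta> / 2" by simp
    show "\<eta> \<le> 1 / 2" unfolding \<eta>_def by (rule min.cobounded1)
    show "0 < \<eta>" using \<delta> C(1) by (simp add: \<eta>_def)
  qed
  \<comment> \<open>On the ball the norm is at least r / 2, hence the power of 2. The smallness of
    \<open>v\<close> and the asymptotic error each take one eighth of the main term, and 1/2 + 1/8 +
    1/8 < 1 gives the contradiction.\<close>
  define \<epsilon> where "\<epsilon> = \<delta> / (8 * 2 ^ (?d + 1))"
  have \<epsilon>: "0 < \<epsilon>" using \<delta> by (simp add: \<epsilon>_def)
  obtain r0 where r0: "AE x in lebesgue. r0 \<le> norm x \<longrightarrow> norm (v x) \<le> \<epsilon> / norm x ^ (?d + 1)"
    using small[OF \<epsilon>] by blast
  \<comment> \<open>The entries ensure in turn |p| >= 1, |p| >= r0 and an asymptotic error of at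
    most one eighth of the main term.\<close>
  define r where "r = max (max 2 (2 * \<bar>r0\<bar>)) (8 * 2 ^ (?d + 2) * \<bar>R\<bar> / \<delta>)"
  have r: "2 \<le> r" "2 * \<bar>r0\<bar> \<le> r" "8 * 2 ^ (?d + 2) * \<bar>R\<bar> / \<delta> \<le> r" by (auto simp: r_def)
  have e0: "e \<noteq> 0" using e by auto
  have nre: "norm (r *\<^sub>R e) = r" using e r by simp
  have ae: "AE x in lebesgue. (1 \<le> norm x \<longrightarrow> norm (v x + far_field Q x) \<le> R / norm x ^ (?d + 2))
      \<and> (r0 \<le> norm x \<longrightarrow> norm (v x) \<le> \<epsilon> / norm x ^ (?d + 1))"
    using asy r0 by eventually_elim blast
  have ne: "ball (r *\<^sub>R e) (\<eta> * r) \<noteq> {}" using mult_pos_pos[OF \<eta>(1), of r] r(1) by auto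
  obtain p where p0: "p \<in> ball (r *\<^sub>R e) (\<eta> * r)"
    "(1 \<le> norm p \<longrightarrow> norm (v p + far_field Q p) \<le> R / norm p ^ (?d + 2))
      \<and> (r0 \<le> norm p \<longrightarrow> norm (v p) \<le> \<epsilon> / norm p ^ (?d + 1))"
    by (rule AE_lebesgue_open_ex[OF ae open_ball ne]) (rule that)
  then have p: "p \<in> ball (r *\<^sub>R e) (\<eta> * r)"
    "1 \<le> norm p \<longrightarrow> norm (v p + far_field Q p) \<le> R / norm p ^ (?d + 2)"
    "r0 \<le> norm p \<longrightarrow> norm (v p) \<le> \<epsilon> / norm p ^ (?d + 1)"
    by blast+
  define y where "y = r *\<^sub>R e - p"
  have py: "p = r *\<^sub>R e - y" by (simp add: y_def)
  have y: "norm y \<le> \<eta> * r" using p(1) by (simp add: y_def dist_norm)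
  have y2: "norm y \<le> r / 2" using y \<eta>(2) r mult_right_mono[of \<eta> "1/2" r] by linarith
  have np: "r / 2 \<le> norm p"
    using norm_triangle_ineq2[of "r *\<^sub>R e" y] y2 unfolding py nre by linarith
  have p1: "1 \<le> norm p" "r0 \<le> norm p" using np r by linarith+
  have r2: "0 < r / 2" using r by simp
  have rp: "0 < r" using r by simp
  define X where "X = 1 / r ^ (?d + 1)"
  have X: "0 < X" using rp by (simp add: X_def)
  have a: "norm (far_field Q (r *\<^sub>R e)) = X * \<delta>"
    unfolding far_field_scale[OF rp e0] \<delta>_def using rp by (simp add: X_def)
  have b: "norm (far_field Q p - far_field Q (r *\<^sub>R e)) \<le> X * (\<delta> / 2)"
  proof -
    have "norm (far_field Q p - far_field Q (r *\<^sub>R e)) \<le> C * norm y / norm (r *\<^sub>R e) ^ (?d + 2)"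
      unfolding py by (rule C(2)) (use rp e0 y2 nre in auto)
    also have "\<dots> \<le> C * (\<eta> * r) / r ^ (?d + 2)"
      unfolding nre using y C(1) rp by (intro divide_right_mono mult_left_mono) auto
    also have "\<dots> = X * (C * \<eta>)" using rp by (simp add: X_def)
    also have "\<dots> \<le> X * (\<delta> / 2)" using X \<eta>(3) by (intro mult_left_mono) auto
    finally show ?thesis .
  qed
  have c: "norm (v p + far_field Q p) \<le> X * (\<delta> / 8)"
  proof -
    have "norm (v p + far_field Q p) \<le> R / norm p ^ (?d + 2)" using p(2) p1 by simp
    also have "\<dots> \<le> \<bar>R\<bar> / (r / 2) ^ (?d + 2)"
      using r2 np p1 by (intro frac_le power_mono zero_less_power) auto
    also have "\<dots> = X * (2 ^ (?d + 2) * \<bar>R\<bar> / r)"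
      using rp by (simp add: X_def power_divide mult_ac)
    also have "\<dots> \<le> X * (\<delta> / 8)"
    proof (rule mult_left_mono)
      have "8 * 2 ^ (?d + 2) * \<bar>R\<bar> \<le> r * \<delta>" using r(3) \<delta> by (simp only: pos_divide_le_eq)
      then show "2 ^ (?d + 2) * \<bar>R\<bar> / r \<le> \<delta> / 8" using rp
        by (simp only: pos_divide_le_eq) (simp add: mult.commute)
    qed (use X in simp)
    finally show ?thesis .
  qed
  have d: "norm (v p) \<le> X * (\<delta> / 8)"
  proof -
    have "norm (v p) \<le> \<epsilon> / norm p ^ (?d + 1)" using p(3) p1 by simp
    also have "\<dots> \<le> \<epsilon> / (r / 2) ^ (?d + 1)"
      using r2 np \<epsilon> by (intro frac_le power_mono zero_less_power) auto
    also have "\<dots> = X * (\<delta> / 8)"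
      unfolding X_def \<epsilon>_def power_divide by simp
    finally show ?thesis .
  qed
  have t: "norm (far_field Q (r *\<^sub>R e)) \<le> norm (far_field Q p - far_field Q (r *\<^sub>R e)) + norm (v p + far_field Q p) + norm (v p)"
    using norm_triangle_ineq4[of "v p + far_field Q p" "v p"]
      norm_triangle_ineq4[of "far_field Q p" "far_field Q p - far_field Q (r *\<^sub>R e)"] by simp
  have "X * \<delta> \<le> X * (\<delta> / 2) + X * (\<delta> / 8) + X * (\<delta> / 8)"
    using t unfolding a using b c d by linarith
  also have "\<dots> = X * \<delta> * (3 / 4)" by simp
  finally have "X * \<delta> \<le> X * \<delta> * (3 / 4)" .
  moreover have "0 < X * \<delta>" using X \<delta> by simp
  ultimately show False by linarith
qed

section \<open>The equivalence\<close>

theorem corollary1p3: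
  fixes \<nu> C \<sigma> t :: real
    and u0 :: "real ^ 'n \<Rightarrow> real ^ 'n"
    and u :: "real \<Rightarrow> real ^ 'n \<Rightarrow> real ^ 'n"
  assumes "CARD('n) \<ge> 2"
    and "\<nu> > 0"
    and "u0 \<in> Linf"
    and "lifespan \<nu> u0 > 0"
    and "mild_solution \<nu> u0 {s. 0 \<le> s \<and> ereal s < lifespan \<nu> u0} u"
    and "C > 0" and "\<sigma> > 0"
    and "AE x in lebesgue. norm (u0 x) \<le> C * heat_kernel (\<nu> * \<sigma>) x"
    and "0 < t" and "ereal t < lifespan \<nu> u0"
  shows "(\<lambda>x. norm (u t x)) \<in>
           o[inf at_infinity (ae_filter lebesgue)](\<lambda>x. 1 / norm x ^ (CARD('n) + 1))
     \<longleftrightarrow> (\<forall>i j. L2_inner t (\<lambda>s x. u s x $ i) (\<lambda>s x. u s x $ j) =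
                (L2_norm t u)\<^sup>2 / real CARD('n) * (if i = j then 1 else 0))"
proof -
  let ?d = "CARD('n)"
  define I where "I = {s. 0 \<le> s \<and> ereal s < lifespan \<nu> u0}"
  define Q where "Q j k = L2_inner t (\<lambda>s x. u s x $ j) (\<lambda>s x. u s x $ k)" for j k
  have I: "{0..t} \<subseteq> I"
  proof
    fix s assume "s \<in> {0..t}"
    then have "0 \<le> s" "ereal s \<le> ereal t" by auto
    then show "s \<in> I" unfolding I_def using assms(10) order_le_less_trans by blast
  qed
  have mild: "(\<lambda>(s, x). u s x) \<in> borel_measurable (lebesgue_on (I \<times> UNIV))" "continuous_Linf I u"
    "AE x in lebesgue. u 0 x = u0 x"
    "\<And>s. s \<in> I \<Longrightarrow> 0 < s \<Longrightarrow> AE x in lebesgue. u s x = heat_flow (\<nu> * s) u0 x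
           - (LINT r:{0..s}|lebesgue. heat_leray_div (\<nu> * (s - r)) (\<lambda>y. tensor (u r y) (u r y)) x)"
    using assms(5) unfolding mild_solution_def I_def[symmetric] by blast+
  have duhamel: "AE x in lebesgue. u s x = heat_flow (\<nu> * s) u0 x
           - (LINT r:{0..s}|lebesgue. heat_leray_div (\<nu> * (s - r)) (\<lambda>y. tensor (u r y) (u r y)) x)"
    if "0 < s" "s \<le> t" for s
    by (rule mild(4)) (use that I in auto)
  obtain B where B: "0 \<le> B" "\<And>x :: real ^ 'n. heat_kernel (\<nu> * \<sigma>) x \<le> B / (1 + norm x) ^ (?d + 2)"
    by (rule heat_kernel_le_inverse_power[where 'n = 'n and \<tau> = "\<nu> * \<sigma>" and m = "?d + 2"])
      (use assms in simp, rule that)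
  have CB: "0 \<le> C * B" using B assms by simp
  \<comment> \<open>The Gaussian bound yields any power. The power d + 2 keeps the heat flow within
    the error of the expansion, and d + 1 is the weight of the decay estimate.\<close>
  have data2: "AE x in lebesgue. norm (u0 x) \<le> C * B / (1 + norm x) ^ (?d + 2)"
    using assms(8)
  proof eventually_elim
    case (elim x)
    have "C * heat_kernel (\<nu> * \<sigma>) x \<le> C * (B / (1 + norm x) ^ (?d + 2))"
      using assms(6) by (intro mult_left_mono B) auto
    with elim show ?case by simp
  qed
  have data1: "AE x in lebesgue. norm (u0 x) \<le> C * B / (1 + norm x) ^ (?d + 1)"
    using data2
  proof eventually_elim
    case (elim x)
    have "C * B / (1 + norm x) ^ (?d + 2) \<le> C * B / (1 + norm x) ^ (?d + 1)"
      using CB by (intro divide_left_mono power_increasing mult_pos_pos zero_less_power) (auto simp: add_pos_nonneg)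
    with elim show ?case by linarith
  qed
  obtain M where M: "0 \<le> M" "\<And>s. s \<in> {0..t} \<Longrightarrow> AE x in lebesgue. norm (u s x) \<le> M"
    by (rule continuous_Linf_bounded[OF mild(2) I]) (rule that)
  obtain A where A: "0 \<le> A" "\<And>s. s \<in> {0..t} \<Longrightarrow> AE x in lebesgue. norm (u s x) \<le> A / (1 + norm x) ^ (?d + 1)"
    by (rule mild_solution_decay[OF assms(2) assms(9) M(1) CB M(2) mild(3) duhamel data1]) (assumption | rule that)+
  obtain R where R: "AE x in lebesgue. 1 \<le> norm x \<longrightarrow> norm (u t x + far_field Q x) \<le> R / norm x ^ (?d + 2)"
    unfolding far_field_def Q_def
    by (rule mild_solution_asymptotics[OF assms(2) assms(9) A(1) CB mild(1) I A(2) duhamel[OF assms(9) order_refl] data2])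
      (assumption | rule that)+
  have Qsym: "Q i j = Q j i" for i j unfolding Q_def L2_inner_def by (simp add: mult.commute)
  \<comment> \<open>Nonnegativity of the trace allows the square root in \<open>L2_norm\<close> to
    be squared back.\<close>
  have "0 \<le> Q i i" for i
    unfolding Q_def L2_inner_def set_lebesgue_integral_def
    by (intro integral_nonneg_AE AE_I2) (simp add: split_beta)
  then have norm_sq: "(L2_norm t u)\<^sup>2 = (\<Sum>k\<in>UNIV. Q k k)"
    unfolding L2_norm_def Q_def by (intro real_sqrt_pow2 sum_nonneg) auto
  have little_o: "(\<lambda>x. norm (u t x)) \<in> o[inf at_infinity (ae_filter lebesgue)](\<lambda>x. 1 / norm x ^ (?d + 1))
     \<longleftrightarrow> (\<forall>\<epsilon>>0. \<exists>r. AE x in lebesgue. r \<le> norm x \<longrightarrow> norm (u t x) \<le> \<epsilon> / norm x ^ (?d + 1))"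
    unfolding smallo_def by (simp add: eventually_inf_at_infinity_ae del: power_Suc)
  have "(\<forall>\<epsilon>>0. \<exists>r. AE x in lebesgue. r \<le> norm x \<longrightarrow> norm (u t x) \<le> \<epsilon> / norm x ^ (?d + 1))
     \<longleftrightarrow> (\<forall>i j. Q i j = (\<Sum>k\<in>UNIV. Q k k) / real ?d * (if i = j then 1 else 0))" (is "?L \<longleftrightarrow> ?R")
  proof
    assume ?L
    have zero: "far_field Q (axis m 1) = 0" for m
      by (rule far_field_zero_of_small[OF R]) (use \<open>?L\<close> in auto)
    show ?R by (intro allI far_field_zero_imp_isotropic[of Q] Qsym zero)
  next
    assume iso: ?R
    show ?L
    proof (intro allI impI)
      fix \<epsilon> :: real assume \<epsilon>: "0 < \<epsilon>"
      \<comment> \<open>With the far field gone, the extra power in the error is worth \<epsilon>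
        once |x| reaches |R| / \<epsilon>.\<close>
      have "AE x in lebesgue. max 1 (\<bar>R\<bar> / \<epsilon>) \<le> norm x \<longrightarrow> norm (u t x) \<le> \<epsilon> / norm x ^ (?d + 1)"
        using R
      proof eventually_elim
        case (elim x)
        show ?case
        proof
          assume x: "max 1 (\<bar>R\<bar> / \<epsilon>) \<le> norm x"
          then have x1: "1 \<le> norm x" "\<bar>R\<bar> / \<epsilon> \<le> norm x" by auto
          then have x0: "x \<noteq> 0" "0 < norm x" by auto
          have "far_field Q x = 0" by (rule far_field_isotropic[OF x0(1)]) (use iso in blast)
          then have "norm (u t x) \<le> R / norm x ^ (?d + 2)" using elim x1 by simp
          also have "\<dots> \<le> (\<epsilon> * norm x) / norm x ^ (?d + 2)"
            using x1(2) \<epsilon> by (intro divide_right_mono) (auto simp: pos_divide_le_eq mult.commute)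
          also have "\<dots> = \<epsilon> / norm x ^ (?d + 1)" using x0 by simp
          finally show "norm (u t x) \<le> \<epsilon> / norm x ^ (?d + 1)" .
        qed
      qed
      then show "\<exists>r. AE x in lebesgue. r \<le> norm x \<longrightarrow> norm (u t x) \<le> \<epsilon> / norm x ^ (?d + 1)" ..
    qed
  qed
  then show ?thesis unfolding little_o norm_sq Q_def .
qed

end
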